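(* Let $E$ be a vector bundle with a bundle metric and a compatible (metric) connection over a Riemannian manifold $M$, let $p\in M$, and let $H=\mathrm{Hol}_p$ be the holonomy group of the connection at $p$. Let $L=L_p$ be the associated length norm on $H$. Then there exists a metrizable topology on $H$, namely the one coming from the length norm $L$ (induced by the metric $(a,b)\mapsto L(a^{-1}b)$), which is finer than the subspace topology of $H$ as a subgroup of $GL(E_p)$, such that the function $a\mapsto L(a)$ is continuous with respect to this topology and, furthermore, the group action $H\times E_p\to E_p$ remains continuous.
   Context: The holonomy group $\mathrm{Hol}_p\le GL(E_p)$ is the group of all parallel translations $P^\alpha_1:E_p\to E_p$ along piecewise smooth loops $\alpha:[0,1]\to M$ based at $p$. The length norm is $$L_p(a)=\inf\{\ell(\alpha):\alpha\text{ a piecewise smooth loop at }p\text{ with }P^\alpha_1=a\},$$ where $\ell$ is length with respect to the Riemannian metric of $M$. "Finer" is meant in the non-strict sense. *)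

theory Defs
  imports "HOL-Analysis.Analysis" "HOL-Algebra.Bij"
begin

section \<open>Smooth maps\<close>

text \<open>
  The sets \<open>S\<close> below are relatively open in a linear subspace of a Euclidean space, or relatively
  open in a nondegenerate compact interval (then the derivatives at the end points are one-sided).
  In the first case \<open>f' x\<close> is determined only along the subspace; since it is existentially
  quantified it can be taken to vanish on the orthogonal complement, so quantifying over all
  directions \<open>v\<close> does not add a condition.
\<close>

primrec Ck_on :: "nat \<Rightarrow> 'a::real_normed_vector set \<Rightarrow> ('a \<Rightarrow> 'b::real_normed_vector) \<Rightarrow> bool" where
  "Ck_on 0 S f = continuous_on S f"
| "Ck_on (Suc k) S f =
     (\<exists>f'. (\<forall>x\<in>S. (f has_derivative f' x) (at x within S)) \<and> (\<forall>v. Ck_on k S (\<lambda>x. f' x v)))"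

definition smooth_on :: "'a::real_normed_vector set \<Rightarrow> ('a \<Rightarrow> 'b::real_normed_vector) \<Rightarrow> bool" where
  "smooth_on S f \<longleftrightarrow> (\<forall>k. Ck_on k S f)"


section \<open>Smooth manifolds\<close>

text \<open>A chart consists of its domain and the coordinate map (relevant only on the domain).\<close>

type_synonym ('m, 'v) chart = "'m set \<times> ('m \<Rightarrow> 'v)"

text \<open>
  The model space is a linear subspace of a Euclidean space rather than the whole space, so that
  manifolds of every dimension, including 0, are covered.
\<close>

record ('m, 'v) manifold =
  mtop :: "'m topology"
  mmodel :: "'v set"
  atlas :: "('m, 'v) chart set"

definition chart_inv :: "('m, 'v) chart \<Rightarrow> 'v \<Rightarrow> 'm" where
  "chart_inv c = inv_into (fst c) (snd c)"

definition smooth_manifold :: "('m, 'v::euclidean_space) manifold \<Rightarrow> bool" where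
  "smooth_manifold M \<longleftrightarrow>
     Hausdorff_space (mtop M) \<and> second_countable (mtop M) \<and> subspace (mmodel M) \<and>
     (\<Union>c\<in>atlas M. fst c) = topspace (mtop M) \<and>
     (\<forall>(U, \<phi>)\<in>atlas M. openin (mtop M) U \<and> openin (top_of_set (mmodel M)) (\<phi> ` U) \<and>
        homeomorphic_map (subtopology (mtop M) U) (top_of_set (\<phi> ` U)) \<phi>) \<and>
     (\<forall>c\<in>atlas M. \<forall>c'\<in>atlas M. smooth_on (snd c ` (fst c \<inter> fst c')) (snd c' \<circ> chart_inv c))"

definition smooth_fun ::
  "('m, 'v::euclidean_space) manifold \<Rightarrow> 'm set \<Rightarrow> ('m \<Rightarrow> 'b::real_normed_vector) \<Rightarrow> bool" where
  "smooth_fun M U f \<longleftrightarrow> (\<forall>c\<in>atlas M. smooth_on (snd c ` (U \<inter> fst c)) (f \<circ> chart_inv c))"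

definition charts_at :: "('m, 'v) manifold \<Rightarrow> 'm \<Rightarrow> ('m, 'v) chart set" where
  "charts_at M p = {c \<in> atlas M. p \<in> fst c}"

text \<open>
  A tangent vector at \<open>p\<close> is given by its components in the charts at \<open>p\<close>, subject to the usual
  transformation law; the components are set to 0 for all other charts.
\<close>

type_synonym ('m, 'v) tvec = "('m, 'v) chart \<Rightarrow> 'v"

definition tangent_space :: "('m, 'v::euclidean_space) manifold \<Rightarrow> 'm \<Rightarrow> ('m, 'v) tvec set" where
  "tangent_space M p =
     {X. (\<forall>c\<in>charts_at M p. X c \<in> mmodel M) \<and> (\<forall>c. c \<notin> charts_at M p \<longrightarrow> X c = 0) \<and>
         (\<forall>c\<in>charts_at M p. \<forall>c'\<in>charts_at M p.
            X c' = frechet_derivative (snd c' \<circ> chart_inv c)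
                     (at (snd c p) within snd c ` (fst c \<inter> fst c')) (X c))}"

text \<open>The derivative \<open>X f\<close> of a function smooth near \<open>p\<close> (computed in any chart at \<open>p\<close>).\<close>

definition dir_deriv ::
  "('m, 'v::euclidean_space) manifold \<Rightarrow> 'm \<Rightarrow> ('m, 'v) tvec \<Rightarrow> ('m \<Rightarrow> real) \<Rightarrow> real" where
  "dir_deriv M p X f =
     (let c = (SOME c. c \<in> charts_at M p)
      in frechet_derivative (f \<circ> chart_inv c) (at (snd c p) within snd c ` fst c) (X c))"

definition smooth_vector_field ::
  "('m, 'v::euclidean_space) manifold \<Rightarrow> 'm set \<Rightarrow> ('m \<Rightarrow> ('m, 'v) tvec) \<Rightarrow> bool" where
  "smooth_vector_field M U X \<longleftrightarrow>
     (\<forall>q\<in>U. X q \<in> tangent_space M q) \<and>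
     (\<forall>c\<in>atlas M. smooth_on (snd c ` (U \<inter> fst c)) (\<lambda>x. X (chart_inv c x) c))"

definition riemannian_manifold ::
  "('m, 'v::euclidean_space) manifold \<Rightarrow> ('m \<Rightarrow> ('m, 'v) tvec \<Rightarrow> ('m, 'v) tvec \<Rightarrow> real) \<Rightarrow> bool" where
  "riemannian_manifold M g \<longleftrightarrow>
     smooth_manifold M \<and>
     (\<forall>p\<in>topspace (mtop M). \<forall>X\<in>tangent_space M p.
        (\<forall>Y\<in>tangent_space M p. g p X Y = g p Y X \<and>
           (\<forall>r. g p (\<lambda>c. r *\<^sub>R X c) Y = r * g p X Y) \<and>
           (\<forall>Z\<in>tangent_space M p. g p (\<lambda>c. X c + Z c) Y = g p X Y + g p Z Y)) \<and>
        (X \<noteq> (\<lambda>_. 0) \<longrightarrow> g p X X > 0)) \<and>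
     (\<forall>U X Y. openin (mtop M) U \<and> smooth_vector_field M U X \<and> smooth_vector_field M U Y \<longrightarrow>
        smooth_fun M U (\<lambda>q. g q (X q) (Y q)))"


section \<open>Curves\<close>

definition smooth_curve ::
  "('m, 'v::euclidean_space) manifold \<Rightarrow> real set \<Rightarrow> (real \<Rightarrow> 'm) \<Rightarrow> bool" where
  "smooth_curve M I \<alpha> \<longleftrightarrow>
     continuous_map (top_of_set I) (mtop M) \<alpha> \<and>
     (\<forall>c\<in>atlas M. smooth_on {t \<in> I. \<alpha> t \<in> fst c} (snd c \<circ> \<alpha>))"

definition velocity ::
  "('m, 'v::euclidean_space) manifold \<Rightarrow> real set \<Rightarrow> (real \<Rightarrow> 'm) \<Rightarrow> real \<Rightarrow> ('m, 'v) tvec" where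
  "velocity M I \<alpha> t =
     (\<lambda>c. if c \<in> charts_at M (\<alpha> t) then vector_derivative (snd c \<circ> \<alpha>) (at t within I) else 0)"

text \<open>The pairs of consecutive points of a finite subdivision.\<close>

definition pieces :: "real set \<Rightarrow> (real \<times> real) set" where
  "pieces T = {(a, b). a \<in> T \<and> b \<in> T \<and> a < b \<and> {a<..<b} \<inter> T = {}}"

definition smooth_subdivision ::
  "('m, 'v::euclidean_space) manifold \<Rightarrow> (real \<Rightarrow> 'm) \<Rightarrow> real set \<Rightarrow> bool" where
  "smooth_subdivision M \<alpha> T \<longleftrightarrow>
     finite T \<and> {0, 1} \<subseteq> T \<and> T \<subseteq> {0..1} \<and> (\<forall>(a, b)\<in>pieces T. smooth_curve M {a..b} \<alpha>)"

definition piecewise_smooth_loop ::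
  "('m, 'v::euclidean_space) manifold \<Rightarrow> 'm \<Rightarrow> (real \<Rightarrow> 'm) \<Rightarrow> bool" where
  "piecewise_smooth_loop M p \<alpha> \<longleftrightarrow> (\<exists>T. smooth_subdivision M \<alpha> T) \<and> \<alpha> 0 = p \<and> \<alpha> 1 = p"

text \<open>At the finitely many break points the integrand may be arbitrary.\<close>

definition curve_length ::
  "('m, 'v::euclidean_space) manifold \<Rightarrow> ('m \<Rightarrow> ('m, 'v) tvec \<Rightarrow> ('m, 'v) tvec \<Rightarrow> real) \<Rightarrow>
   (real \<Rightarrow> 'm) \<Rightarrow> real" where
  "curve_length M g \<alpha> =
     integral {0..1} (\<lambda>t. sqrt (g (\<alpha> t) (velocity M {0..1} \<alpha> t) (velocity M {0..1} \<alpha> t)))"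


section \<open>Vector bundles\<close>

text \<open>
  A local trivialization consists of an open set of the base and the fibre component
  \<open>\<Phi>\<close> of the trivializing map \<open>e \<mapsto> (proj e, \<Phi> e)\<close>. As for manifolds, the typical fibre is a linear
  subspace of a Euclidean space, which allows rank 0. The operations \<open>vadd\<close> and \<open>vscale\<close> are
  relevant only on vectors of the same fibre.
\<close>

record ('m, 'e, 'f) vbundle =
  etop :: "'e topology"
  proj :: "'e \<Rightarrow> 'm"
  fmodel :: "'f set"
  vadd :: "'e \<Rightarrow> 'e \<Rightarrow> 'e"
  vscale :: "real \<Rightarrow> 'e \<Rightarrow> 'e"
  trivs :: "('m set \<times> ('e \<Rightarrow> 'f)) set"

definition fibre :: "('m, 'e, 'f) vbundle \<Rightarrow> 'm \<Rightarrow> 'e set" where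
  "fibre E p = {e \<in> topspace (etop E). proj E e = p}"

text \<open>The local section that is constantly \<open>v\<close> in the trivialization \<open>\<Phi>\<close>.\<close>

definition const_section :: "('m, 'e, 'f) vbundle \<Rightarrow> ('e \<Rightarrow> 'f) \<Rightarrow> 'f \<Rightarrow> 'm \<Rightarrow> 'e" where
  "const_section E \<Phi> v q = inv_into (fibre E q) \<Phi> v"

text \<open>
  The last condition says that the transition functions into \<open>GL(fmodel E)\<close> are smooth. The vector
  space axioms on the fibres follow, since \<open>\<Phi>\<close> is a bijection of each fibre onto \<open>fmodel E\<close>
  that respects the operations.
\<close>

definition vector_bundle ::
  "('m, 'v::euclidean_space) manifold \<Rightarrow> ('m, 'e, 'f::euclidean_space) vbundle \<Rightarrow> bool" where
  "vector_bundle M E \<longleftrightarrow>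
     subspace (fmodel E) \<and> continuous_map (etop E) (mtop M) (proj E) \<and>
     (\<Union>\<tau>\<in>trivs E. fst \<tau>) = topspace (mtop M) \<and>
     (\<forall>(U, \<Phi>)\<in>trivs E. openin (mtop M) U \<and>
        homeomorphic_map (subtopology (etop E) {e \<in> topspace (etop E). proj E e \<in> U})
          (prod_topology (subtopology (mtop M) U) (top_of_set (fmodel E)))
          (\<lambda>e. (proj E e, \<Phi> e)) \<and>
        (\<forall>q\<in>U. \<forall>e\<in>fibre E q.
           (\<forall>e'\<in>fibre E q. vadd E e e' \<in> fibre E q \<and> \<Phi> (vadd E e e') = \<Phi> e + \<Phi> e') \<and>
           (\<forall>r. vscale E r e \<in> fibre E q \<and> \<Phi> (vscale E r e) = r *\<^sub>R \<Phi> e))) \<and>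
     (\<forall>(U, \<Phi>)\<in>trivs E. \<forall>(W, \<Psi>)\<in>trivs E. \<forall>v\<in>fmodel E.
        smooth_fun M (U \<inter> W) (\<lambda>q. \<Psi> (const_section E \<Phi> v q)))"

definition smooth_section ::
  "('m, 'v::euclidean_space) manifold \<Rightarrow> ('m, 'e, 'f::euclidean_space) vbundle \<Rightarrow> 'm set \<Rightarrow>
   ('m \<Rightarrow> 'e) \<Rightarrow> bool" where
  "smooth_section M E U s \<longleftrightarrow>
     (\<forall>q\<in>U. s q \<in> fibre E q) \<and> (\<forall>(W, \<Phi>)\<in>trivs E. smooth_fun M (U \<inter> W) (\<Phi> \<circ> s))"

definition bundle_metric ::
  "('m, 'v::euclidean_space) manifold \<Rightarrow> ('m, 'e, 'f::euclidean_space) vbundle \<Rightarrow>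
   ('e \<Rightarrow> 'e \<Rightarrow> real) \<Rightarrow> bool" where
  "bundle_metric M E h \<longleftrightarrow>
     (\<forall>p\<in>topspace (mtop M). \<forall>e\<in>fibre E p.
        (\<forall>e'\<in>fibre E p. h e e' = h e' e \<and>
           (\<forall>r. h (vscale E r e) e' = r * h e e') \<and>
           (\<forall>e''\<in>fibre E p. h (vadd E e e'') e' = h e e' + h e'' e')) \<and>
        (e \<noteq> vscale E 0 e \<longrightarrow> h e e > 0)) \<and>
     (\<forall>U s s'. openin (mtop M) U \<and> smooth_section M E U s \<and> smooth_section M E U s' \<longrightarrow>
        smooth_fun M U (\<lambda>q. h (s q) (s' q)))"


section \<open>Connections and parallel translation\<close>

text \<open>
  A connection is a covariant derivative acting on local smooth sections: \<open>nabla s p X\<close> is the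
  derivative of \<open>s\<close> at \<open>p\<close> in the direction of the tangent vector \<open>X\<close> at \<open>p\<close>. It is linear in \<open>X\<close>,
  additive and Leibniz in \<open>s\<close>, maps smooth data to smooth sections, and depends only on the
  restriction of \<open>s\<close> to any neighbourhood of \<open>p\<close> (because \<open>U\<close> is an arbitrary open set on which
  \<open>s\<close> is smooth).
\<close>

definition connection ::
  "('m, 'v::euclidean_space) manifold \<Rightarrow> ('m, 'e, 'f::euclidean_space) vbundle \<Rightarrow>
   (('m \<Rightarrow> 'e) \<Rightarrow> 'm \<Rightarrow> ('m, 'v) tvec \<Rightarrow> 'e) \<Rightarrow> bool" where
  "connection M E nabla \<longleftrightarrow>
     (\<forall>U s. openin (mtop M) U \<and> smooth_section M E U s \<longrightarrow>
        (\<forall>p\<in>U. \<forall>X\<in>tangent_space M p.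
           nabla s p X \<in> fibre E p \<and>
           (\<forall>Y\<in>tangent_space M p.
              nabla s p (\<lambda>c. X c + Y c) = vadd E (nabla s p X) (nabla s p Y)) \<and>
           (\<forall>r. nabla s p (\<lambda>c. r *\<^sub>R X c) = vscale E r (nabla s p X)) \<and>
           (\<forall>s'. smooth_section M E U s' \<longrightarrow>
              nabla (\<lambda>q. vadd E (s q) (s' q)) p X = vadd E (nabla s p X) (nabla s' p X)) \<and>
           (\<forall>f :: 'm \<Rightarrow> real. smooth_fun M U f \<longrightarrow>
              nabla (\<lambda>q. vscale E (f q) (s q)) p X =
              vadd E (vscale E (f p) (nabla s p X)) (vscale E (dir_deriv M p X f) (s p))) \<and>
           (\<forall>s'. smooth_section M E U s' \<and> (\<forall>q\<in>U. s' q = s q) \<longrightarrow> nabla s' p X = nabla s p X)) \<and>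
        (\<forall>X. smooth_vector_field M U X \<longrightarrow> smooth_section M E U (\<lambda>q. nabla s q (X q))))"

definition metric_connection ::
  "('m, 'v::euclidean_space) manifold \<Rightarrow> ('m, 'e, 'f::euclidean_space) vbundle \<Rightarrow>
   ('e \<Rightarrow> 'e \<Rightarrow> real) \<Rightarrow> (('m \<Rightarrow> 'e) \<Rightarrow> 'm \<Rightarrow> ('m, 'v) tvec \<Rightarrow> 'e) \<Rightarrow> bool" where
  "metric_connection M E h nabla \<longleftrightarrow>
     connection M E nabla \<and>
     (\<forall>U s s'. openin (mtop M) U \<and> smooth_section M E U s \<and> smooth_section M E U s' \<longrightarrow>
        (\<forall>p\<in>U. \<forall>X\<in>tangent_space M p.
           dir_deriv M p X (\<lambda>q. h (s q) (s' q)) = h (nabla s p X) (s' p) + h (s p) (nabla s' p X)))"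

text \<open>
  \<open>has_covariant_derivative M E nabla I \<alpha> s t w\<close>: the covariant derivative of the section \<open>s\<close> along
  \<open>\<alpha>\<close> at \<open>t\<close>, one-sided at the end points of the interval \<open>I\<close>, is \<open>w\<close>. Writing
  \<open>s = (\<Sum>i. y\<^sub>i e\<^sub>i)\<close> in a frame that is constant in a trivialization \<open>\<Phi>\<close>, it is
  \<open>\<Sum>i. y\<^sub>i' e\<^sub>i + y\<^sub>i \<nabla>\<^bsub>\<alpha>'\<^esub> e\<^sub>i\<close>; the second sum is \<open>\<nabla>\<^bsub>\<alpha>'\<^esub>\<close> of the section
  that is constantly \<open>\<Phi> (s t)\<close> in the trivialization.
\<close>

definition has_covariant_derivative ::
  "('m, 'v::euclidean_space) manifold \<Rightarrow> ('m, 'e, 'f::euclidean_space) vbundle \<Rightarrow>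
   (('m \<Rightarrow> 'e) \<Rightarrow> 'm \<Rightarrow> ('m, 'v) tvec \<Rightarrow> 'e) \<Rightarrow> real set \<Rightarrow> (real \<Rightarrow> 'm) \<Rightarrow> (real \<Rightarrow> 'e) \<Rightarrow>
   real \<Rightarrow> 'e \<Rightarrow> bool" where
  "has_covariant_derivative M E nabla I \<alpha> s t w \<longleftrightarrow>
     w \<in> fibre E (\<alpha> t) \<and>
     (\<forall>(U, \<Phi>)\<in>trivs E. \<alpha> t \<in> U \<longrightarrow>
        (\<exists>y'. ((\<Phi> \<circ> s) has_vector_derivative y') (at t within I) \<and>
          \<Phi> w = y' + \<Phi> (nabla (const_section E \<Phi> (\<Phi> (s t))) (\<alpha> t) (velocity M I \<alpha> t))))"

text \<open>Here \<open>vscale E 0 (s t)\<close> is the zero vector of the fibre over \<open>\<alpha> t\<close>.\<close>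

definition parallel_along ::
  "('m, 'v::euclidean_space) manifold \<Rightarrow> ('m, 'e, 'f::euclidean_space) vbundle \<Rightarrow>
   (('m \<Rightarrow> 'e) \<Rightarrow> 'm \<Rightarrow> ('m, 'v) tvec \<Rightarrow> 'e) \<Rightarrow> (real \<Rightarrow> 'm) \<Rightarrow> (real \<Rightarrow> 'e) \<Rightarrow> bool" where
  "parallel_along M E nabla \<alpha> s \<longleftrightarrow>
     (\<forall>t\<in>{0..1}. s t \<in> fibre E (\<alpha> t)) \<and>
     (\<exists>T. smooth_subdivision M \<alpha> T \<and>
        (\<forall>(a, b)\<in>pieces T. \<forall>t\<in>{a..b}.
           has_covariant_derivative M E nabla {a..b} \<alpha> s t (vscale E 0 (s t))))"

text \<open>
  \<open>P\<close> is the parallel translation \<open>P\<^sup>\<alpha>\<^sub>1\<close> along \<open>\<alpha>\<close> from the fibre over \<open>\<alpha> 0\<close> to the fibre over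
  \<open>\<alpha> 1\<close>: it sends \<open>s 0\<close> to \<open>s 1\<close> for the parallel sections \<open>s\<close> along \<open>\<alpha>\<close>.
\<close>

definition is_parallel_translation ::
  "('m, 'v::euclidean_space) manifold \<Rightarrow> ('m, 'e, 'f::euclidean_space) vbundle \<Rightarrow>
   (('m \<Rightarrow> 'e) \<Rightarrow> 'm \<Rightarrow> ('m, 'v) tvec \<Rightarrow> 'e) \<Rightarrow> (real \<Rightarrow> 'm) \<Rightarrow> ('e \<Rightarrow> 'e) \<Rightarrow> bool" where
  "is_parallel_translation M E nabla \<alpha> P \<longleftrightarrow>
     P \<in> extensional (fibre E (\<alpha> 0)) \<and>
     (\<forall>e\<in>fibre E (\<alpha> 0). \<exists>s. parallel_along M E nabla \<alpha> s \<and> s 0 = e \<and> s 1 = P e)"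


section \<open>The holonomy group and the length norm\<close>

definition GL :: "('m, 'e, 'f) vbundle \<Rightarrow> 'm \<Rightarrow> ('e \<Rightarrow> 'e) monoid" where
  "GL E p = (BijGroup (fibre E p))\<lparr>carrier :=
     {a \<in> Bij (fibre E p). \<forall>e\<in>fibre E p.
        (\<forall>e'\<in>fibre E p. a (vadd E e e') = vadd E (a e) (a e')) \<and>
        (\<forall>r. a (vscale E r e) = vscale E r (a e))}\<rparr>"

text \<open>
  The usual topology of \<open>GL(E\<^sub>p)\<close>, given by the operator norm for the inner product \<open>h\<close> on the
  finite-dimensional space \<open>E\<^sub>p\<close>. The locale \<open>Metric_space\<close> asks for nonnegativity and symmetry on the
  whole type; hence the value 0 off the carrier, here and in \<open>length_dist\<close>.
\<close>

definition op_dist ::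
  "('m, 'e, 'f) vbundle \<Rightarrow> ('e \<Rightarrow> 'e \<Rightarrow> real) \<Rightarrow> 'm \<Rightarrow> ('e \<Rightarrow> 'e) \<Rightarrow> ('e \<Rightarrow> 'e) \<Rightarrow> real" where
  "op_dist E h p a b =
     (if a \<in> carrier (GL E p) \<and> b \<in> carrier (GL E p)
      then SUP e\<in>{e \<in> fibre E p. h e e \<le> 1}.
             (let d = vadd E (a e) (vscale E (-1) (b e)) in sqrt (h d d))
      else 0)"

definition GL_topology ::
  "('m, 'e, 'f) vbundle \<Rightarrow> ('e \<Rightarrow> 'e \<Rightarrow> real) \<Rightarrow> 'm \<Rightarrow> ('e \<Rightarrow> 'e) topology" where
  "GL_topology E h p = Metric_space.mtopology (carrier (GL E p)) (op_dist E h p)"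

definition Hol ::
  "('m, 'v::euclidean_space) manifold \<Rightarrow> ('m, 'e, 'f::euclidean_space) vbundle \<Rightarrow>
   (('m \<Rightarrow> 'e) \<Rightarrow> 'm \<Rightarrow> ('m, 'v) tvec \<Rightarrow> 'e) \<Rightarrow> 'm \<Rightarrow> ('e \<Rightarrow> 'e) set" where
  "Hol M E nabla p =
     {a \<in> carrier (GL E p).
        \<exists>\<alpha>. piecewise_smooth_loop M p \<alpha> \<and> is_parallel_translation M E nabla \<alpha> a}"

definition length_norm ::
  "('m, 'v::euclidean_space) manifold \<Rightarrow> ('m \<Rightarrow> ('m, 'v) tvec \<Rightarrow> ('m, 'v) tvec \<Rightarrow> real) \<Rightarrow>
   ('m, 'e, 'f::euclidean_space) vbundle \<Rightarrow> (('m \<Rightarrow> 'e) \<Rightarrow> 'm \<Rightarrow> ('m, 'v) tvec \<Rightarrow> 'e) \<Rightarrow>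
   'm \<Rightarrow> ('e \<Rightarrow> 'e) \<Rightarrow> real" where
  "length_norm M g E nabla p a =
     Inf {curve_length M g \<alpha> |\<alpha>.
            piecewise_smooth_loop M p \<alpha> \<and> is_parallel_translation M E nabla \<alpha> a}"

definition length_dist ::
  "('m, 'v::euclidean_space) manifold \<Rightarrow> ('m \<Rightarrow> ('m, 'v) tvec \<Rightarrow> ('m, 'v) tvec \<Rightarrow> real) \<Rightarrow>
   ('m, 'e, 'f::euclidean_space) vbundle \<Rightarrow> (('m \<Rightarrow> 'e) \<Rightarrow> 'm \<Rightarrow> ('m, 'v) tvec \<Rightarrow> 'e) \<Rightarrow>
   'm \<Rightarrow> ('e \<Rightarrow> 'e) \<Rightarrow> ('e \<Rightarrow> 'e) \<Rightarrow> real" where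
  "length_dist M g E nabla p a b =
     (if a \<in> Hol M E nabla p \<and> b \<in> Hol M E nabla p
      then length_norm M g E nabla p (inv\<^bsub>GL E p\<^esub> a \<otimes>\<^bsub>GL E p\<^esub> b)
      else 0)"

end

theory Submission
  imports Defs
begin

text \<open>
  Concatenation, reversal and constant loops show that the holonomy group is a group and that \<open>L\<close> is
  nonnegative, symmetric and subadditive with \<open>L 1 = 0\<close>. Everything else rests on one estimate: a loop
  at \<open>p\<close> of length \<open>l\<close>, if \<open>l\<close> is small, never leaves a compact coordinate ball around \<open>p\<close> over which
  the bundle is trivial; there the metric dominates the Euclidean one and the connection form is
  bounded, so that a parallel section \<open>y\<close>, written in the trivialization, satisfies
  \<open>\<bar>y'\<bar> \<le> C \<bar>\<alpha>'\<bar> \<bar>y\<bar>\<close> and hence \<open>\<bar>y 1 - y 0\<bar> \<le> 2 C l \<bar>y 0\<bar>\<close>. Thus \<open>L a\<close> small forces \<open>a\<close> to be close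
  to the identity, which gives definiteness of \<open>L\<close>, the comparison with the operator norm and, by
  left translation, continuity of the action. Neither existence nor uniqueness of parallel
  translation is used, because \<open>Hol\<close> and \<open>L\<close> only refer to parallel sections that exist.
\<close>

section \<open>Calculus on subsets of normed spaces\<close>

text \<open>The estimate is kept in the relative form \<open>norm (\<Phi> (s 1) - \<Phi> (s 0))
  \<le> \<rho> * norm (\<Phi> (s 0))\<close>: it is homogeneous in the vector, hence uniform over
  the fibre, so that one \<delta> controls a whole operator. For left translation put c = a^{-1} b;
  then a e - b e = a (e - c e), and the fixed operator a is Lipschitz in the trivialization. Two
  obstacles shape the preparations. Derivatives relative to an open subset of a subspace are
  determined only in the directions of that subspace, so transition derivatives can be composed and
  compared only on vectors of the model space. And the metric and the connection act on abstract
  vectors and sections; charts and constant sections turn them into families of bilinear maps on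
  Euclidean subspaces, where expansions in a finite frame reduce continuity and bounds to finitely
  many coefficients. That a short curve stays in the coordinate ball is not a purely local matter:
  in the limit it might leave the chart domain. The Hausdorff property excludes this, because it
  makes the compact ball closed in all of \<open>M\<close>.\<close>

lemma Ck_on_cong:
  assumes "Ck_on k S f" "\<And>x. x \<in> S \<Longrightarrow> g x = f x"
  shows "Ck_on k S g"
proof (cases k)
  case 0
  then show ?thesis using assms by (auto cong: continuous_on_cong)
next
  case (Suc j)
  then obtain f' where f': "\<forall>x\<in>S. (f has_derivative f' x) (at x within S)"
    "\<forall>v. Ck_on j S (\<lambda>x. f' x v)" using assms(1) by auto
  have "\<forall>x\<in>S. (g has_derivative f' x) (at x within S)"
    using f'(1) assms(2) by (auto intro: has_derivative_transform)
  then show ?thesis using Suc f'(2) by auto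
qed

lemma Ck_on_SucD: "Ck_on (Suc k) S f \<Longrightarrow> Ck_on k S f"
proof (induction k arbitrary: f)
  case 0
  then show ?case
    by (auto intro: has_derivative_continuous_on)
next
  case (Suc k)
  then obtain f' where f': "\<forall>x\<in>S. (f has_derivative f' x) (at x within S)"
    "\<forall>v. Ck_on (Suc k) S (\<lambda>x. f' x v)" by (auto simp del: Ck_on.simps(2) simp: Ck_on.simps(2)[of "Suc k"])
  then show ?case using Suc.IH by (auto simp: Ck_on.simps(2)[of k] simp del: Ck_on.simps(2))
qed

lemma Ck_on_continuous: "Ck_on k S f \<Longrightarrow> continuous_on S f"
proof (induction k)
  case (Suc k)
  then show ?case using Ck_on_SucD by blast
qed simp

lemma Ck_on_subset: "Ck_on k S f \<Longrightarrow> T \<subseteq> S \<Longrightarrow> Ck_on k T f"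
proof (induction k arbitrary: f)
  case 0
  then show ?case by (auto intro: continuous_on_subset)
next
  case (Suc k)
  then obtain f' where f': "\<forall>x\<in>S. (f has_derivative f' x) (at x within S)"
    "\<forall>v. Ck_on k S (\<lambda>x. f' x v)" by auto
  then have "\<forall>x\<in>T. (f has_derivative f' x) (at x within T)"
    using Suc.prems by (auto intro: has_derivative_subset)
  then show ?case using f'(2) Suc by auto
qed

lemma Ck_on_const: "Ck_on k S (\<lambda>x. c)"
proof (induction k arbitrary: c)
  case (Suc k)
  then show ?case by (auto intro!: exI[of _ "\<lambda>x v. 0"])
qed simp

lemma Ck_on_bounded_linear:
  assumes "bounded_linear L"
  shows "Ck_on k S f \<Longrightarrow> Ck_on k S (\<lambda>x. L (f x))"
proof (induction k arbitrary: f)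
  case 0
  then show ?case by (auto intro: bounded_linear.continuous_on[OF assms])
next
  case (Suc k)
  then obtain f' where f': "\<forall>x\<in>S. (f has_derivative f' x) (at x within S)"
    "\<forall>v. Ck_on k S (\<lambda>x. f' x v)" by auto
  then have "\<forall>x\<in>S. ((\<lambda>x. L (f x)) has_derivative (\<lambda>v. L (f' x v))) (at x within S)"
    by (auto intro: bounded_linear.has_derivative[OF assms])
  then show ?case using f'(2) Suc by (auto intro!: exI[of _ "\<lambda>x v. L (f' x v)"])
qed

lemma Ck_on_add: "Ck_on k S f \<Longrightarrow> Ck_on k S g \<Longrightarrow> Ck_on k S (\<lambda>x. f x + g x)"
proof (induction k arbitrary: f g)
  case 0
  then show ?case by (auto intro: continuous_intros)
next
  case (Suc k)
  then obtain f' g' where f': "\<forall>x\<in>S. (f has_derivative f' x) (at x within S)"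
    "\<forall>v. Ck_on k S (\<lambda>x. f' x v)" and g': "\<forall>x\<in>S. (g has_derivative g' x) (at x within S)"
    "\<forall>v. Ck_on k S (\<lambda>x. g' x v)" by auto
  then have "\<forall>x\<in>S. ((\<lambda>x. f x + g x) has_derivative (\<lambda>v. f' x v + g' x v)) (at x within S)"
    by (auto intro: has_derivative_add)
  then show ?case using f'(2) g'(2) Suc by (auto intro!: exI[of _ "\<lambda>x v. f' x v + g' x v"])
qed

lemma Ck_on_sum: "(\<And>i. i \<in> I \<Longrightarrow> Ck_on k S (f i)) \<Longrightarrow> Ck_on k S (\<lambda>x. \<Sum>i\<in>I. f i x)"
  by (induction I rule: infinite_finite_induct) (auto intro: Ck_on_const Ck_on_add)

lemma Ck_on_scaleR:
  fixes f :: "'a::real_normed_vector \<Rightarrow> real"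
  shows "Ck_on k S f \<Longrightarrow> Ck_on k S g \<Longrightarrow> Ck_on k S (\<lambda>x. f x *\<^sub>R g x)"
proof (induction k arbitrary: f g)
  case 0
  then show ?case by (auto intro: continuous_intros)
next
  case (Suc k)
  then obtain f' g' where f': "\<forall>x\<in>S. (f has_derivative f' x) (at x within S)"
    "\<forall>v. Ck_on k S (\<lambda>x. f' x v)" and g': "\<forall>x\<in>S. (g has_derivative g' x) (at x within S)"
    "\<forall>v. Ck_on k S (\<lambda>x. g' x v)" by auto
  have "\<forall>x\<in>S. ((\<lambda>x. f x *\<^sub>R g x) has_derivative (\<lambda>v. f x *\<^sub>R g' x v + f' x v *\<^sub>R g x)) (at x within S)"
    using f' g' by (auto intro: has_derivative_scaleR)
  moreover have "Ck_on k S (\<lambda>x. f x *\<^sub>R g' x v + f' x v *\<^sub>R g x)" for v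
    using Suc f' g' by (intro Ck_on_add Suc.IH) (auto intro: Ck_on_SucD simp del: Ck_on.simps)
  ultimately show ?case by (auto intro!: exI[of _ "\<lambda>x v. f x *\<^sub>R g' x v + f' x v *\<^sub>R g x"])
qed

text \<open>The derivative \<open>g' (f x) (f' x v)\<close> applies \<open>g'\<close> to a direction
  that moves with \<open>x\<close>, while \<open>Ck_on\<close> controls \<open>g'\<close> in fixed
  directions. Expanding \<open>f' x v\<close> in \<open>Basis\<close> turns it into a sum of
  products to which the induction hypothesis applies.\<close>

lemma Ck_on_compose:
  fixes f :: "'a::real_normed_vector \<Rightarrow> 'b::euclidean_space"
  shows "Ck_on k T g \<Longrightarrow> Ck_on k S f \<Longrightarrow> f ` S \<subseteq> T \<Longrightarrow> Ck_on k S (\<lambda>x. g (f x))"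
proof (induction k arbitrary: g)
  case 0
  then show ?case by (auto intro: continuous_on_compose2)
next
  case (Suc k)
  then obtain f' g' where f': "\<forall>x\<in>S. (f has_derivative f' x) (at x within S)"
    "\<forall>v. Ck_on k S (\<lambda>x. f' x v)" and g': "\<forall>x\<in>T. (g has_derivative g' x) (at x within T)"
    "\<forall>v. Ck_on k T (\<lambda>x. g' x v)" by auto
  have "((\<lambda>x. g (f x)) has_derivative (\<lambda>v. g' (f x) (f' x v))) (at x within S)" if "x \<in> S" for x
    using that f' g' Suc.prems(3)
    by (intro has_derivative_in_compose2[of T g g' f S x "f' x"]) auto
  moreover have "Ck_on k S (\<lambda>x. g' (f x) (f' x v))" for v
  proof (rule Ck_on_cong)
    show "Ck_on k S (\<lambda>x. \<Sum>b\<in>Basis. (f' x v \<bullet> b) *\<^sub>R g' (f x) b)"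
      using f' g' Suc.IH[OF _ Ck_on_SucD[OF Suc.prems(2)] Suc.prems(3)]
      by (intro Ck_on_sum Ck_on_scaleR Ck_on_bounded_linear[OF bounded_linear_inner_left])
        (blast+)
  next
    fix x assume "x \<in> S"
    then have "linear (g' (f x))"
      using g'(1) Suc.prems(3) has_derivative_linear by blast
    then show "g' (f x) (f' x v) = (\<Sum>b\<in>Basis. (f' x v \<bullet> b) *\<^sub>R g' (f x) b)"
      by (subst euclidean_representation[of "f' x v", symmetric]) (simp add: linear_sum linear_scale)
  qed
  ultimately show ?case by (auto intro!: exI[of _ "\<lambda>x v. g' (f x) (f' x v)"])
qed

lemma Ck_on_affine: "Ck_on k S (\<lambda>t::real. m * t + c)"
proof (cases k)
  case (Suc j)
  have "((\<lambda>t::real. m * t + c) has_derivative (\<lambda>v. m * v)) (at x within S)" for x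
    by (auto intro!: derivative_eq_intros)
  then show ?thesis unfolding Suc by (auto intro!: exI[of _ "\<lambda>x v. m * v"] Ck_on_const)
qed (auto intro: continuous_intros)

lemma smooth_on_imp_continuous: "smooth_on S f \<Longrightarrow> continuous_on S f"
  unfolding smooth_on_def using Ck_on_continuous by blast

lemma smooth_on_imp_has_derivative:
  assumes "smooth_on S f" "x \<in> S"
  shows "(f has_derivative frechet_derivative f (at x within S)) (at x within S)"
proof -
  have "Ck_on 1 S f" using assms by (simp add: smooth_on_def del: Ck_on.simps)
  then have "f differentiable (at x within S)" using assms(2) by (auto simp: differentiable_def)
  then show ?thesis by (simp add: frechet_derivative_works)
qed

lemma smooth_on_cong: "smooth_on S f \<Longrightarrow> (\<And>x. x \<in> S \<Longrightarrow> g x = f x) \<Longrightarrow> smooth_on S g"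
  unfolding smooth_on_def using Ck_on_cong by blast

lemma smooth_on_compose:
  fixes f :: "'a::real_normed_vector \<Rightarrow> 'b::euclidean_space"
  shows "smooth_on T g \<Longrightarrow> smooth_on S f \<Longrightarrow> f ` S \<subseteq> T \<Longrightarrow> smooth_on S (\<lambda>x. g (f x))"
  unfolding smooth_on_def using Ck_on_compose by blast

text \<open>Near \<open>x\<close> the line in a direction of \<open>V\<close> stays in
  \<open>S\<close>, so a derivative relative to \<open>S\<close> becomes one at an interior point of
  the real line, where it is unique.\<close>

lemma has_derivative_along_line:
  fixes f :: "'a::euclidean_space \<Rightarrow> 'b::real_normed_vector"
  assumes V: "subspace V" and S: "openin (top_of_set V) S" and x: "x \<in> S" and v: "v \<in> V"
    and d: "(f has_derivative f') (at x within S)"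
  shows "\<exists>e>0. (\<forall>t. \<bar>t\<bar> < e \<longrightarrow> x + t *\<^sub>R v \<in> S) \<and>
           ((\<lambda>t. f (x + t *\<^sub>R v)) has_vector_derivative f' v) (at 0)"
proof -
  obtain O' where O': "open O'" "S = V \<inter> O'" using S by (auto simp: openin_open)
  have "open ((\<lambda>t. x + t *\<^sub>R v) -` O')"
    by (intro open_vimage O') (auto intro!: continuous_intros)
  moreover have "0 \<in> (\<lambda>t. x + t *\<^sub>R v) -` O'" using x O' by simp
  ultimately obtain e where e: "e > 0" "ball 0 e \<subseteq> (\<lambda>t. x + t *\<^sub>R v) -` O'"
    by (meson open_contains_ball)
  have inS: "x + t *\<^sub>R v \<in> S" if "\<bar>t\<bar> < e" for t
  proof -
    have "t \<in> ball 0 e" using that by simp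
    then have "x + t *\<^sub>R v \<in> O'" using e(2) by blast
    then show ?thesis using V v x O'(2) by (auto simp: subspace_add subspace_mul)
  qed
  have "((\<lambda>t. f (x + t *\<^sub>R v)) has_derivative (\<lambda>t. f' (t *\<^sub>R v))) (at 0 within ball 0 e)"
  proof (rule has_derivative_in_compose[of "\<lambda>t. x + t *\<^sub>R v" "\<lambda>t. t *\<^sub>R v" 0 "ball 0 e" f f'])
    show "((\<lambda>t. x + t *\<^sub>R v) has_derivative (\<lambda>t. t *\<^sub>R v)) (at 0 within ball 0 e)"
      by (auto intro!: derivative_eq_intros)
    have "(\<lambda>t. x + t *\<^sub>R v) ` ball 0 e \<subseteq> S" using inS by auto
    then show "(f has_derivative f') (at (x + 0 *\<^sub>R v) within (\<lambda>t. x + t *\<^sub>R v) ` ball 0 e)"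
      using d by (auto intro: has_derivative_subset)
  qed
  moreover have "f' (t *\<^sub>R v) = t *\<^sub>R f' v" for t
    using d has_derivative_linear linear_scale by blast
  moreover have "at (0::real) within ball 0 e = at 0"
    by (rule at_within_open) (use e in auto)
  ultimately show ?thesis using e(1) inS by (auto simp: has_vector_derivative_def)
qed

text \<open>Relative to an open subset of \<open>V\<close>, derivatives are determined only in the directions of \<open>V\<close>.\<close>

lemma has_derivative_unique_subspace:
  fixes f :: "'a::euclidean_space \<Rightarrow> 'b::real_normed_vector"
  assumes V: "subspace V" "openin (top_of_set V) S" "x \<in> S" "v \<in> V"
    and "(f has_derivative f') (at x within S)" "(f has_derivative f'') (at x within S)"
  shows "f' v = f'' v"
  using has_derivative_along_line[OF V assms(5)] has_derivative_along_line[OF V assms(6)]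
  by (metis vector_derivative_at)

text \<open>\<open>frechet_derivative\<close> chooses one of possibly several derivatives; on
  vectors of \<open>V\<close> the choice is immaterial.\<close>

lemma frechet_derivative_subspace:
  fixes f :: "'a::euclidean_space \<Rightarrow> 'b::real_normed_vector"
  assumes V: "subspace V" "openin (top_of_set V) S" "x \<in> S" "v \<in> V"
    and d: "(f has_derivative f') (at x within S)"
  shows "frechet_derivative f (at x within S) v = f' v"
  using has_derivative_unique_subspace[OF V _ d] frechet_derivative_works differentiableI[OF d] by metis

text \<open>The difference quotients lie in \<open>V\<close>, which is closed. This keeps velocities
  and derivatives of transition maps inside the model space.\<close>

lemma has_vector_derivative_in_closed_subspace:
  fixes f :: "real \<Rightarrow> 'b::euclidean_space"
  assumes V: "subspace V" and d: "(f has_vector_derivative y) (at t within I)"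
    and nt: "at t within I \<noteq> bot" and f: "t \<in> I" "\<And>s. s \<in> I \<Longrightarrow> f s \<in> V"
  shows "y \<in> V"
proof (rule Lim_in_closed_set[OF closed_subspace[OF V] _ nt])
  show "((\<lambda>s. (f s - f t) /\<^sub>R (s - t)) \<longlongrightarrow> y) (at t within I)"
  proof (rule Lim_null[THEN iffD2], rule tendsto_norm_zero_cancel)
    have *: "((\<lambda>s. norm ((f s - f t) - (s - t) *\<^sub>R y) / norm (s - t)) \<longlongrightarrow> 0) (at t within I)"
      using d by (simp add: has_vector_derivative_def has_derivative_iff_norm)
    have "norm ((f s - f t) /\<^sub>R (s - t) - y) = norm ((f s - f t) - (s - t) *\<^sub>R y) / norm (s - t)"
      if "s \<noteq> t" for s
    proof -
      have "(f s - f t) /\<^sub>R (s - t) - y = ((f s - f t) - (s - t) *\<^sub>R y) /\<^sub>R (s - t)"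
        using that by (simp add: scaleR_diff_right)
      then show ?thesis by (simp add: divide_inverse_commute)
    qed
    then have "\<forall>\<^sub>F s in at t within I. norm ((f s - f t) - (s - t) *\<^sub>R y) / norm (s - t) =
       norm ((f s - f t) /\<^sub>R (s - t) - y)"
      by (auto simp: eventually_at_filter)
    then show "((\<lambda>s. norm ((f s - f t) /\<^sub>R (s - t) - y)) \<longlongrightarrow> 0) (at t within I)"
      using * by (rule Lim_transform_eventually[rotated])
  qed
  show "\<forall>\<^sub>F s in at t within I. (f s - f t) /\<^sub>R (s - t) \<in> V"
    using f V by (auto simp: eventually_at_filter subspace_diff subspace_mul)
qed

section \<open>Linear maps and forms on subspaces\<close>

text \<open>An orthonormal basis of \<open>V\<close> is the intended instance; the reproducing
  formula is what later expansions into finitely many coefficients use.\<close>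

definition parseval_frame :: "'a::euclidean_space set \<Rightarrow> 'a set \<Rightarrow> bool" where
  "parseval_frame V B \<longleftrightarrow> finite B \<and> B \<subseteq> V \<and> (\<forall>v\<in>V. (\<Sum>b\<in>B. (v \<bullet> b) *\<^sub>R b) = v)"

text \<open>Linearity is asked on \<open>V\<close> alone, since forms read in a chart or a
  trivialization have no meaningful values off the model space.\<close>

definition lin_on :: "'a::real_vector set \<Rightarrow> ('a \<Rightarrow> 'b::real_vector) \<Rightarrow> bool" where
  "lin_on V F \<longleftrightarrow> (\<forall>u\<in>V. (\<forall>v\<in>V. F (u + v) = F u + F v) \<and> (\<forall>r. F (r *\<^sub>R u) = r *\<^sub>R F u))"

lemma parseval_frame_exists:
  assumes "subspace V" obtains B where "parseval_frame V B"
proof -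
  obtain B where B: "B \<subseteq> V" "pairwise orthogonal B" "\<And>x. x \<in> B \<Longrightarrow> norm x = 1"
    "independent B" "card B = dim V" "span B = V"
    using orthonormal_basis_subspace[OF assms] by blast
  have fin: "finite B" using B(4) independent_imp_finite by blast
  have "(\<Sum>b\<in>B. (v \<bullet> b) *\<^sub>R b) = v" if vV: "v \<in> V" for v
  proof -
    obtain k where k: "v = (\<Sum>b\<in>B. k b *\<^sub>R b)"
      using vV unfolding B(6)[symmetric] span_finite[OF fin] by auto
    have "v \<bullet> b = k b" if "b \<in> B" for b
    proof -
      have "v \<bullet> b = (\<Sum>b'\<in>B. if b' = b then k b else 0)"
        unfolding k inner_sum_left
      proof (rule sum.cong[OF refl])
        fix b' assume "b' \<in> B"
        then show "k b' *\<^sub>R b' \<bullet> b = (if b' = b then k b else 0)"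
          using B(2) B(3)[OF that] that
          by (auto simp: pairwise_def orthogonal_def norm_eq_1)
      qed
      then show ?thesis using fin that by simp
    qed
    then show ?thesis using k by simp
  qed
  then show ?thesis using that fin B(1) unfolding parseval_frame_def by blast
qed

lemma lin_on_zero: "lin_on V F \<Longrightarrow> subspace V \<Longrightarrow> F 0 = 0"
  unfolding lin_on_def using subspace_0 by (metis scale_zero_left)

lemma lin_on_sum:
  assumes "lin_on V F" "subspace V" "\<And>i. i \<in> I \<Longrightarrow> w i \<in> V"
  shows "F (\<Sum>i\<in>I. k i *\<^sub>R w i) = (\<Sum>i\<in>I. k i *\<^sub>R F (w i))"
  using assms(3)
proof (induction I rule: infinite_finite_induct)
  case (insert x I)
  have "(\<Sum>i\<in>I. k i *\<^sub>R w i) \<in> V" "k x *\<^sub>R w x \<in> V"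
    using insert.prems assms(2) by (auto intro!: subspace_sum subspace_mul)
  then show ?case using insert assms(1) by (simp add: lin_on_def)
qed (use assms lin_on_zero in auto)

lemma lin_on_expand:
  assumes "lin_on V F" "subspace V" "parseval_frame V B" "v \<in> V"
  shows "F v = (\<Sum>b\<in>B. (v \<bullet> b) *\<^sub>R F b)"
proof -
  have "F v = F (\<Sum>b\<in>B. (v \<bullet> b) *\<^sub>R b)" using assms by (simp add: parseval_frame_def)
  also have "\<dots> = (\<Sum>b\<in>B. (v \<bullet> b) *\<^sub>R F b)"
    by (rule lin_on_sum[OF assms(1,2)]) (use assms in \<open>auto simp: parseval_frame_def\<close>)
  finally show ?thesis .
qed

text \<open>A family of bilinear maps is thereby governed by the finitely many functions
  \<open>Q b c\<close>, so continuity has to be known for these alone.\<close>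

lemma bilin_on_expand:
  assumes V: "subspace V" "parseval_frame V B" and W: "subspace W" "parseval_frame W C"
    and "\<And>w. w \<in> W \<Longrightarrow> lin_on V (\<lambda>v. Q v w)" "\<And>v. v \<in> V \<Longrightarrow> lin_on W (Q v)"
    and "v \<in> V" "w \<in> W"
  shows "Q v w = (\<Sum>b\<in>B. \<Sum>c\<in>C. ((v \<bullet> b) * (w \<bullet> c)) *\<^sub>R Q b c)"
proof -
  have "Q v w = (\<Sum>b\<in>B. (v \<bullet> b) *\<^sub>R Q b w)"
    by (rule lin_on_expand[OF assms(5) V \<open>v \<in> V\<close>, OF \<open>w \<in> W\<close>])
  also have "\<dots> = (\<Sum>b\<in>B. (v \<bullet> b) *\<^sub>R (\<Sum>c\<in>C. (w \<bullet> c) *\<^sub>R Q b c))"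
    using lin_on_expand[OF assms(6) W \<open>w \<in> W\<close>] V(2) by (auto simp: parseval_frame_def intro!: sum.cong)
  finally show ?thesis by (simp add: scaleR_sum_right)
qed

text \<open>A positive continuous function on the compact product of \<open>K\<close> with the unit
  sphere of \<open>V\<close> has a positive minimum, and homogeneity of degree two carries the bound
  over to all \<open>v\<close>.\<close>

lemma compact_posdef_lower_bound:
  fixes Q :: "'x::t2_space \<Rightarrow> 'v::euclidean_space \<Rightarrow> 'v \<Rightarrow> real"
  assumes K: "compact K" and V: "subspace V" "parseval_frame V B"
    and lin: "\<And>x w. x \<in> K \<Longrightarrow> w \<in> V \<Longrightarrow> lin_on V (\<lambda>v. Q x v w)"
      "\<And>x v. x \<in> K \<Longrightarrow> v \<in> V \<Longrightarrow> lin_on V (Q x v)"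
    and cont: "\<And>b b'. b \<in> B \<Longrightarrow> b' \<in> B \<Longrightarrow> continuous_on K (\<lambda>x. Q x b b')"
    and pos: "\<And>x v. x \<in> K \<Longrightarrow> v \<in> V \<Longrightarrow> v \<noteq> 0 \<Longrightarrow> Q x v v > 0"
  obtains c where "c > 0" "\<And>x v. x \<in> K \<Longrightarrow> v \<in> V \<Longrightarrow> c * (norm v)\<^sup>2 \<le> Q x v v"
proof -
  have "\<exists>c>0. \<forall>x\<in>K. \<forall>v\<in>V \<inter> sphere 0 1. c \<le> Q x v v"
  \<comment> \<open>The product is empty if \<open>K\<close> is empty or \<open>V\<close> is zero;
    then any positive constant serves.\<close>
  proof (cases "K \<times> (V \<inter> sphere 0 1) = {}")
    case True
    then show ?thesis by (auto intro!: exI[of _ 1])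
  next
    case False
    \<comment> \<open>Continuity is assumed for the coefficients, so the expanded form is minimized;
      for \<open>x \<in> K\<close> and \<open>v \<in> V\<close> it agrees with
      \<open>Q x v v\<close>.\<close>
    define f where "f = (\<lambda>(x, v). \<Sum>b\<in>B. \<Sum>c\<in>B. ((v \<bullet> b) * (v \<bullet> c)) * Q x b c)"
    have f: "f (x, v) = Q x v v" if "x \<in> K" "v \<in> V" for x v
      using bilin_on_expand[OF V V lin(1)[OF that(1)] lin(2)[OF that(1)] that(2) that(2)] by (simp add: f_def)
    have "continuous_on (K \<times> (V \<inter> sphere 0 1)) f"
      unfolding f_def case_prod_unfold
      by (intro continuous_intros continuous_on_compose2[OF cont]) auto
    moreover have "compact (K \<times> (V \<inter> sphere 0 1))"
      by (intro compact_Times K closed_Int_compact closed_subspace V) auto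
    ultimately obtain z where z: "z \<in> K \<times> (V \<inter> sphere 0 1)"
      "\<forall>y\<in>K \<times> (V \<inter> sphere 0 1). f z \<le> f y"
      using False continuous_attains_inf by blast
    obtain x0 v0 where x0: "z = (x0, v0)" "x0 \<in> K" "v0 \<in> V" "norm v0 = 1" using z(1) by auto
    have "f z \<le> Q x v v" if "x \<in> K" "v \<in> V \<inter> sphere 0 1" for x v
      using z(2) f that by (metis IntD1 SigmaI)
    moreover have "v0 \<noteq> 0" using x0(4) by auto
    then have "0 < f z" using pos f x0 by simp
    ultimately show ?thesis by blast
  qed
  then obtain c where c: "c > 0" "\<And>x v. x \<in> K \<Longrightarrow> v \<in> V \<Longrightarrow> norm v = 1 \<Longrightarrow> c \<le> Q x v v" by auto
  have "c * (norm v)\<^sup>2 \<le> Q x v v" if "x \<in> K" "v \<in> V" for x v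
  proof (cases "v = 0")
    case True
    then show ?thesis using lin_on_zero[OF lin(2)[OF that] V(1)] by simp
  next
    case False
    define u where "u = v /\<^sub>R norm v"
    have u: "u \<in> V" "norm u = 1" and v: "v = norm v *\<^sub>R u"
      using False that V(1) by (auto simp: u_def subspace_mul)
    have "Q x (norm v *\<^sub>R u) v = norm v * Q x u v"
      using lin(1)[OF that] u(1) by (simp add: lin_on_def)
    then have 1: "Q x v v = norm v * Q x u v" using v by metis
    have "Q x u (norm v *\<^sub>R u) = norm v * Q x u u"
      using lin(2)[OF that(1) u(1)] u(1) by (simp add: lin_on_def)
    then have "Q x u v = norm v * Q x u u" using v by metis
    then have "Q x v v = (norm v)\<^sup>2 * Q x u u"
      unfolding 1 by (simp add: power2_eq_square)
    then show ?thesis using c(2)[OF that(1) u] by (simp add: mult.commute mult_right_mono)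
  qed
  then show ?thesis using that c(1) by blast
qed

lemma compact_bilin_bound:
  fixes A :: "'x::topological_space \<Rightarrow> 'v::euclidean_space \<Rightarrow> 'w::euclidean_space \<Rightarrow> 'b::real_normed_vector"
  assumes K: "compact K" and V: "subspace V" "parseval_frame V B" and W: "subspace W" "parseval_frame W C"
    and lin: "\<And>x w. x \<in> K \<Longrightarrow> w \<in> W \<Longrightarrow> lin_on V (\<lambda>v. A x v w)"
      "\<And>x v. x \<in> K \<Longrightarrow> v \<in> V \<Longrightarrow> lin_on W (A x v)"
    and cont: "\<And>b c. b \<in> B \<Longrightarrow> c \<in> C \<Longrightarrow> continuous_on K (\<lambda>x. A x b c)"
  obtains D where "D \<ge> 0" "\<And>x v w. x \<in> K \<Longrightarrow> v \<in> V \<Longrightarrow> w \<in> W \<Longrightarrow> norm (A x v w) \<le> D * norm v * norm w"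
proof -
  have "\<exists>m. \<forall>x\<in>K. norm (A x b c) \<le> m" if "b \<in> B" "c \<in> C" for b c
    using compact_imp_bounded[OF compact_continuous_image[OF cont[OF that] K]]
    by (auto simp: bounded_iff)
  then obtain m where m: "\<And>x b c. b \<in> B \<Longrightarrow> c \<in> C \<Longrightarrow> x \<in> K \<Longrightarrow> norm (A x b c) \<le> m b c" by metis
  \<comment> \<open>A bound \<open>m b c\<close> may be negative when \<open>K\<close> is empty; the
    absolute value keeps \<open>D\<close> nonnegative.\<close>
  define D where "D = (\<Sum>b\<in>B. \<Sum>c\<in>C. norm b * norm c * \<bar>m b c\<bar>)"
  have "norm (A x v w) \<le> D * norm v * norm w" if x: "x \<in> K" "v \<in> V" "w \<in> W" for x v w
  proof -
    have "norm (A x v w) = norm (\<Sum>b\<in>B. \<Sum>c\<in>C. ((v \<bullet> b) * (w \<bullet> c)) *\<^sub>R A x b c)"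
      by (rule arg_cong[where f=norm], rule bilin_on_expand[OF V W]) (use x lin in blast)+
    also have "\<dots> \<le> (\<Sum>b\<in>B. \<Sum>c\<in>C. norm (((v \<bullet> b) * (w \<bullet> c)) *\<^sub>R A x b c))"
      by (intro order_trans[OF norm_sum] sum_mono) simp
    also have "\<dots> \<le> (\<Sum>b\<in>B. \<Sum>c\<in>C. (norm b * norm c * \<bar>m b c\<bar>) * norm v * norm w)"
    proof (intro sum_mono)
      fix b c assume "b \<in> B" "c \<in> C"
      then have "norm (A x b c) \<le> \<bar>m b c\<bar>" using m[OF _ _ x(1), of b c] by linarith
      then have "\<bar>v \<bullet> b\<bar> * \<bar>w \<bullet> c\<bar> * norm (A x b c) \<le> (norm v * norm b) * (norm w * norm c) * \<bar>m b c\<bar>"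
        by (intro mult_mono Cauchy_Schwarz_ineq2) auto
      then show "norm (((v \<bullet> b) * (w \<bullet> c)) *\<^sub>R A x b c) \<le> (norm b * norm c * \<bar>m b c\<bar>) * norm v * norm w"
        by (simp add: abs_mult mult_ac)
    qed
    also have "\<dots> = D * norm v * norm w" by (simp add: D_def sum_distrib_right)
    finally show ?thesis .
  qed
  moreover have "D \<ge> 0" unfolding D_def by (intro sum_nonneg) auto
  ultimately show ?thesis using that by blast
qed

lemma lin_on_bound:
  fixes F :: "'v::euclidean_space \<Rightarrow> 'b::real_normed_vector"
  assumes "lin_on V F" "subspace V"
  obtains C where "C \<ge> 0" "\<And>v. v \<in> V \<Longrightarrow> norm (F v) \<le> C * norm v"
proof -
  obtain B where B: "parseval_frame V B" using parseval_frame_exists[OF assms(2)] .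
  define C where "C = (\<Sum>b\<in>B. norm b * norm (F b))"
  have "norm (F v) \<le> C * norm v" if "v \<in> V" for v
  proof -
    have "norm (F v) \<le> (\<Sum>b\<in>B. norm ((v \<bullet> b) *\<^sub>R F b))"
      unfolding lin_on_expand[OF assms B that] by (rule norm_sum)
    also have "\<dots> \<le> (\<Sum>b\<in>B. (norm v * norm b) * norm (F b))"
      by (intro sum_mono) (simp add: Cauchy_Schwarz_ineq2 mult_right_mono)
    also have "\<dots> = C * norm v" by (simp add: C_def sum_distrib_left sum_distrib_right mult_ac)
    finally show ?thesis .
  qed
  moreover have "C \<ge> 0" unfolding C_def by (intro sum_nonneg) auto
  ultimately show ?thesis using that by blast
qed

section \<open>Coordinates on a manifold\<close>

locale smooth_mfd =
  fixes M :: "('m, 'v::euclidean_space) manifold"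
  assumes sm: "smooth_manifold M"
begin

lemma model_subspace: "subspace (mmodel M)"
  using sm by (simp add: smooth_manifold_def)

lemma Hausdorff_M: "Hausdorff_space (mtop M)"
  using sm by (simp add: smooth_manifold_def)

lemma atlas_cover: "q \<in> topspace (mtop M) \<Longrightarrow> \<exists>c\<in>atlas M. q \<in> fst c"
  using sm unfolding smooth_manifold_def by blast

lemma chart_conditions:
  assumes "c \<in> atlas M"
  shows "openin (mtop M) (fst c) \<and> openin (top_of_set (mmodel M)) (snd c ` fst c) \<and>
    homeomorphic_map (subtopology (mtop M) (fst c)) (top_of_set (snd c ` fst c)) (snd c)"
proof -
  have "\<forall>(U, \<phi>)\<in>atlas M. openin (mtop M) U \<and> openin (top_of_set (mmodel M)) (\<phi> ` U) \<and>
        homeomorphic_map (subtopology (mtop M) U) (top_of_set (\<phi> ` U)) \<phi>"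
    using sm unfolding smooth_manifold_def by blast
  from bspec[OF this assms] show ?thesis by (simp only: case_prod_unfold)
qed

lemmas chart_open = chart_conditions[THEN conjunct1]
lemmas chart_homeo = chart_conditions[THEN conjunct2, THEN conjunct2]

lemma chart_domain: "c \<in> atlas M \<Longrightarrow> fst c \<subseteq> topspace (mtop M)"
  by (rule openin_subset[OF chart_open])

lemma chart_inj:
  assumes "c \<in> atlas M" shows "inj_on (snd c) (fst c)"
proof -
  have "topspace (subtopology (mtop M) (fst c)) = fst c" using chart_domain[OF assms] by auto
  then show ?thesis using homeomorphic_imp_injective_map[OF chart_homeo[OF assms]] by simp
qed

lemma chart_inv_left [simp]: "c \<in> atlas M \<Longrightarrow> q \<in> fst c \<Longrightarrow> chart_inv c (snd c q) = q"
  by (simp add: chart_inv_def chart_inj)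

lemma chart_inv_right [simp]: "x \<in> snd c ` fst c \<Longrightarrow> snd c (chart_inv c x) = x"
  by (simp add: chart_inv_def f_inv_into_f)

lemma chart_inv_mem: "x \<in> snd c ` fst c \<Longrightarrow> chart_inv c x \<in> fst c"
  by (simp add: chart_inv_def inv_into_into)

lemma chart_image_open:
  assumes c: "c \<in> atlas M" and U: "openin (mtop M) U"
  shows "openin (top_of_set (mmodel M)) (snd c ` (U \<inter> fst c))"
proof -
  have "openin (subtopology (mtop M) (fst c)) (U \<inter> fst c)"
    using U by (simp add: openin_subtopology_Int)
  then have "openin (top_of_set (snd c ` fst c)) (snd c ` (U \<inter> fst c))"
    using homeomorphic_imp_open_map[OF chart_homeo[OF c]] by (simp add: open_map_def)
  then show ?thesis by (rule openin_trans) (use chart_conditions[OF c] in blast)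
qed

lemma chart_image_subset: "c \<in> atlas M \<Longrightarrow> snd c ` fst c \<subseteq> mmodel M"
  using openin_imp_subset[OF chart_conditions[THEN conjunct2, THEN conjunct1]] .

lemma chart_continuous:
  "c \<in> atlas M \<Longrightarrow> continuous_map (subtopology (mtop M) (fst c)) euclidean (snd c)"
  by (rule continuous_map_into_fulltopology[OF homeomorphic_imp_continuous_map[OF chart_homeo]])

text \<open>\<open>chart_inv\<close> is an \<open>inv_into\<close>; on the image of the chart it
  coincides with the continuous inverse that the homeomorphism provides.\<close>

lemma chart_inv_continuous:
  assumes c: "c \<in> atlas M"
  shows "continuous_map (top_of_set (snd c ` fst c)) (mtop M) (chart_inv c)"
proof -
  have t: "topspace (subtopology (mtop M) (fst c)) = fst c"
    using chart_domain[OF c] by auto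
  obtain g where g: "homeomorphic_maps (subtopology (mtop M) (fst c)) (top_of_set (snd c ` fst c)) (snd c) g"
    using chart_homeo[OF c] homeomorphic_map_maps by blast
  then have "continuous_map (top_of_set (snd c ` fst c)) (mtop M) g"
    by (auto simp: homeomorphic_maps_def continuous_map_in_subtopology)
  moreover have "g x = chart_inv c x" if "x \<in> snd c ` fst c" for x
    using that g c t by (auto simp: homeomorphic_maps_def)
  ultimately show ?thesis by (auto intro: continuous_map_eq)
qed

lemma transition_smooth:
  "c \<in> atlas M \<Longrightarrow> c' \<in> atlas M \<Longrightarrow> smooth_on (snd c ` (fst c \<inter> fst c')) (snd c' \<circ> chart_inv c)"
  using sm by (simp add: smooth_manifold_def)

text \<open>The derivative of the change of coordinates, in exactly the form of the transformation
  law in \<open>tangent_space\<close>. Being a chosen derivative, it is determined on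
  \<open>mmodel M\<close> only.\<close>

definition jac :: "('m, 'v) chart \<Rightarrow> ('m, 'v) chart \<Rightarrow> 'm \<Rightarrow> 'v \<Rightarrow> 'v" where
  "jac c c' q = frechet_derivative (snd c' \<circ> chart_inv c) (at (snd c q) within snd c ` (fst c \<inter> fst c'))"

lemma jac_derivative:
  assumes "c \<in> atlas M" "c' \<in> atlas M" "q \<in> fst c" "q \<in> fst c'"
  shows "((snd c' \<circ> chart_inv c) has_derivative jac c c' q) (at (snd c q) within snd c ` (fst c \<inter> fst c'))"
  unfolding jac_def using assms by (intro smooth_on_imp_has_derivative transition_smooth) auto

text \<open>The domain of \<open>\<beta>\<close> is left general so that the same chain rule serves
  inverse charts and curves.\<close>

lemma chart_change_derivative:
  assumes c: "c \<in> atlas M" "c' \<in> atlas M" and z: "z \<in> A"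
    and A: "\<And>y. y \<in> A \<Longrightarrow> \<beta> y \<in> fst c \<and> \<beta> y \<in> fst c'"
    and d: "((\<lambda>y. snd c (\<beta> y)) has_derivative D) (at z within A)"
  shows "((\<lambda>y. snd c' (\<beta> y)) has_derivative (\<lambda>v. jac c c' (\<beta> z) (D v))) (at z within A)"
proof -
  have "((\<lambda>y. (snd c' \<circ> chart_inv c) (snd c (\<beta> y))) has_derivative (\<lambda>v. jac c c' (\<beta> z) (D v))) (at z within A)"
  proof (rule has_derivative_in_compose[OF d])
    show "((snd c' \<circ> chart_inv c) has_derivative jac c c' (\<beta> z)) (at (snd c (\<beta> z)) within (\<lambda>y. snd c (\<beta> y)) ` A)"
      using A by (intro has_derivative_subset[OF jac_derivative[OF c]]) (use z in auto)
  qed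
  then show ?thesis
    by (rule has_derivative_transform[rotated 2]) (use z A c in auto)
qed

text \<open>Both sides differentiate the transition from \<open>c\<close> to \<open>c''\<close> on
  the triple overlap. The two derivatives are known to agree along the model space, whence the
  condition on \<open>v\<close>.\<close>

lemma jac_cocycle:
  assumes c: "c \<in> atlas M" "c' \<in> atlas M" "c'' \<in> atlas M"
    and q: "q \<in> fst c" "q \<in> fst c'" "q \<in> fst c''" and v: "v \<in> mmodel M"
  shows "jac c c'' q v = jac c' c'' q (jac c c' q v)"
proof -
  define A where "A = snd c ` ((fst c' \<inter> fst c'') \<inter> fst c)"
  have A: "openin (top_of_set (mmodel M)) A"
    unfolding A_def using c by (intro chart_image_open openin_Int chart_open) auto
  have x: "snd c q \<in> A" using q by (auto simp: A_def)
  have 1: "((\<lambda>x. snd c'' (chart_inv c x)) has_derivative jac c c'' q) (at (snd c q) within A)"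
    using has_derivative_subset[OF jac_derivative[OF c(1,3) q(1,3)], of A] by (auto simp: A_def o_def)
  have 2: "((\<lambda>x. snd c' (chart_inv c x)) has_derivative jac c c' q) (at (snd c q) within A)"
    using has_derivative_subset[OF jac_derivative[OF c(1,2) q(1,2)], of A] by (auto simp: A_def o_def)
  have "((\<lambda>x. snd c'' (chart_inv c x)) has_derivative
      (\<lambda>v. jac c' c'' (chart_inv c (snd c q)) (jac c c' q v))) (at (snd c q) within A)"
    by (rule chart_change_derivative[OF c(2,3) x _ 2]) (use c in \<open>auto simp: A_def\<close>)
  then show ?thesis
    using has_derivative_unique_subspace[OF model_subspace A x v 1] c q by simp
qed

text \<open>The vector is the velocity at 0 of a curve in the closed subspace
  \<open>mmodel M\<close>, namely the image of a coordinate line.\<close>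

lemma jac_in_model:
  assumes c: "c \<in> atlas M" "c' \<in> atlas M" and q: "q \<in> fst c" "q \<in> fst c'" and v: "v \<in> mmodel M"
  shows "jac c c' q v \<in> mmodel M"
proof -
  define S where "S = snd c ` (fst c' \<inter> fst c)"
  have S: "openin (top_of_set (mmodel M)) S"
    unfolding S_def using c by (intro chart_image_open chart_open) auto
  have x: "snd c q \<in> S" using q by (auto simp: S_def)
  have d: "((snd c' \<circ> chart_inv c) has_derivative jac c c' q) (at (snd c q) within S)"
    using jac_derivative[OF c q] by (simp add: S_def Int_commute)
  obtain e where e: "e > 0" "\<And>t. \<bar>t\<bar> < e \<Longrightarrow> snd c q + t *\<^sub>R v \<in> S"
     "((\<lambda>t. (snd c' \<circ> chart_inv c) (snd c q + t *\<^sub>R v)) has_vector_derivative jac c c' q v) (at 0)"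
    using has_derivative_along_line[OF model_subspace S x v d] by (elim exE conjE) simp
  show ?thesis
  proof (rule has_vector_derivative_in_closed_subspace[OF model_subspace])
    show "((\<lambda>t. (snd c' \<circ> chart_inv c) (snd c q + t *\<^sub>R v)) has_vector_derivative jac c c' q v) (at 0 within {-e<..<e})"
      by (rule has_vector_derivative_at_within[OF e(3)])
    have "at 0 within {- e<..<e} = at (0::real)" by (rule at_within_open) (use e(1) in auto)
    then show "at 0 within {- e<..<e} \<noteq> bot" by simp
    show "(0::real) \<in> {-e<..<e}" using e(1) by simp
    fix s assume "s \<in> {-e<..<e}"
    then have "snd c q + s *\<^sub>R v \<in> S" using e(2) by auto
    then obtain r where r: "r \<in> fst c'" "r \<in> fst c" "snd c q + s *\<^sub>R v = snd c r"
      by (auto simp: S_def)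
    show "(snd c' \<circ> chart_inv c) (snd c q + s *\<^sub>R v) \<in> mmodel M"
      unfolding r(3) o_apply chart_inv_left[OF c(1) r(2)]
      using chart_image_subset[OF c(2)] r(1) by blast
  qed
qed

lemma jac_self:
  assumes c: "c \<in> atlas M" and q: "q \<in> fst c" and v: "v \<in> mmodel M"
  shows "jac c c q v = v"
proof -
  have S: "openin (top_of_set (mmodel M)) (snd c ` fst c)"
    using chart_image_open[OF c chart_open[OF c]] by simp
  have x: "snd c q \<in> snd c ` fst c" using q by simp
  have 1: "((snd c \<circ> chart_inv c) has_derivative (\<lambda>v. v)) (at (snd c q) within snd c ` fst c)"
    by (rule has_derivative_transform[OF x _ has_derivative_ident]) simp
  have 2: "((snd c \<circ> chart_inv c) has_derivative jac c c q) (at (snd c q) within snd c ` fst c)"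
    using jac_derivative[OF c c q q] by simp
  show ?thesis by (rule has_derivative_unique_subspace[OF model_subspace S x v 2 1])
qed

lemma jac_linear:
  assumes "c \<in> atlas M" "c' \<in> atlas M" "q \<in> fst c" "q \<in> fst c'"
  shows "linear (jac c c' q)"
  using jac_derivative[OF assms] has_derivative_linear by blast

text \<open>
  Smoothness of the metric and of the connection is only given on smooth vector fields; the
  coordinate fields \<open>\<lambda>q. cvec c q v\<close> turn it into local bounds.
\<close>

definition cvec :: "('m, 'v) chart \<Rightarrow> 'm \<Rightarrow> 'v \<Rightarrow> ('m, 'v) tvec" where
  "cvec c q v = (\<lambda>c'. if c' \<in> charts_at M q then jac c c' q v else 0)"

lemma charts_atD: "c \<in> charts_at M q \<Longrightarrow> c \<in> atlas M \<and> q \<in> fst c"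
  by (simp add: charts_at_def)

lemma tangent_space_iff:
  "X \<in> tangent_space M q \<longleftrightarrow>
     (\<forall>c\<in>charts_at M q. X c \<in> mmodel M) \<and> (\<forall>c. c \<notin> charts_at M q \<longrightarrow> X c = 0) \<and>
     (\<forall>c\<in>charts_at M q. \<forall>c'\<in>charts_at M q. X c' = jac c c' q (X c))"
  by (auto simp: tangent_space_def jac_def)

lemma cvec_tangent:
  assumes c: "c \<in> charts_at M q" and v: "v \<in> mmodel M"
  shows "cvec c q v \<in> tangent_space M q"
  unfolding tangent_space_iff
proof (intro conjI ballI allI impI)
  fix c1 assume c1: "c1 \<in> charts_at M q"
  show "cvec c q v c1 \<in> mmodel M"
    using c1 charts_atD[OF c1] charts_atD[OF c] v by (simp add: cvec_def jac_in_model)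
  fix c2 assume c2: "c2 \<in> charts_at M q"
  show "cvec c q v c2 = jac c1 c2 q (cvec c q v c1)"
    unfolding cvec_def if_P[OF c1] if_P[OF c2]
    using charts_atD[OF c1] charts_atD[OF c2] charts_atD[OF c] v by (intro jac_cocycle) auto
qed (simp add: cvec_def)

text \<open>The transformation law recovers all components from one, so that bounds for coordinate
  fields extend to arbitrary tangent vectors.\<close>

lemma tangent_eq_cvec:
  assumes "c \<in> charts_at M q" "X \<in> tangent_space M q"
  shows "X = cvec c q (X c)"
proof
  fix c'
  show "X c' = cvec c q (X c) c'"
  proof (cases "c' \<in> charts_at M q")
    case True
    then have "X c' = jac c c' q (X c)" using assms unfolding tangent_space_iff by blast
    then show ?thesis by (simp only: cvec_def if_P[OF True])
  next
    case False
    then have "X c' = 0" using assms unfolding tangent_space_iff by blast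
    then show ?thesis by (simp only: cvec_def if_not_P[OF False])
  qed
qed

lemma tangent_model: "c \<in> charts_at M q \<Longrightarrow> X \<in> tangent_space M q \<Longrightarrow> X c \<in> mmodel M"
  unfolding tangent_space_iff by blast

lemma cvec_add: "c \<in> charts_at M q \<Longrightarrow> cvec c q (u + v) = (\<lambda>c'. cvec c q u c' + cvec c q v c')"
  by (auto simp: cvec_def fun_eq_iff linear_add[OF jac_linear] dest!: charts_atD)

lemma cvec_scale: "c \<in> charts_at M q \<Longrightarrow> cvec c q (r *\<^sub>R v) = (\<lambda>c'. r *\<^sub>R cvec c q v c')"
  by (auto simp: cvec_def fun_eq_iff linear_scale[OF jac_linear] dest!: charts_atD)

lemma cvec_self: "c \<in> charts_at M q \<Longrightarrow> v \<in> mmodel M \<Longrightarrow> cvec c q v c = v"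
  by (simp add: cvec_def charts_at_def jac_self)

text \<open>In a second chart the component is the derivative of the transition in a fixed
  direction, composed with the reverse transition.\<close>

lemma cvec_smooth:
  assumes c: "c \<in> atlas M" and v: "v \<in> mmodel M"
  shows "smooth_vector_field M (fst c) (\<lambda>q. cvec c q v)"
  unfolding smooth_vector_field_def
proof (intro conjI ballI)
  fix q assume "q \<in> fst c"
  then show "cvec c q v \<in> tangent_space M q" using c v by (intro cvec_tangent) (auto simp: charts_at_def)
next
  fix c' assume c': "c' \<in> atlas M"
  define S where "S = snd c ` (fst c' \<inter> fst c)"
  define S' where "S' = snd c' ` (fst c \<inter> fst c')"
  have S: "openin (top_of_set (mmodel M)) S"
    unfolding S_def by (intro chart_image_open chart_open c c')
  have f: "smooth_on S (snd c' \<circ> chart_inv c)"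
    using transition_smooth[OF c c'] by (simp add: S_def Int_commute)
  have "smooth_on S (\<lambda>x. jac c c' (chart_inv c x) v)"
    unfolding smooth_on_def
  proof
    fix k
    \<comment> \<open>The witness depends on \<open>k\<close>, but in the direction \<open>v\<close>
      every witness equals \<open>jac\<close>.\<close>
    obtain f' where f': "\<forall>x\<in>S. ((snd c' \<circ> chart_inv c) has_derivative f' x) (at x within S)"
      "\<forall>v. Ck_on k S (\<lambda>x. f' x v)"
      using f[unfolded smooth_on_def, THEN spec, of "Suc k", unfolded Ck_on.simps(2)]
      by (elim exE conjE) simp
    have "jac c c' (chart_inv c x) v = f' x v" if x: "x \<in> S" for x
    proof -
      have "x \<in> snd c ` fst c" using x by (auto simp: S_def)
      then have "jac c c' (chart_inv c x) = frechet_derivative (snd c' \<circ> chart_inv c) (at x within S)"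
        by (simp add: jac_def S_def Int_commute)
      then show ?thesis
        using frechet_derivative_subspace[OF model_subspace S x v bspec[OF f'(1) x]] by simp
    qed
    then show "Ck_on k S (\<lambda>x. jac c c' (chart_inv c x) v)"
      by (rule Ck_on_cong[OF f'(2)[THEN spec]])
  qed
  \<comment> \<open>\<open>S\<close> and \<open>S'\<close> are the same overlap in the coordinates
    of \<open>c\<close> and of \<open>c'\<close>; the reverse transition passes from
    \<open>S'\<close> to \<open>S\<close>.\<close>
  moreover have "smooth_on S' (snd c \<circ> chart_inv c')"
    using transition_smooth[OF c' c] by (simp add: S'_def Int_commute)
  moreover have "(snd c \<circ> chart_inv c') ` S' \<subseteq> S"
    using chart_inv_left[OF c'] by (auto simp: S_def S'_def)
  ultimately have "smooth_on S' (\<lambda>x. jac c c' (chart_inv c ((snd c \<circ> chart_inv c') x)) v)"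
    by (rule smooth_on_compose)
  then show "smooth_on (snd c' ` (fst c \<inter> fst c')) (\<lambda>x. cvec c (chart_inv c' x) v c')"
    unfolding S'_def 
    by (rule smooth_on_cong) (use c c' in \<open>clarsimp simp: cvec_def charts_at_def\<close>)
qed

end

section \<open>Piecewise smooth curves and their speed\<close>

lemma at_within_relopen:
  assumes "openin (top_of_set I) A" "t \<in> A"
  shows "at t within A = at t within I"
proof -
  obtain W where W: "open W" "A = I \<inter> W" using assms(1) by (auto simp: openin_open)
  show ?thesis
    by (rule at_within_nhd[of t W]) (use W assms(2) in auto)
qed

lemma at_within_Icc_neq_bot: "a < b \<Longrightarrow> t \<in> {a..b} \<Longrightarrow> at t within {a..b::real} \<noteq> bot"
  by (simp add: trivial_limit_within islimpt_Icc)

lemma at_within_Icc_interior: "a < t \<Longrightarrow> t < b \<Longrightarrow> at t within {a..b::real} = at t"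
  by (rule at_within_interior) simp

text \<open>Induction on the number of subdivision points below \<open>t\<close>: the largest of
  them is the left end of a piece that ends at \<open>t\<close>. The rule propagates continuity and
  integrability from the pieces to the whole interval.\<close>

lemma pieces_induct [consumes 3, case_names zero piece]:
  fixes T :: "real set"
  assumes T: "finite T" "T \<subseteq> {0..1}" "t \<in> T"
    and zero: "P 0" and step: "\<And>a b. (a, b) \<in> pieces T \<Longrightarrow> P a \<Longrightarrow> P b" and T0: "0 \<in> T"
  shows "P t"
  using T(3)
proof (induction "card {s \<in> T. s < t}" arbitrary: t rule: less_induct)
  case less
  show ?case
  proof (cases "t = 0")
    case False
    define a where "a = Max {s \<in> T. s < t}"
    have t: "0 < t" using less.prems T False by force
    have fin: "finite {s \<in> T. s < t}" and ne: "{s \<in> T. s < t} \<noteq> {}" using T T0 t by auto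
    have a: "a \<in> T" "a < t" using Max_in[OF fin ne] by (auto simp: a_def)
    have "{a<..<t} \<inter> T = {}"
      using Max_ge[OF fin] unfolding a_def[symmetric] by force
    then have "(a, t) \<in> pieces T" using a less.prems by (simp add: pieces_def)
    moreover have "card {s \<in> T. s < a} < card {s \<in> T. s < t}"
      by (rule psubset_card_mono[OF fin]) (use a in auto)
    ultimately show ?thesis using step less.hyps a(1) by blast
  qed (use zero in simp)
qed

lemma pieces_cover:
  fixes T :: "real set"
  assumes T: "finite T" "0 \<in> T" "1 \<in> T" and t: "t \<in> {0..1}" "t \<notin> T"
  obtains a b where "(a, b) \<in> pieces T" "a < t" "t < b"
proof -
  define a where "a = Max {s \<in> T. s < t}"
  define b where "b = Min {s \<in> T. t < s}"
  have "t \<noteq> 0" "t \<noteq> 1" using t T by auto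
  then have t': "0 < t" "t < 1" using t by auto
  have fa: "finite {s \<in> T. s < t}" "{s \<in> T. s < t} \<noteq> {}" using T t' by auto
  have fb: "finite {s \<in> T. t < s}" "{s \<in> T. t < s} \<noteq> {}" using T t' by auto
  have a: "a \<in> T" "a < t" using Max_in[OF fa] by (auto simp: a_def)
  have b: "b \<in> T" "t < b" using Min_in[OF fb] by (auto simp: b_def)
  have "x \<notin> T" if "x \<in> {a<..<b}" for x
  proof
    assume x: "x \<in> T"
    then have "x < t \<or> t < x" using t by (cases "x = t") auto
    then show False
    proof
      assume "x < t"
      then have "x \<le> a" using Max_ge[OF fa(1)] x by (simp add: a_def)
      then show False using that by simp
    next
      assume "t < x"
      then have "b \<le> x" using Min_le[OF fb(1)] x by (simp add: b_def)
      then show False using that by simp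
    qed
  qed
  then have "(a, b) \<in> pieces T" using a b by (auto simp: pieces_def)
  then show ?thesis using that a b by blast
qed

lemma piecesD:
  assumes "(a, b) \<in> pieces T" shows "a \<in> T" "b \<in> T" "a < b" "{a<..<b} \<inter> T = {}"
  using assms by (auto simp: pieces_def)

lemma smooth_subdivisionD:
  assumes "smooth_subdivision M \<alpha> T"
  shows "finite T" "0 \<in> T" "1 \<in> T" "T \<subseteq> {0..1}"
    "(a, b) \<in> pieces T \<Longrightarrow> smooth_curve M {a..b} \<alpha>"
  using assms unfolding smooth_subdivision_def by blast+

lemma velocity_eq_within: "at t within I = at t within J \<Longrightarrow> velocity M I \<alpha> t = velocity M J \<alpha> t"
  by (auto simp: velocity_def fun_eq_iff)

lemma velocity_interior:
  assumes "a < t" "t < b"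
  shows "velocity M {a..b} \<alpha> t = velocity M UNIV \<alpha> t"
  by (rule velocity_eq_within) (simp add: at_within_Icc_interior assms)

lemma smooth_subdivision_continuous:
  assumes "smooth_subdivision M \<alpha> T"
  shows "continuous_map (top_of_set {0..1}) (mtop M) \<alpha>"
proof -
  note T = smooth_subdivisionD[OF assms]
  show ?thesis
  proof (rule pieces_induct[OF T(1,4,3), of "\<lambda>t. continuous_map (top_of_set {0..t}) (mtop M) \<alpha>"])
    \<comment> \<open>Over the single point 0 the claim still says that \<open>\<alpha> 0\<close>
      lies in \<open>M\<close>; the first piece shows this.\<close>
    have "\<exists>b. (0, b) \<in> pieces T"
    proof -
      define b where "b = Min {s \<in> T. 0 < s}"
      have fb: "finite {s \<in> T. 0 < s}" "{s \<in> T. 0 < s} \<noteq> {}" using T by auto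
      have b: "b \<in> T" "0 < b" using Min_in[OF fb] by (auto simp: b_def)
      have "b \<le> x" if "x \<in> T" "0 < x" for x
        unfolding b_def using Min_le[OF fb(1), of x] that by simp
      then have "{0<..<b} \<inter> T = {}" by force
      then have "(0, b) \<in> pieces T" using T(2) b by (simp add: pieces_def)
      then show ?thesis ..
    qed
    then obtain b where b: "(0, b) \<in> pieces T" ..
    have "continuous_map (top_of_set {0..b}) (mtop M) \<alpha>"
      using T(5)[OF b] by (simp add: smooth_curve_def)
    then show "continuous_map (top_of_set {0..0}) (mtop M) \<alpha>"
      by (rule continuous_map_from_subtopology_mono) (use piecesD(3)[OF b] in auto)
  next
    fix a b assume piece: "(a, b) \<in> pieces T" "continuous_map (top_of_set {0..a}) (mtop M) \<alpha>"
    have ab: "a < b" "a \<in> {0..1}" using piecesD[OF piece(1)] T(4) by auto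
    have c: "continuous_map (top_of_set {a..b}) (mtop M) \<alpha>"
      using T(5)[OF piece(1)] by (simp add: smooth_curve_def)
    \<comment> \<open>Pasting along two closed intervals: the preimage of a closed set is a union of
      two closed sets.\<close>
    show "continuous_map (top_of_set {0..b}) (mtop M) \<alpha>" unfolding continuous_map_closedin
    proof (intro conjI allI impI Pi_I)
      fix x assume "x \<in> topspace (top_of_set {0..b})"
      then have "x \<in> {0..a} \<or> x \<in> {a..b}" by auto
      then show "\<alpha> x \<in> topspace (mtop M)"
        using piece(2) c by (auto simp: continuous_map_def)
    next
      fix C assume C: "closedin (mtop M) C"
      have "closedin (top_of_set {0..a}) {x \<in> {0..a}. \<alpha> x \<in> C}" "closedin (top_of_set {a..b}) {x \<in> {a..b}. \<alpha> x \<in> C}"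
        using closedin_continuous_map_preimage[OF piece(2) C] closedin_continuous_map_preimage[OF c C] by auto
      then have "closed {x \<in> {0..a}. \<alpha> x \<in> C}" "closed {x \<in> {a..b}. \<alpha> x \<in> C}"
        by (auto dest: closedin_closed_trans)
      moreover have "{x \<in> topspace (top_of_set {0..b}). \<alpha> x \<in> C} = {x \<in> {0..a}. \<alpha> x \<in> C} \<union> {x \<in> {a..b}. \<alpha> x \<in> C}"
        using ab by auto
      ultimately show "closedin (top_of_set {0..b}) {x \<in> topspace (top_of_set {0..b}). \<alpha> x \<in> C}"
        by (auto intro!: closed_subset closed_Un)
    qed
  qed (rule T(2))
qed

section \<open>Velocity of a curve, chart by chart\<close>

context smooth_mfd
begin

context
  fixes I :: "real set" and \<alpha> :: "real \<Rightarrow> 'm"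
  assumes curve: "smooth_curve M I \<alpha>" and nt: "\<And>t. t \<in> I \<Longrightarrow> at t within I \<noteq> bot"
begin

lemma curve_chart_open:
  assumes "openin (mtop M) U" shows "openin (top_of_set I) {t \<in> I. \<alpha> t \<in> U}"
  using openin_continuous_map_preimage[OF _ assms, of "top_of_set I" \<alpha>] curve
  by (simp add: smooth_curve_def)

text \<open>Smoothness is given within the preimage of a chart domain, whereas
  \<open>velocity\<close> differentiates within \<open>I\<close>. The preimage is relatively open,
  so both filters agree.\<close>

lemma curve_chart_at:
  assumes "openin (mtop M) U" "t \<in> I" "\<alpha> t \<in> U"
  shows "at t within {t \<in> I. \<alpha> t \<in> U} = at t within I"
  by (rule at_within_relopen[OF curve_chart_open[OF assms(1)]]) (use assms in simp)

text \<open>The continuous derivative comes from the witness in \<open>Ck_on\<close>; it is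
  identified with \<open>velocity\<close> afterwards, by uniqueness of derivatives where
  \<open>at t within I\<close> is nontrivial.\<close>

lemma curve_chart_derivative:
  assumes c: "c \<in> atlas M"
  shows "\<exists>w. (\<forall>t. t \<in> I \<longrightarrow> \<alpha> t \<in> fst c \<longrightarrow>
      ((\<lambda>t. snd c (\<alpha> t)) has_vector_derivative w t) (at t within I)) \<and>
    continuous_on {t \<in> I. \<alpha> t \<in> fst c} w"
proof -
  define A where "A = {t \<in> I. \<alpha> t \<in> fst c}"
  have "smooth_on A (snd c \<circ> \<alpha>)" using curve c by (simp add: smooth_curve_def A_def)
  then have "Ck_on (Suc 0) A (snd c \<circ> \<alpha>)" unfolding smooth_on_def by (rule spec)
  then obtain f' where f': "\<forall>x\<in>A. ((snd c \<circ> \<alpha>) has_derivative f' x) (at x within A)"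
      "\<forall>v. continuous_on A (\<lambda>x. f' x v)" unfolding Ck_on.simps by (elim exE conjE) simp
  have "((\<lambda>t. snd c (\<alpha> t)) has_vector_derivative f' t 1) (at t within I)" if "t \<in> I" "\<alpha> t \<in> fst c" for t
  proof -
    have d: "((\<lambda>t. snd c (\<alpha> t)) has_derivative f' t) (at t within I)"
    proof -
      have "t \<in> A" using that by (simp add: A_def)
      with f'(1) have "((snd c \<circ> \<alpha>) has_derivative f' t) (at t within A)" by (rule bspec)
      then show ?thesis unfolding A_def curve_chart_at[OF chart_open[OF c] that] o_def .
    qed
    have "f' t = (\<lambda>r. r *\<^sub>R f' t 1)"
    proof
      fix r show "f' t r = r *\<^sub>R f' t 1"
        using linear_scale[OF has_derivative_linear[OF d], of r 1] by simp
    qed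
    then show ?thesis using d by (simp add: has_vector_derivative_def)
  qed
  moreover have "continuous_on {t \<in> I. \<alpha> t \<in> fst c} (\<lambda>t. f' t 1)"
    using f'(2) by (simp add: A_def)
  ultimately show ?thesis by (intro exI[of _ "\<lambda>t. f' t 1"]) simp
qed

lemma velocity_derivative:
  assumes "t \<in> I" "c \<in> charts_at M (\<alpha> t)"
  shows "((\<lambda>t. snd c (\<alpha> t)) has_vector_derivative velocity M I \<alpha> t c) (at t within I)"
proof -
  have ca: "c \<in> atlas M" "\<alpha> t \<in> fst c" using charts_atD[OF assms(2)] by auto
  obtain w where w: "\<forall>t. t \<in> I \<longrightarrow> \<alpha> t \<in> fst c \<longrightarrow>
      ((\<lambda>t. snd c (\<alpha> t)) has_vector_derivative w t) (at t within I)"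
    "continuous_on {t \<in> I. \<alpha> t \<in> fst c} w"
    using curve_chart_derivative[OF ca(1)] by (elim exE conjE)
  have "((\<lambda>t. snd c (\<alpha> t)) has_vector_derivative w t) (at t within I)"
    by (rule w(1)[rule_format, OF assms(1) ca(2)])
  moreover from this have "vector_derivative (snd c \<circ> \<alpha>) (at t within I) = w t"
    using vector_derivative_within[OF nt[OF assms(1)]] by (simp add: o_def)
  ultimately show ?thesis using assms(2) by (simp add: velocity_def)
qed

lemma velocity_continuous:
  assumes c: "c \<in> atlas M"
  shows "continuous_on {t \<in> I. \<alpha> t \<in> fst c} (\<lambda>t. velocity M I \<alpha> t c)"
proof -
  obtain w where w: "\<forall>t. t \<in> I \<longrightarrow> \<alpha> t \<in> fst c \<longrightarrow>
      ((\<lambda>t. snd c (\<alpha> t)) has_vector_derivative w t) (at t within I)"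
    "continuous_on {t \<in> I. \<alpha> t \<in> fst c} w"
    using curve_chart_derivative[OF c] by (elim exE conjE)
  have "velocity M I \<alpha> t c = w t" if "t \<in> I" "\<alpha> t \<in> fst c" for t
    using velocity_derivative[of t c] w(1)[rule_format, OF that] that c vector_derivative_within[OF nt[OF that(1)]]
    by (simp add: velocity_def charts_at_def o_def)
  then show ?thesis by (intro continuous_on_eq[OF w(2)]) simp
qed

text \<open>The components lie in the model space as limits of difference quotients, and the
  transformation law is the chain rule for a change of charts.\<close>

lemma velocity_tangent:
  assumes t: "t \<in> I"
  shows "velocity M I \<alpha> t \<in> tangent_space M (\<alpha> t)"
  unfolding tangent_space_iff
proof (intro conjI ballI allI impI)
  fix c assume c: "c \<in> charts_at M (\<alpha> t)"
  have ca: "c \<in> atlas M" "\<alpha> t \<in> fst c" using charts_atD[OF c] by auto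
  define A where "A = {t \<in> I. \<alpha> t \<in> fst c}"
  have A: "at t within A = at t within I"
    unfolding A_def by (rule curve_chart_at[OF chart_open[OF ca(1)] t ca(2)])
  show "velocity M I \<alpha> t c \<in> mmodel M"
  proof (rule has_vector_derivative_in_closed_subspace[OF model_subspace])
    show "((\<lambda>t. snd c (\<alpha> t)) has_vector_derivative velocity M I \<alpha> t c) (at t within A)"
      unfolding A by (rule velocity_derivative[OF t c])
    show "at t within A \<noteq> bot" unfolding A by (rule nt[OF t])
    show "t \<in> A" using t ca by (simp add: A_def)
    show "snd c (\<alpha> s) \<in> mmodel M" if "s \<in> A" for s
      using that chart_image_subset[OF ca(1)] by (auto simp: A_def)
  qed
  fix c' assume c': "c' \<in> charts_at M (\<alpha> t)"
  have ca': "c' \<in> atlas M" "\<alpha> t \<in> fst c'" using charts_atD[OF c'] by auto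
  define B where "B = {t \<in> I. \<alpha> t \<in> fst c \<inter> fst c'}"
  have B: "at t within B = at t within I"
    unfolding B_def using ca ca' t by (intro curve_chart_at openin_Int chart_open) auto
  have tB: "t \<in> B" using t ca ca' by (simp add: B_def)
  have "((\<lambda>s. snd c' (\<alpha> s)) has_derivative (\<lambda>v. jac c c' (\<alpha> t) (v *\<^sub>R velocity M I \<alpha> t c))) (at t within B)"
    by (rule chart_change_derivative[OF ca(1) ca'(1) tB])
      (use velocity_derivative[OF t c] B in \<open>auto simp: B_def has_vector_derivative_def\<close>)
  then have "((\<lambda>s. snd c' (\<alpha> s)) has_vector_derivative jac c c' (\<alpha> t) (velocity M I \<alpha> t c)) (at t within I)"
    by (simp add: has_vector_derivative_def B linear_scale[OF jac_linear[OF ca(1) ca'(1) ca(2) ca'(2)]])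
  then show "velocity M I \<alpha> t c' = jac c c' (\<alpha> t) (velocity M I \<alpha> t c)"
    using vector_derivative_within[OF nt[OF t]] velocity_derivative[OF t c'] by metis
qed (simp add: velocity_def)

end

end

text \<open>The integrand of \<open>curve_length\<close>, with the interval of differentiation as a
  parameter: on each piece it is continuous up to the end points, and inside the piece it coincides
  with the version for \<open>{0..1}\<close>.\<close>

definition speed ::
  "('m, 'v::euclidean_space) manifold \<Rightarrow> ('m \<Rightarrow> ('m, 'v) tvec \<Rightarrow> ('m, 'v) tvec \<Rightarrow> real) \<Rightarrow>
   real set \<Rightarrow> (real \<Rightarrow> 'm) \<Rightarrow> real \<Rightarrow> real" where
  "speed M g I \<alpha> t = sqrt (g (\<alpha> t) (velocity M I \<alpha> t) (velocity M I \<alpha> t))"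

section \<open>The metric in coordinates and the length of curves\<close>

locale riem_mfd =
  fixes M :: "('m, 'v::euclidean_space) manifold"
    and g :: "'m \<Rightarrow> ('m, 'v) tvec \<Rightarrow> ('m, 'v) tvec \<Rightarrow> real"
  assumes rm: "riemannian_manifold M g"

sublocale riem_mfd \<subseteq> smooth_mfd
  using rm by unfold_locales (simp add: riemannian_manifold_def)

context riem_mfd
begin

abbreviation "spd \<equiv> speed M g {0..1}"
abbreviation "len \<equiv> curve_length M g"

lemma metric_rules:
  assumes "q \<in> topspace (mtop M)" "X \<in> tangent_space M q"
  shows "Y \<in> tangent_space M q \<Longrightarrow> g q X Y = g q Y X"
    and "Y \<in> tangent_space M q \<Longrightarrow> g q (\<lambda>c. r *\<^sub>R X c) Y = r * g q X Y"
    and "Y \<in> tangent_space M q \<Longrightarrow> Z \<in> tangent_space M q \<Longrightarrow> g q (\<lambda>c. X c + Z c) Y = g q X Y + g q Z Y"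
    and "X \<noteq> (\<lambda>_. 0) \<Longrightarrow> g q X X > 0"
  using rm assms unfolding riemannian_manifold_def by blast+

text \<open>The argument is a coordinate point rather than a point of \<open>M\<close>, so that
  compactness and continuity are those of Euclidean space.\<close>

definition gform :: "('m, 'v) chart \<Rightarrow> 'v \<Rightarrow> 'v \<Rightarrow> 'v \<Rightarrow> real" where
  "gform c x u v = g (chart_inv c x) (cvec c (chart_inv c x) u) (cvec c (chart_inv c x) v)"

context
  fixes c assumes c: "c \<in> atlas M"
begin

lemma charts_at_chart_inv:
  assumes "x \<in> snd c ` fst c"
  shows "c \<in> charts_at M (chart_inv c x)" "chart_inv c x \<in> topspace (mtop M)"
  using c chart_inv_mem[OF assms] chart_domain[OF c] by (auto simp: charts_at_def)

lemma gform_linear_left: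
  assumes x: "x \<in> snd c ` fst c" and w: "w \<in> mmodel M"
  shows "lin_on (mmodel M) (\<lambda>v. gform c x v w)"
  unfolding lin_on_def gform_def
  using charts_at_chart_inv[OF x] w
  by (simp add: cvec_add cvec_scale metric_rules cvec_tangent)

lemma gform_linear_right:
  assumes x: "x \<in> snd c ` fst c" and w: "w \<in> mmodel M"
  shows "lin_on (mmodel M) (gform c x w)"
proof -
  have "gform c x w v = gform c x v w" if "v \<in> mmodel M" for v
    unfolding gform_def using charts_at_chart_inv[OF x] w that
    by (simp add: metric_rules(1) cvec_tangent)
  then show ?thesis
    using gform_linear_left[OF assms] model_subspace by (simp add: lin_on_def subspace_add subspace_mul)
qed

lemma gform_pos:
  assumes x: "x \<in> snd c ` fst c" and w: "w \<in> mmodel M" "w \<noteq> 0"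
  shows "gform c x w w > 0"
proof -
  have "cvec c (chart_inv c x) w \<noteq> (\<lambda>_. 0)"
    using cvec_self[OF charts_at_chart_inv(1)[OF x] w(1)] w(2) by metis
  then show ?thesis
    unfolding gform_def using charts_at_chart_inv[OF x] w by (intro metric_rules(4)) (auto intro: cvec_tangent)
qed

lemma gform_nonneg:
  assumes x: "x \<in> snd c ` fst c" and w: "w \<in> mmodel M"
  shows "gform c x w w \<ge> 0"
  using gform_pos[OF assms] lin_on_zero[OF gform_linear_right[OF assms] model_subspace]
  by (cases "w = 0") auto

lemma gform_continuous:
  assumes "u \<in> mmodel M" "v \<in> mmodel M"
  shows "continuous_on (snd c ` fst c) (\<lambda>x. gform c x u v)"
proof -
  have "smooth_fun M (fst c) (\<lambda>q. g q (cvec c q u) (cvec c q v))"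
    using rm[unfolded riemannian_manifold_def, THEN conjunct2, THEN conjunct2, rule_format,
        OF conjI, OF chart_open[OF c] conjI, OF cvec_smooth[OF c assms(1)] cvec_smooth[OF c assms(2)]] .
  from this[unfolded smooth_fun_def, rule_format, OF c]
  show ?thesis by (auto simp: gform_def o_def dest: smooth_on_imp_continuous)
qed

lemma metric_eq_gform:
  assumes q: "q \<in> fst c" and X: "X \<in> tangent_space M q"
  shows "g q X X = gform c (snd c q) (X c) (X c)"
proof -
  have "c \<in> charts_at M q" using c q by (simp add: charts_at_def)
  then have "X = cvec c q (X c)" using tangent_eq_cvec X by blast
  then show ?thesis using c q by (simp add: gform_def)
qed

text \<open>\<open>C\<close> is the constant that converts length on \<open>M\<close> into
  coordinate distance.\<close>

lemma gform_lower_bound: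
  assumes K: "compact K" "K \<subseteq> snd c ` fst c"
  obtains C where "C > 0" "\<And>x v. x \<in> K \<Longrightarrow> v \<in> mmodel M \<Longrightarrow> norm v \<le> C * sqrt (gform c x v v)"
proof -
  obtain B where B: "parseval_frame (mmodel M) B" using parseval_frame_exists[OF model_subspace] .
  obtain k where k: "k > 0" "\<And>x v. x \<in> K \<Longrightarrow> v \<in> mmodel M \<Longrightarrow> k * (norm v)\<^sup>2 \<le> gform c x v v"
  proof (rule compact_posdef_lower_bound[OF K(1) model_subspace B, of "gform c"])
    show "continuous_on K (\<lambda>x. gform c x b b')" if "b \<in> B" "b' \<in> B" for b b'
      using that B by (intro continuous_on_subset[OF gform_continuous K(2)]) (auto simp: parseval_frame_def)
  qed (use K gform_linear_left gform_linear_right gform_pos in auto)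
  have "norm v \<le> (1 / sqrt k) * sqrt (gform c x v v)" if "x \<in> K" "v \<in> mmodel M" for x v
  proof -
    have "sqrt k * norm v = sqrt (k * (norm v)\<^sup>2)" by (simp add: real_sqrt_mult)
    also have "\<dots> \<le> sqrt (gform c x v v)" using k(2)[OF that] by simp
    finally show ?thesis using k(1) by (simp add: field_simps)
  qed
  then show ?thesis using that[of "1 / sqrt k"] k(1) by simp
qed

end

lemma metric_nonneg:
  assumes "q \<in> topspace (mtop M)" "X \<in> tangent_space M q"
  shows "g q X X \<ge> 0"
proof -
  obtain c where c: "c \<in> atlas M" "q \<in> fst c" using atlas_cover[OF assms(1)] by blast
  have "X c \<in> mmodel M" by (rule tangent_model[OF _ assms(2)]) (use c in \<open>simp add: charts_at_def\<close>)
  then show ?thesis using metric_eq_gform[OF c assms(2)] gform_nonneg[OF c(1)] c(2) by simp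
qed

text \<open>Locally the squared speed is a quadratic polynomial in the frame components of the
  velocity, with coefficients \<open>gform\<close> at frame vectors. The expansion is made because
  continuity of \<open>gform\<close> is available for fixed vectors.\<close>

lemma speed_continuous:
  assumes curve: "smooth_curve M I \<alpha>" and nt: "\<And>t. t \<in> I \<Longrightarrow> at t within I \<noteq> bot"
  shows "continuous_on I (speed M g I \<alpha>)"
  unfolding continuous_on_eq_continuous_within
proof
  fix t assume t: "t \<in> I"
  have "\<alpha> t \<in> topspace (mtop M)" using curve t by (auto simp: smooth_curve_def continuous_map_def)
  then obtain c where c: "c \<in> atlas M" "\<alpha> t \<in> fst c" using atlas_cover by blast
  define A where "A = {t \<in> I. \<alpha> t \<in> fst c}"
  define w where "w = (\<lambda>t. velocity M I \<alpha> t c)"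
  obtain B where B: "parseval_frame (mmodel M) B" using parseval_frame_exists[OF model_subspace] .
  have sp: "speed M g I \<alpha> s = sqrt (\<Sum>b\<in>B. \<Sum>b'\<in>B. ((w s \<bullet> b) * (w s \<bullet> b')) *\<^sub>R gform c (snd c (\<alpha> s)) b b')"
    if "s \<in> A" for s
  proof -
    have s: "s \<in> I" "\<alpha> s \<in> fst c" using that by (auto simp: A_def)
    have tan: "velocity M I \<alpha> s \<in> tangent_space M (\<alpha> s)" by (rule velocity_tangent[OF curve nt s(1)])
    have "w s \<in> mmodel M" unfolding w_def
      by (rule tangent_model[OF _ tan]) (use c s in \<open>simp add: charts_at_def\<close>)
    then have "gform c (snd c (\<alpha> s)) (w s) (w s) = (\<Sum>b\<in>B. \<Sum>b'\<in>B. ((w s \<bullet> b) * (w s \<bullet> b')) *\<^sub>R gform c (snd c (\<alpha> s)) b b')"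
      using s by (intro bilin_on_expand[OF model_subspace B model_subspace B]
         gform_linear_left[OF c(1)] gform_linear_right[OF c(1)]) auto
    then show ?thesis by (simp add: speed_def metric_eq_gform[OF c(1) s(2) tan] w_def)
  qed
  have "continuous_on A (\<lambda>s. snd c (\<alpha> s))"
    using curve c(1) by (auto simp: smooth_curve_def A_def o_def dest!: smooth_on_imp_continuous)
  moreover have "continuous_on A w"
    unfolding w_def A_def by (rule velocity_continuous[OF curve nt c(1)])
  ultimately have "continuous_on A (\<lambda>s. sqrt (\<Sum>b\<in>B. \<Sum>b'\<in>B. ((w s \<bullet> b) * (w s \<bullet> b')) *\<^sub>R gform c (snd c (\<alpha> s)) b b'))"
    using B by (intro continuous_intros continuous_on_compose2[OF gform_continuous[OF c(1)]])
      (auto simp: parseval_frame_def A_def)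
  then have "continuous_on A (speed M g I \<alpha>)" by (rule continuous_on_eq) (rule sp[symmetric])
  then have "continuous (at t within A) (speed M g I \<alpha>)"
    using t c by (simp add: continuous_on_eq_continuous_within A_def)
  moreover have "at t within A = at t within I"
    unfolding A_def by (rule curve_chart_at[OF curve nt chart_open[OF c(1)] t c(2)])
  ultimately show "continuous (at t within I) (speed M g I \<alpha>)" by simp
qed

lemma speed_integrable:
  assumes "smooth_subdivision M \<alpha> T"
  shows "spd \<alpha> integrable_on {0..1}"
proof -
  note T = smooth_subdivisionD[OF assms]
  show ?thesis
  proof (rule pieces_induct[OF T(1,4,3), of "\<lambda>t. spd \<alpha> integrable_on {0..t}"])
    fix a b assume p: "(a, b) \<in> pieces T" and IH: "spd \<alpha> integrable_on {0..a}"
    have ab: "a < b" "a \<in> {0..1}" "b \<in> {0..1}" using piecesD[OF p] T(4) by auto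
    have i: "speed M g {a..b} \<alpha> integrable_on {a..b}"
      by (intro integrable_continuous_interval speed_continuous T(5)[OF p] at_within_Icc_neq_bot ab)
    \<comment> \<open>At \<open>a\<close> and \<open>b\<close> the velocity within the piece and
      that within \<open>{0..1}\<close> may differ; two points do not affect the integral.\<close>
    have e: "spd \<alpha> t = speed M g {a..b} \<alpha> t" if "t \<in> {a..b} - {a, b}" for t
      unfolding speed_def using that ab by (simp add: velocity_interior)
    have j: "spd \<alpha> integrable_on {a..b}"
      by (rule integrable_spike_finite[where S = "{a, b}", OF _ e i]) simp_all
    show "spd \<alpha> integrable_on {0..b}"
      by (rule Henstock_Kurzweil_Integration.integrable_combine[OF _ _ IH j]) (use ab in simp_all)
  next
    show "spd \<alpha> integrable_on {0..0}"
      using integrable_on_refl[of "spd \<alpha>" 0] by simp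
  qed (rule T(2))
qed

lemma subdivision_velocity:
  assumes "smooth_subdivision M \<alpha> T" and t: "t \<in> {0..1}" "t \<notin> T"
  shows "velocity M {0..1} \<alpha> t \<in> tangent_space M (\<alpha> t)"
    and "c \<in> charts_at M (\<alpha> t) \<Longrightarrow> ((\<lambda>t. snd c (\<alpha> t)) has_vector_derivative velocity M {0..1} \<alpha> t c) (at t)"
    and "\<alpha> t \<in> topspace (mtop M)"
proof -
  note T = smooth_subdivisionD[OF assms(1)]
  obtain a b where ab: "(a, b) \<in> pieces T" "a < t" "t < b" using pieces_cover[OF T(1-3) t] .
  \<comment> \<open>\<open>T\<close> contains 0 and 1, so \<open>t\<close> is interior and both
    velocities below are two-sided.\<close>
  have t01: "0 < t" "t < 1" using t T(2,3) by (cases "t = 0"; cases "t = 1"; simp)+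
  have v: "velocity M {0..1} \<alpha> t = velocity M {a..b} \<alpha> t"
    by (simp add: velocity_interior[OF t01] velocity_interior[OF ab(2,3)])
  note cv = T(5)[OF ab(1)] at_within_Icc_neq_bot[OF piecesD(3)[OF ab(1)]]
  show "velocity M {0..1} \<alpha> t \<in> tangent_space M (\<alpha> t)"
    unfolding v by (rule velocity_tangent[OF cv]) (use ab in auto)
  show "((\<lambda>t. snd c (\<alpha> t)) has_vector_derivative velocity M {0..1} \<alpha> t c) (at t)" if "c \<in> charts_at M (\<alpha> t)"
    unfolding v using velocity_derivative[OF cv _ that] ab by (simp add: at_within_Icc_interior)
  show "\<alpha> t \<in> topspace (mtop M)"
    using cv(1) ab by (auto simp: smooth_curve_def continuous_map_def)
qed

lemma speed_has_integral:
  assumes "smooth_subdivision M \<alpha> T"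
  shows "(spd \<alpha> has_integral len \<alpha>) {0..1}"
  using speed_integrable[OF assms] by (simp add: curve_length_def speed_def[abs_def] has_integral_integral)

text \<open>
  At a break point the \<open>velocity\<close> is arbitrary, so the radicand of \<open>speed\<close>, hence its root, may be
  negative there.
\<close>

lemma curve_length_has_integral:
  assumes "smooth_subdivision M \<alpha> T"
  shows "((\<lambda>t. if t \<in> T then 0 else spd \<alpha> t) has_integral len \<alpha>) {0..1}"
  by (rule has_integral_spike_finite[OF smooth_subdivisionD(1)[OF assms] _ speed_has_integral[OF assms]]) simp

lemma speed_nonneg:
  assumes "smooth_subdivision M \<alpha> T" "t \<in> {0..1}"
  shows "0 \<le> (if t \<in> T then 0 else spd \<alpha> t)"
  using metric_nonneg subdivision_velocity[OF assms] by (simp add: speed_def)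

lemma curve_length_nonneg:
  assumes "smooth_subdivision M \<alpha> T" shows "len \<alpha> \<ge> 0"
  by (rule has_integral_nonneg[OF curve_length_has_integral[OF assms] speed_nonneg[OF assms]])

end

section \<open>Vector bundles with a connection\<close>

locale bundle_connection = riem_mfd M g
  for M :: "('m, 'v::euclidean_space) manifold" and g +
  fixes E :: "('m, 'e, 'f::euclidean_space) vbundle"
    and h :: "'e \<Rightarrow> 'e \<Rightarrow> real"
    and nabla :: "('m \<Rightarrow> 'e) \<Rightarrow> 'm \<Rightarrow> ('m, 'v) tvec \<Rightarrow> 'e"
  assumes vb: "vector_bundle M E" and bm: "bundle_metric M E h" and conn: "connection M E nabla"
begin

abbreviation "parallel \<equiv> parallel_along M E nabla"

lemma fmodel_subspace: "subspace (fmodel E)"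
  using vb unfolding vector_bundle_def by blast

lemma triv_cover:
  assumes "q \<in> topspace (mtop M)" obtains U \<Phi> where "(U, \<Phi>) \<in> trivs E" "q \<in> U"
proof -
  have "(\<Union>\<tau>\<in>trivs E. fst \<tau>) = topspace (mtop M)" using vb unfolding vector_bundle_def by blast
  then obtain \<tau> where "\<tau> \<in> trivs E" "q \<in> fst \<tau>" using assms by blast
  then show ?thesis using that[of "fst \<tau>" "snd \<tau>"] by simp
qed

lemma smooth_fun_cong:
  assumes "smooth_fun M U f" "\<And>q. q \<in> U \<Longrightarrow> f' q = f q"
  shows "smooth_fun M U f'"
  unfolding smooth_fun_def
proof
  fix c assume c: "c \<in> atlas M"
  show "smooth_on (snd c ` (U \<inter> fst c)) (f' \<circ> chart_inv c)"
    by (rule smooth_on_cong[OF assms(1)[unfolded smooth_fun_def, rule_format, OF c]])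
      (use c assms(2) in \<open>clarsimp\<close>)
qed

lemma smooth_fun_subset:
  assumes "smooth_fun M U f" "W \<subseteq> U" shows "smooth_fun M W f"
  unfolding smooth_fun_def smooth_on_def
proof (intro ballI allI)
  fix c k assume c: "c \<in> atlas M"
  show "Ck_on k (snd c ` (W \<inter> fst c)) (f \<circ> chart_inv c)"
    by (rule Ck_on_subset[OF assms(1)[unfolded smooth_fun_def smooth_on_def, rule_format, OF c]])
      (use assms(2) in blast)
qed

lemma smooth_fun_const: "smooth_fun M U (\<lambda>_. r)"
  by (simp add: smooth_fun_def smooth_on_def o_def Ck_on_const)

lemma smooth_section_cong:
  assumes s: "smooth_section M E U s" and eq: "\<And>q. q \<in> U \<Longrightarrow> s' q = s q"
  shows "smooth_section M E U s'"
  unfolding smooth_section_def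
proof (intro conjI ballI)
  fix q assume "q \<in> U" then show "s' q \<in> fibre E q" using s eq by (simp add: smooth_section_def)
next
  fix \<tau> assume t: "\<tau> \<in> trivs E"
  have "smooth_fun M (U \<inter> fst \<tau>) (snd \<tau> \<circ> s)"
    using s t unfolding smooth_section_def by (metis (no_types, lifting) case_prod_unfold)
  then have "smooth_fun M (U \<inter> fst \<tau>) (snd \<tau> \<circ> s')"
    by (rule smooth_fun_cong) (simp add: eq)
  then show "case \<tau> of (W, \<Phi>) \<Rightarrow> smooth_fun M (U \<inter> W) (\<Phi> \<circ> s')" by (simp add: case_prod_unfold)
qed

text \<open>This feeds the Leibniz rule with a constant function, which yields homogeneity of
  \<open>nabla\<close> in the section.\<close>

lemma dir_deriv_const:
  assumes q: "q \<in> topspace (mtop M)" and X: "X \<in> tangent_space M q"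
  shows "dir_deriv M q X (\<lambda>_. r) = 0"
proof -
  define c where "c = (SOME c. c \<in> charts_at M q)"
  have "\<exists>c. c \<in> charts_at M q" using atlas_cover[OF q] by (auto simp: charts_at_def)
  then have c: "c \<in> charts_at M q" unfolding c_def by (rule someI_ex)
  have ca: "c \<in> atlas M" "q \<in> fst c" using charts_atD[OF c] by auto
  have "frechet_derivative ((\<lambda>_. r) \<circ> chart_inv c) (at (snd c q) within snd c ` fst c) (X c) = (\<lambda>_. 0) (X c)"
  proof (rule frechet_derivative_subspace[OF model_subspace])
    show "openin (top_of_set (mmodel M)) (snd c ` fst c)"
      using chart_conditions[OF ca(1)] by blast
    show "((\<lambda>_. r) \<circ> chart_inv c has_derivative (\<lambda>_. 0)) (at (snd c q) within snd c ` fst c)"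
      by (simp add: o_def)
  qed (use ca tangent_model[OF c X] in auto)
  then show ?thesis unfolding dir_deriv_def c_def[symmetric] Let_def by simp
qed

lemma fibre_topspace: "e \<in> fibre E q \<Longrightarrow> q \<in> topspace (mtop M)"
proof -
  assume "e \<in> fibre E q"
  moreover have "continuous_map (etop E) (mtop M) (proj E)"
    using vb unfolding vector_bundle_def by blast
  ultimately show ?thesis by (auto simp: fibre_def continuous_map_def)
qed

section \<open>Fibres, constant sections and the connection form in a trivialization\<close>

context
  fixes U :: "'m set" and \<Phi> :: "'e \<Rightarrow> 'f"
  assumes triv: "(U, \<Phi>) \<in> trivs E"
begin

lemma triv_conditions:
  "openin (mtop M) U"
  "homeomorphic_map (subtopology (etop E) {e \<in> topspace (etop E). proj E e \<in> U})
     (prod_topology (subtopology (mtop M) U) (top_of_set (fmodel E))) (\<lambda>e. (proj E e, \<Phi> e))"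
  "\<forall>q\<in>U. \<forall>e\<in>fibre E q.
     (\<forall>e'\<in>fibre E q. vadd E e e' \<in> fibre E q \<and> \<Phi> (vadd E e e') = \<Phi> e + \<Phi> e') \<and>
     (\<forall>r. vscale E r e \<in> fibre E q \<and> \<Phi> (vscale E r e) = r *\<^sub>R \<Phi> e)"
proof -
  have "\<forall>(U, \<Phi>)\<in>trivs E. openin (mtop M) U \<and>
        homeomorphic_map (subtopology (etop E) {e \<in> topspace (etop E). proj E e \<in> U})
          (prod_topology (subtopology (mtop M) U) (top_of_set (fmodel E)))
          (\<lambda>e. (proj E e, \<Phi> e)) \<and>
        (\<forall>q\<in>U. \<forall>e\<in>fibre E q.
           (\<forall>e'\<in>fibre E q. vadd E e e' \<in> fibre E q \<and> \<Phi> (vadd E e e') = \<Phi> e + \<Phi> e') \<and>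
           (\<forall>r. vscale E r e \<in> fibre E q \<and> \<Phi> (vscale E r e) = r *\<^sub>R \<Phi> e))"
    using vb unfolding vector_bundle_def by (elim conjE)
  note * = bspec[OF this triv, unfolded prod.case]
  show "openin (mtop M) U" by (rule *[THEN conjunct1])
  show "homeomorphic_map (subtopology (etop E) {e \<in> topspace (etop E). proj E e \<in> U})
     (prod_topology (subtopology (mtop M) U) (top_of_set (fmodel E))) (\<lambda>e. (proj E e, \<Phi> e))"
    by (rule *[THEN conjunct2, THEN conjunct1])
  show "\<forall>q\<in>U. \<forall>e\<in>fibre E q.
     (\<forall>e'\<in>fibre E q. vadd E e e' \<in> fibre E q \<and> \<Phi> (vadd E e e') = \<Phi> e + \<Phi> e') \<and>
     (\<forall>r. vscale E r e \<in> fibre E q \<and> \<Phi> (vscale E r e) = r *\<^sub>R \<Phi> e)"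
    by (rule *[THEN conjunct2, THEN conjunct2])
qed

lemma fibre_ops:
  assumes "q \<in> U" "e \<in> fibre E q"
  shows "e' \<in> fibre E q \<Longrightarrow> vadd E e e' \<in> fibre E q" "e' \<in> fibre E q \<Longrightarrow> \<Phi> (vadd E e e') = \<Phi> e + \<Phi> e'"
    "vscale E r e \<in> fibre E q" "\<Phi> (vscale E r e) = r *\<^sub>R \<Phi> e"
  using triv_conditions(3) assms by blast+

lemma triv_subset: "U \<subseteq> topspace (mtop M)"
  by (rule openin_subset[OF triv_conditions(1)])

text \<open>Both halves come from the homeomorphism over \<open>U\<close>, whose first component
  \<open>proj\<close> pins down the fibre.\<close>

lemma triv_bij: assumes q: "q \<in> U" shows "bij_betw \<Phi> (fibre E q) (fmodel E)"
proof -
  let ?X = "{e \<in> topspace (etop E). proj E e \<in> U}"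
  have t: "topspace (subtopology (etop E) ?X) = ?X" by auto
  have inj: "inj_on (\<lambda>e. (proj E e, \<Phi> e)) ?X"
    using homeomorphic_imp_injective_map[OF triv_conditions(2)] unfolding t .
  have surj: "(\<lambda>e. (proj E e, \<Phi> e)) ` ?X = U \<times> fmodel E"
    using homeomorphic_imp_surjective_map[OF triv_conditions(2)] triv_subset unfolding t
    by (simp add: Int_absorb1)
  show ?thesis unfolding bij_betw_def
  proof
    show "inj_on \<Phi> (fibre E q)"
    proof (rule inj_onI)
      fix x y assume "x \<in> fibre E q" "y \<in> fibre E q" "\<Phi> x = \<Phi> y"
      then show "x = y" using inj_onD[OF inj, of x y] q by (simp add: fibre_def)
    qed
    show "\<Phi> ` fibre E q = fmodel E"
    proof
      show "\<Phi> ` fibre E q \<subseteq> fmodel E"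
      proof
        fix v assume "v \<in> \<Phi> ` fibre E q"
        then obtain e where e: "e \<in> fibre E q" "v = \<Phi> e" by blast
        then have "(proj E e, \<Phi> e) \<in> U \<times> fmodel E"
          unfolding surj[symmetric] using q by (intro imageI) (simp add: fibre_def)
        then show "v \<in> fmodel E" using e by simp
      qed
      show "fmodel E \<subseteq> \<Phi> ` fibre E q"
      proof
        fix v assume "v \<in> fmodel E"
        then have "(q, v) \<in> (\<lambda>e. (proj E e, \<Phi> e)) ` ?X" unfolding surj using q by simp
        then obtain e where "e \<in> ?X" "proj E e = q" "\<Phi> e = v" by auto
        then show "v \<in> \<Phi> ` fibre E q" by (auto simp: fibre_def)
      qed
    qed
  qed
qed

lemma triv_mem: "q \<in> U \<Longrightarrow> e \<in> fibre E q \<Longrightarrow> \<Phi> e \<in> fmodel E"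
  using triv_bij by (auto simp: bij_betw_def)

lemma triv_inj: "q \<in> U \<Longrightarrow> e \<in> fibre E q \<Longrightarrow> e' \<in> fibre E q \<Longrightarrow> \<Phi> e = \<Phi> e' \<Longrightarrow> e = e'"
  using triv_bij[of q] by (auto simp: bij_betw_def dest: inj_onD)

lemma const_section_mem: "q \<in> U \<Longrightarrow> v \<in> fmodel E \<Longrightarrow> const_section E \<Phi> v q \<in> fibre E q"
  using triv_bij[of q] by (simp add: const_section_def bij_betw_def inv_into_into)

lemma const_section_triv [simp]: "q \<in> U \<Longrightarrow> v \<in> fmodel E \<Longrightarrow> \<Phi> (const_section E \<Phi> v q) = v"
  using triv_bij[of q] by (simp add: const_section_def bij_betw_def f_inv_into_f)

lemma const_section_self: "q \<in> U \<Longrightarrow> e \<in> fibre E q \<Longrightarrow> const_section E \<Phi> (\<Phi> e) q = e"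
  using triv_bij[of q] by (simp add: const_section_def bij_betw_def)

lemma const_section_smooth:
  assumes v: "v \<in> fmodel E" and W: "W \<subseteq> U"
  shows "smooth_section M E W (const_section E \<Phi> v)"
  unfolding smooth_section_def
proof (intro conjI ballI)
  fix q assume "q \<in> W" then show "const_section E \<Phi> v q \<in> fibre E q" using W v const_section_mem by blast
next
  fix \<tau> assume t: "\<tau> \<in> trivs E"
  have "\<forall>(U, \<Phi>)\<in>trivs E. \<forall>(W, \<Psi>)\<in>trivs E. \<forall>v\<in>fmodel E.
        smooth_fun M (U \<inter> W) (\<lambda>q. \<Psi> (const_section E \<Phi> v q))"
    using vb unfolding vector_bundle_def by (elim conjE)
  from bspec[OF this triv, unfolded prod.case, THEN bspec, OF t] v
  have "smooth_fun M (U \<inter> fst \<tau>) (\<lambda>q. snd \<tau> (const_section E \<Phi> v q))"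
    by (simp add: case_prod_unfold)
  then have "smooth_fun M (W \<inter> fst \<tau>) (\<lambda>q. snd \<tau> (const_section E \<Phi> v q))"
    by (rule smooth_fun_subset) (use W in blast)
  then show "case \<tau> of (W', \<Psi>) \<Rightarrow> smooth_fun M (W \<inter> W') (\<Psi> \<circ> const_section E \<Phi> v)"
    by (simp add: case_prod_unfold o_def)
qed

text \<open>The connection form of the trivialization \<open>\<Phi>\<close>.\<close>

definition cform :: "'m \<Rightarrow> ('m, 'v) tvec \<Rightarrow> 'f \<Rightarrow> 'f" where
  "cform q X v = \<Phi> (nabla (const_section E \<Phi> v) q X)"

lemma nabla_rules:
  assumes "smooth_section M E U s" "q \<in> U" "X \<in> tangent_space M q"
  shows "nabla s q X \<in> fibre E q"
    "Y \<in> tangent_space M q \<Longrightarrow> nabla s q (\<lambda>c. X c + Y c) = vadd E (nabla s q X) (nabla s q Y)"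
    "nabla s q (\<lambda>c. r *\<^sub>R X c) = vscale E r (nabla s q X)"
    "smooth_section M E U s' \<Longrightarrow>
       nabla (\<lambda>q. vadd E (s q) (s' q)) q X = vadd E (nabla s q X) (nabla s' q X)"
    "smooth_fun M U f \<Longrightarrow> nabla (\<lambda>q. vscale E (f q) (s q)) q X =
              vadd E (vscale E (f q) (nabla s q X)) (vscale E (dir_deriv M q X f) (s q))"
    "smooth_section M E U s' \<Longrightarrow> (\<forall>q\<in>U. s' q = s q) \<Longrightarrow> nabla s' q X = nabla s q X"
  using conn[unfolded connection_def, THEN spec, THEN spec, THEN mp, OF conjI[OF triv_conditions(1) assms(1)],
     THEN conjunct1, THEN bspec, OF assms(2), THEN bspec, OF assms(3)] by simp_all

lemma cform_add_left:
  assumes "q \<in> U" "X \<in> tangent_space M q" "Y \<in> tangent_space M q" "v \<in> fmodel E"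
  shows "cform q (\<lambda>c. X c + Y c) v = cform q X v + cform q Y v"
proof -
  note s = const_section_smooth[OF assms(4) order_refl]
  show ?thesis unfolding cform_def nabla_rules(2)[OF s assms(1-3)]
    by (rule fibre_ops(2)[OF assms(1)]) (use assms s in \<open>simp_all add: nabla_rules(1)\<close>)
qed

lemma cform_scale_left:
  assumes "q \<in> U" "X \<in> tangent_space M q" "v \<in> fmodel E"
  shows "cform q (\<lambda>c. r *\<^sub>R X c) v = r *\<^sub>R cform q X v"
proof -
  note s = const_section_smooth[OF assms(3) order_refl]
  show ?thesis unfolding cform_def nabla_rules(3)[OF s assms(1-2)]
    by (rule fibre_ops(4)[OF assms(1)]) (use assms s in \<open>simp add: nabla_rules(1)\<close>)
qed

text \<open>The sum of two constant sections equals a constant section over \<open>U\<close> and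
  possibly nowhere else, so locality of the connection is used. Homogeneity is the Leibniz rule for
  a constant function.\<close>

lemma cform_linear_right:
  assumes q: "q \<in> U" and X: "X \<in> tangent_space M q"
  shows "lin_on (fmodel E) (cform q X)"
  unfolding lin_on_def
proof (intro ballI conjI allI)
  fix u v assume u: "u \<in> fmodel E" and v: "v \<in> fmodel E"
  let ?s = "const_section E \<Phi>"
  note su = const_section_smooth[OF u order_refl] and sv = const_section_smooth[OF v order_refl]
  have uv: "u + v \<in> fmodel E" using fmodel_subspace u v by (rule subspace_add)
  note suv = const_section_smooth[OF uv order_refl]
  have eq: "\<forall>q\<in>U. vadd E (?s u q) (?s v q) = ?s (u + v) q"
  proof
    fix q assume q: "q \<in> U"
    show "vadd E (?s u q) (?s v q) = ?s (u + v) q"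
      by (rule triv_inj[OF q]) (simp_all add: q u v uv fibre_ops[OF q] const_section_mem)
  qed
  have s2: "smooth_section M E U (\<lambda>q. vadd E (?s u q) (?s v q))"
    by (rule smooth_section_cong[OF suv]) (use eq in simp)
  have "nabla (?s (u + v)) q X = nabla (\<lambda>q. vadd E (?s u q) (?s v q)) q X"
    using nabla_rules(6)[OF suv q X s2 eq] by simp
  also have "\<dots> = vadd E (nabla (?s u) q X) (nabla (?s v) q X)"
    by (rule nabla_rules(4)[OF su q X sv])
  finally show "cform q X (u + v) = cform q X u + cform q X v"
    unfolding cform_def
    by (simp add: fibre_ops(2)[OF q nabla_rules(1)[OF su q X] nabla_rules(1)[OF sv q X]])
next
  fix u r assume u: "u \<in> fmodel E"
  let ?s = "const_section E \<Phi>"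
  note su = const_section_smooth[OF u order_refl]
  have ru: "r *\<^sub>R u \<in> fmodel E" using fmodel_subspace u by (simp add: subspace_mul)
  note sru = const_section_smooth[OF ru order_refl]
  have eq: "\<forall>q\<in>U. vscale E r (?s u q) = ?s (r *\<^sub>R u) q"
  proof
    fix q assume q: "q \<in> U"
    show "vscale E r (?s u q) = ?s (r *\<^sub>R u) q"
      by (rule triv_inj[OF q]) (simp_all add: q u ru fibre_ops[OF q] const_section_mem)
  qed
  have s2: "smooth_section M E U (\<lambda>q. vscale E r (?s u q))"
    by (rule smooth_section_cong[OF sru]) (use eq in simp)
  have qM: "q \<in> topspace (mtop M)" using q triv_subset by blast
  have "nabla (?s (r *\<^sub>R u)) q X = nabla (\<lambda>q. vscale E r (?s u q)) q X"
    using nabla_rules(6)[OF sru q X s2 eq] by simp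
  also have "\<dots> = vadd E (vscale E r (nabla (?s u) q X)) (vscale E 0 (?s u q))"
    using nabla_rules(5)[OF su q X smooth_fun_const[of U r]] dir_deriv_const[OF qM X] by simp
  finally show "cform q X (r *\<^sub>R u) = r *\<^sub>R cform q X u"
    unfolding cform_def
    by (simp add: fibre_ops[OF q] nabla_rules(1)[OF su q X] const_section_mem[OF q u])
qed

context
  fixes c assumes c: "c \<in> atlas M"
begin

lemma cform_continuous:
  assumes w: "w \<in> mmodel M" and v: "v \<in> fmodel E"
  shows "continuous_on (snd c ` (U \<inter> fst c)) (\<lambda>x. cform (chart_inv c x) (cvec c (chart_inv c x) w) v)"
proof -
  let ?W = "U \<inter> fst c"
  have W: "openin (mtop M) ?W" by (intro openin_Int triv_conditions chart_open c)
  have X: "smooth_vector_field M ?W (\<lambda>q. cvec c q w)"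
    using cvec_smooth[OF c w] unfolding smooth_vector_field_def smooth_on_def
    by (auto intro: Ck_on_subset)
  have s: "smooth_section M E ?W (const_section E \<Phi> v)"
    by (rule const_section_smooth[OF v]) simp
  have "smooth_section M E ?W (\<lambda>q. nabla (const_section E \<Phi> v) q (cvec c q w))"
    using conn[unfolded connection_def, THEN spec, THEN spec, THEN mp, OF conjI[OF W s],
       THEN conjunct2, THEN spec, THEN mp, OF X] .
  then have "smooth_fun M (?W \<inter> U) (\<Phi> \<circ> (\<lambda>q. nabla (const_section E \<Phi> v) q (cvec c q w)))"
    unfolding smooth_section_def by (elim conjE) (drule bspec[OF _ triv], simp)
  then have "smooth_on (snd c ` (?W \<inter> U \<inter> fst c)) ((\<Phi> \<circ> (\<lambda>q. nabla (const_section E \<Phi> v) q (cvec c q w))) \<circ> chart_inv c)"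
    unfolding smooth_fun_def using c by (rule bspec)
  then have "continuous_on (snd c ` (?W \<inter> U \<inter> fst c)) ((\<Phi> \<circ> (\<lambda>q. nabla (const_section E \<Phi> v) q (cvec c q w))) \<circ> chart_inv c)"
    by (rule smooth_on_imp_continuous)
  moreover have "?W \<inter> U \<inter> fst c = ?W" by blast
  ultimately show ?thesis by (simp add: cform_def o_def)
qed

text \<open>In coordinates the connection form is a family of bilinear maps with continuous
  coefficients, bounded by compactness; the component \<open>X c\<close> then stands for the tangent
  vector.\<close>

lemma cform_bound:
  assumes K: "compact K" "K \<subseteq> snd c ` (U \<inter> fst c)"
  obtains D where "D \<ge> 0" "\<And>q X v. q \<in> U \<inter> fst c \<Longrightarrow> snd c q \<in> K \<Longrightarrow> X \<in> tangent_space M q \<Longrightarrow>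
     v \<in> fmodel E \<Longrightarrow> norm (cform q X v) \<le> D * norm (X c) * norm v"
proof -
  let ?A = "\<lambda>x w v. cform (chart_inv c x) (cvec c (chart_inv c x) w) v"
  obtain B where B: "parseval_frame (mmodel M) B" using parseval_frame_exists[OF model_subspace] .
  obtain F where F: "parseval_frame (fmodel E) F" using parseval_frame_exists[OF fmodel_subspace] .
  have x: "chart_inv c x \<in> U" "c \<in> charts_at M (chart_inv c x)" if "x \<in> K" for x
    using that K(2) c by (auto simp: charts_at_def)
  obtain D where D: "D \<ge> 0" "\<And>x w v. x \<in> K \<Longrightarrow> w \<in> mmodel M \<Longrightarrow> v \<in> fmodel E \<Longrightarrow>
      norm (?A x w v) \<le> D * norm w * norm v"
  proof (rule compact_bilin_bound[OF K(1) model_subspace B fmodel_subspace F, of ?A])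
    fix x v assume xK: "x \<in> K" and v: "v \<in> fmodel E"
    show "lin_on (mmodel M) (\<lambda>w. ?A x w v)"
      unfolding lin_on_def
      using x[OF xK] v by (simp add: cvec_add cvec_scale cform_add_left cform_scale_left cvec_tangent)
  next
    fix x w assume xK: "x \<in> K" and w: "w \<in> mmodel M"
    show "lin_on (fmodel E) (?A x w)"
      by (rule cform_linear_right) (use x[OF xK] w in \<open>auto intro: cvec_tangent\<close>)
  next
    fix b f assume "b \<in> B" "f \<in> F"
    then show "continuous_on K (\<lambda>x. ?A x b f)"
      using B F by (intro continuous_on_subset[OF cform_continuous K(2)]) (auto simp: parseval_frame_def)
  qed auto
  have "norm (cform q X v) \<le> D * norm (X c) * norm v"
    if q: "q \<in> U \<inter> fst c" "snd c q \<in> K" and X: "X \<in> tangent_space M q" and v: "v \<in> fmodel E" for q X v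
  proof -
    have cq: "c \<in> charts_at M q" using q c by (simp add: charts_at_def)
    have "X = cvec c q (X c)" by (rule tangent_eq_cvec[OF cq X])
    then show ?thesis
      using D(2)[OF q(2) tangent_model[OF cq X] v] q c by simp
  qed
  then show ?thesis using that D(1) by blast
qed

end

end

end

section \<open>Reversal and concatenation of curves\<close>

text \<open>Reversal has \<open>m = -1\<close>, the halves of a concatenation have
  \<open>m = 2\<close>. Interior parameters stay interior, so that there one-sided derivatives can
  be replaced by two-sided ones.\<close>

lemma affine_image_Icc:
  fixes m k :: real
  assumes "m \<noteq> 0" "a < b"
  shows "\<exists>a' b'. (\<lambda>t. m * t + k) ` {a..b} = {a'..b'} \<and> a' < b' \<and>
    (\<forall>t. a < t \<longrightarrow> t < b \<longrightarrow> a' < m * t + k \<and> m * t + k < b')"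
proof (cases "m > 0")
  case True
  then have "(\<lambda>t. m * t + k) ` {a..b} = {m * a + k..m * b + k}"
    using assms image_affinity_atLeastAtMost[of m k a b] by simp
  then show ?thesis using True assms by (intro exI[of _ "m * a + k"] exI[of _ "m * b + k"]) simp
next
  case False
  then have "(\<lambda>t. m * t + k) ` {a..b} = {m * b + k..m * a + k}"
    using assms image_affinity_atLeastAtMost[of m k a b] by simp
  then show ?thesis using False assms by (intro exI[of _ "m * b + k"] exI[of _ "m * a + k"]) simp
qed

lemma smooth_subdivisionI:
  assumes "\<And>a b. (a, b) \<in> pieces T \<Longrightarrow> smooth_curve M {a..b} \<alpha>"
    "0 \<in> T" "1 \<in> T" "finite T" "T \<subseteq> {0..1}"
  shows "smooth_subdivision M \<alpha> T"
  unfolding smooth_subdivision_def using assms by auto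

lemma pieces_reverse:
  assumes "(a, b) \<in> pieces ((\<lambda>t. 1 - t) ` T)"
  shows "(1 - b, 1 - a) \<in> pieces T"
proof -
  note p = piecesD[OF assms]
  have "x \<notin> T" if "1 - b < x" "x < 1 - a" for x
  proof
    assume "x \<in> T"
    then have "1 - x \<in> {a<..<b} \<inter> (\<lambda>t. 1 - t) ` T" using that by auto
    then show False using p(4) by blast
  qed
  then show ?thesis using p(1-3) by (auto simp: pieces_def)
qed

text \<open>As \<open>joinpaths\<close>, which however requires a topological space as type of the points.\<close>

definition join_curves :: "(real \<Rightarrow> 'x) \<Rightarrow> (real \<Rightarrow> 'x) \<Rightarrow> real \<Rightarrow> 'x" where
  "join_curves \<alpha> \<beta> t = (if t \<le> 1 / 2 then \<alpha> (2 * t) else \<beta> (2 * t - 1))"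

text \<open>At 1/2 the definition evaluates the first curve; the matching end points make the second
  formula valid there too.\<close>

lemma join_upper: "\<alpha> 1 = \<beta> 0 \<Longrightarrow> 1 / 2 \<le> r \<Longrightarrow> join_curves \<alpha> \<beta> r = \<beta> (2 * r + - 1)"
  by (cases "2 * r = 1") (simp_all add: join_curves_def)

definition join_subdivision :: "real set \<Rightarrow> real set \<Rightarrow> real set" where
  "join_subdivision T T' = (\<lambda>t. t / 2) ` T \<union> (\<lambda>t. (t + 1) / 2) ` T'"

text \<open>The point 1/2 belongs to the joined subdivision, so no piece straddles it, and each
  piece is a rescaled piece of one of the two subdivisions.\<close>

lemma pieces_join:
  assumes ab: "(a, b) \<in> pieces (join_subdivision T T')"
    and T: "T \<subseteq> {0..1}" "1 \<in> T" and T': "T' \<subseteq> {0..1}" "0 \<in> T'"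
  shows "b \<le> 1 / 2 \<and> (2 * a, 2 * b) \<in> pieces T \<or> 1 / 2 \<le> a \<and> (2 * a - 1, 2 * b - 1) \<in> pieces T'"
proof -
  let ?S = "join_subdivision T T'"
  note p = piecesD[OF ab]
  have half: "1 / 2 \<in> ?S" using T(2) by (force simp: join_subdivision_def)
  \<comment> \<open>A point of the lower half that comes from \<open>T'\<close> can only be 1/2, and
    then \<open>2 * x = 1\<close> belongs to \<open>T\<close>. The upper half is symmetric.\<close>
  have in_lo: "2 * x \<in> T" if x: "x \<in> ?S" "x \<le> 1 / 2" for x
  proof -
    from x(1) consider y where "y \<in> T" "x = y / 2" | y where "y \<in> T'" "x = (y + 1) / 2"
      unfolding join_subdivision_def by blast
    then show ?thesis
    proof cases
      case (2 y)
      then have "y = 0" using x(2) T'(1) by force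
      then have "2 * x = 1" using 2 by simp
      then show ?thesis using T(2) by simp
    next
      case (1 y)
      then have "2 * x = y" by simp
      then show ?thesis using 1(1) by (simp only:)
    qed
  qed
  have in_hi: "2 * x - 1 \<in> T'" if x: "x \<in> ?S" "1 / 2 \<le> x" for x
  proof -
    from x(1) consider y where "y \<in> T" "x = y / 2" | y where "y \<in> T'" "x = (y + 1) / 2"
      unfolding join_subdivision_def by blast
    then show ?thesis
    proof cases
      case (1 y)
      then have "y = 1" using x(2) T(1) by force
      then have "2 * x - 1 = 0" using 1 by simp
      then show ?thesis using T'(2) by (simp only:)
    next
      case (2 y)
      then have "2 * x - 1 = y" by simp
      then show ?thesis using 2(1) by (simp only:)
    qed
  qed
  have lo: "x / 2 \<in> ?S" if "x \<in> T" for x using that by (auto simp: join_subdivision_def)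
  have hi: "(x + 1) / 2 \<in> ?S" if "x \<in> T'" for x using that by (auto simp: join_subdivision_def)
  have "\<not> (a < 1 / 2 \<and> 1 / 2 < b)"
  proof
    assume "a < 1 / 2 \<and> 1 / 2 < b"
    then have "1 / 2 \<in> {a<..<b}" by (simp only: greaterThanLessThan_iff)
    then show False using half p(4) by blast
  qed
  then consider "b \<le> 1 / 2" | "1 / 2 \<le> a" by linarith
  then show ?thesis
  proof cases
    case 1
    have "x \<notin> T" if "2 * a < x" "x < 2 * b" for x
    proof
      assume "x \<in> T"
      moreover have "x / 2 \<in> {a<..<b}" using that by simp
      ultimately show False using lo[of x] p(4) by blast
    qed
    then have "(2 * a, 2 * b) \<in> pieces T" using 1 p(1-3) in_lo by (auto simp: pieces_def)
    then show ?thesis using 1 by simp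
  next
    case 2
    have "x \<notin> T'" if "2 * a - 1 < x" "x < 2 * b - 1" for x
    proof
      assume "x \<in> T'"
      moreover have "(x + 1) / 2 \<in> {a<..<b}" using that by (simp add: field_simps)
      ultimately show False using hi[of x] p(4) by blast
    qed
    then have "(2 * a - 1, 2 * b - 1) \<in> pieces T'" using 2 p(1-3) in_hi by (auto simp: pieces_def)
    then show ?thesis using 2 by simp
  qed
qed

text \<open>The speed doubles while the parameter interval halves, so each half of a concatenation
  contributes its full length.\<close>

lemma has_integral_double:
  fixes f :: "real \<Rightarrow> real"
  assumes f: "(f has_integral l) {0..1}" and u: "2 * u + k = 0" and v: "2 * v + k = 1"
  shows "((\<lambda>t. 2 * f (2 * t + k)) has_integral l) {u..v}"
proof -
  have uv: "(0 - k) /\<^sub>R 2 = u" "(1 - k) /\<^sub>R 2 = v"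
    using u v by (auto simp: real_scaleR_def field_simps)
  have l: "l /\<^sub>R 2 ^ DIM(real) = l / 2" by (simp add: field_simps)
  have "(f has_integral l) (cbox 0 1)" using f by (simp only: box_real)
  from has_integral_affinity'[OF this, of 2 k, OF zero_less_numeral, unfolded uv l, unfolded box_real real_scaleR_def]
  have "((\<lambda>t. f (2 * t + k)) has_integral l / 2) {u..v}" .
  from has_integral_mult_right[OF this, of 2] show ?thesis by (simp only: nonzero_mult_div_cancel_left times_divide_eq_right zero_neq_numeral not_False_eq_True)
qed

lemma reverse_image: "(\<lambda>t. - 1 * t + 1) ` {a..b::real} = {1 - b..1 - a}"
proof -
  have "(\<lambda>t::real. - 1 * t + 1) = (-) 1" by (rule ext) simp
  then show ?thesis by (simp only: image_diff_atLeastAtMost)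
qed

lemma double_image: "(\<lambda>t. 2 * t + k) ` {a..b::real} = {2 * a + k..2 * b + k}"
proof (intro equalityI subsetI)
  fix x assume "x \<in> {2 * a + k..2 * b + k}"
  then have "(x - k) / 2 \<in> {a..b}" "x = 2 * ((x - k) / 2) + k" by (simp_all add: field_simps)
  then show "x \<in> (\<lambda>t. 2 * t + k) ` {a..b}" by (rule rev_image_eqI)
qed (clarsimp)

section \<open>Length under reversal and concatenation\<close>

context riem_mfd
begin

lemma smooth_curve_reparam:
  assumes \<alpha>: "smooth_curve M J \<alpha>" and J: "\<And>t. t \<in> I \<Longrightarrow> m * t + k \<in> J"
    and \<gamma>: "\<And>t. t \<in> I \<Longrightarrow> \<gamma> t = \<alpha> (m * t + k)"
  shows "smooth_curve M I \<gamma>"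
  unfolding smooth_curve_def
proof (intro conjI ballI)
  have "continuous_map (top_of_set I) (top_of_set J) (\<lambda>t. m * t + k)"
    using J by (auto intro!: continuous_intros)
  then have "continuous_map (top_of_set I) (mtop M) (\<alpha> \<circ> (\<lambda>t. m * t + k))"
    by (rule continuous_map_compose) (use \<alpha> in \<open>simp add: smooth_curve_def\<close>)
  then show "continuous_map (top_of_set I) (mtop M) \<gamma>"
    by (rule continuous_map_eq) (simp add: \<gamma>)
next
  fix c assume c: "c \<in> atlas M"
  have "smooth_on {t \<in> J. \<alpha> t \<in> fst c} (snd c \<circ> \<alpha>)" using \<alpha> c by (simp add: smooth_curve_def)
  then have "smooth_on {t \<in> I. \<gamma> t \<in> fst c} (\<lambda>t. (snd c \<circ> \<alpha>) (m * t + k))"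
    by (rule smooth_on_compose) (use J \<gamma> in \<open>auto simp: smooth_on_def Ck_on_affine\<close>)
  then show "smooth_on {t \<in> I. \<gamma> t \<in> fst c} (snd c \<circ> \<gamma>)"
    by (rule smooth_on_cong) (simp add: \<gamma>)
qed

lemma velocity_reparam:
  assumes \<alpha>: "smooth_curve M ((\<lambda>t. m * t + k) ` I) \<alpha>"
    and \<gamma>: "\<And>t. t \<in> I \<Longrightarrow> \<gamma> t = \<alpha> (m * t + k)"
    and nt: "\<And>t. t \<in> I \<Longrightarrow> at t within I \<noteq> bot"
      "\<And>t. t \<in> (\<lambda>t. m * t + k) ` I \<Longrightarrow> at t within (\<lambda>t. m * t + k) ` I \<noteq> bot"
    and t: "t \<in> I"
  shows "velocity M I \<gamma> t = (\<lambda>c. m *\<^sub>R velocity M ((\<lambda>t. m * t + k) ` I) \<alpha> (m * t + k) c)"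
proof
  fix c
  let ?J = "(\<lambda>t. m * t + k) ` I"
  show "velocity M I \<gamma> t c = m *\<^sub>R velocity M ?J \<alpha> (m * t + k) c"
  proof (cases "c \<in> charts_at M (\<gamma> t)")
    case True
    have c: "c \<in> charts_at M (\<alpha> (m * t + k))" using True \<gamma>[OF t] by simp
    have "((\<lambda>s. snd c (\<alpha> s)) has_vector_derivative velocity M ?J \<alpha> (m * t + k) c) (at (m * t + k) within ?J)"
      by (rule velocity_derivative[OF \<alpha> nt(2) _ c]) (use t in auto)
    moreover have "((\<lambda>t. m * t + k) has_vector_derivative m) (at t within I)"
      by (auto intro!: derivative_eq_intros simp: has_real_derivative_iff_has_vector_derivative[symmetric])
    ultimately have "((\<lambda>s. snd c (\<alpha> s)) \<circ> (\<lambda>t. m * t + k) has_vector_derivative m *\<^sub>R velocity M ?J \<alpha> (m * t + k) c) (at t within I)"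
      by (rule vector_diff_chain_within[rotated])
    then have 1: "((snd c \<circ> \<gamma>) has_vector_derivative m *\<^sub>R velocity M ?J \<alpha> (m * t + k) c) (at t within I)"
      unfolding has_vector_derivative_def
      by (rule has_derivative_transform[OF t, rotated]) (simp add: \<gamma>)
    show ?thesis using vector_derivative_within[OF nt(1)[OF t] 1] True by (simp add: velocity_def)
  next
    case False
    then show ?thesis using \<gamma>[OF t] by (simp add: velocity_def)
  qed
qed

lemma metric_scale:
  assumes "q \<in> topspace (mtop M)" "X \<in> tangent_space M q"
  shows "g q (\<lambda>c. r *\<^sub>R X c) (\<lambda>c. r *\<^sub>R X c) = r\<^sup>2 * g q X X"
proof -
  have rX: "(\<lambda>c. r *\<^sub>R X c) \<in> tangent_space M q"
  proof -
    obtain c where c: "c \<in> atlas M" "q \<in> fst c" using atlas_cover[OF assms(1)] by blast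
    then have c: "c \<in> charts_at M q" by (simp add: charts_at_def)
    have "(\<lambda>c'. r *\<^sub>R X c') = cvec c q (r *\<^sub>R X c)"
      using tangent_eq_cvec[OF c assms(2)] cvec_scale[OF c, of r "X c"] by simp
    moreover have "r *\<^sub>R X c \<in> mmodel M"
      using tangent_model[OF c assms(2)] model_subspace by (simp add: subspace_mul)
    ultimately show ?thesis using cvec_tangent[OF c] by simp
  qed
  have "g q (\<lambda>c. r *\<^sub>R X c) (\<lambda>c. r *\<^sub>R X c) = r * g q X (\<lambda>c. r *\<^sub>R X c)"
    by (rule metric_rules(2)[OF assms rX])
  also have "g q X (\<lambda>c. r *\<^sub>R X c) = r * g q X X"
    using metric_rules(1)[OF assms rX] metric_rules(2)[OF assms assms(2)] by simp
  finally show ?thesis by (simp add: power2_eq_square)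
qed

text \<open>\<open>\<alpha>\<close> is assumed smooth on one piece, whereas \<open>spd\<close>
  differentiates within \<open>{0..1}\<close>; at an interior parameter the two velocities agree.
  The square root of \<open>m\<^sup>2\<close> produces the absolute value.\<close>

lemma speed_reparam:
  assumes \<alpha>: "smooth_curve M ((\<lambda>t. m * t + k) ` {a..b}) \<alpha>" and m: "m \<noteq> 0"
    and \<gamma>: "\<And>t. t \<in> {a..b} \<Longrightarrow> \<gamma> t = \<alpha> (m * t + k)"
    and ab: "0 \<le> a" "b \<le> 1" "(\<lambda>t. m * t + k) ` {a..b} \<subseteq> {0..1}" and t: "a < t" "t < b"
  shows "spd \<gamma> t = \<bar>m\<bar> * spd \<alpha> (m * t + k)"
proof -
  let ?J = "(\<lambda>t. m * t + k) ` {a..b}" and ?t = "m * t + k"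
  obtain a' b' where J: "?J = {a'..b'}" "a' < b'" "a' < ?t" "?t < b'"
    using affine_image_Icc[OF m, of a b k] t by auto
  have ab': "0 \<le> a'" "b' \<le> 1" using ab(3) J(1,2) by auto
  have tI: "t \<in> {a..b}" and tJ: "?t \<in> {a'..b'}" using t J by auto
  have ntI: "\<And>t. t \<in> {a..b} \<Longrightarrow> at t within {a..b} \<noteq> bot"
    by (rule at_within_Icc_neq_bot) (use t in simp_all)
  have ntJ: "\<And>t. t \<in> {a'..b'} \<Longrightarrow> at t within {a'..b'} \<noteq> bot"
    by (rule at_within_Icc_neq_bot) (use J in simp_all)
  note \<alpha>' = \<alpha>[unfolded J(1)]
  have v: "velocity M {a..b} \<gamma> t = (\<lambda>c. m *\<^sub>R velocity M {a'..b'} \<alpha> ?t c)"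
  proof -
    have "\<And>t. t \<in> ?J \<Longrightarrow> at t within ?J \<noteq> bot" unfolding J(1) by (rule ntJ)
    from velocity_reparam[OF \<alpha> \<gamma> ntI this tI] show ?thesis unfolding J(1) .
  qed
  have v1: "velocity M {0..1} \<gamma> t = velocity M {a..b} \<gamma> t"
    using velocity_interior[of 0 t 1 M \<gamma>] velocity_interior[OF t, of M \<gamma>] ab t by simp
  have v2: "velocity M {0..1} \<alpha> ?t = velocity M {a'..b'} \<alpha> ?t"
    using velocity_interior[of 0 ?t 1 M \<alpha>] velocity_interior[OF J(3,4), of M \<alpha>] ab' J by simp
  have tan: "velocity M {a'..b'} \<alpha> ?t \<in> tangent_space M (\<alpha> ?t)"
    by (rule velocity_tangent[OF \<alpha>' ntJ tJ])
  have top: "\<alpha> ?t \<in> topspace (mtop M)"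
    using \<alpha>' tJ by (auto simp: smooth_curve_def continuous_map_def)
  show ?thesis
    unfolding speed_def v1 v2 v \<gamma>[OF tI] metric_scale[OF top tan] by (simp add: real_sqrt_mult)
qed

lemma subdivision_reverse:
  assumes "smooth_subdivision M \<alpha> T"
  shows "smooth_subdivision M (\<lambda>t. \<alpha> (1 - t)) ((\<lambda>t. 1 - t) ` T)"
proof -
  note T = smooth_subdivisionD[OF assms]
  have sc: "smooth_curve M {a..b} (\<lambda>t. \<alpha> (1 - t))" if "(a, b) \<in> pieces ((\<lambda>t. 1 - t) ` T)" for a b
    by (rule smooth_curve_reparam[OF T(5)[OF pieces_reverse[OF that]], of _ "-1" 1]) simp_all
  have "0 \<in> (\<lambda>t. 1 - t) ` T" "1 \<in> (\<lambda>t. 1 - t) ` T"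
    using rev_image_eqI[OF T(3), of 0 "\<lambda>t. 1 - t"] rev_image_eqI[OF T(2), of 1 "\<lambda>t. 1 - t"] by simp_all
  moreover have "(\<lambda>t. 1 - t) ` T \<subseteq> {0..1}" using T(4) by auto
  ultimately show ?thesis using sc T(1) by (intro smooth_subdivisionI) simp_all
qed

lemma subdivision_join:
  assumes T: "smooth_subdivision M \<alpha> T" and T': "smooth_subdivision M \<beta> T'" and eq: "\<alpha> 1 = \<beta> 0"
  shows "smooth_subdivision M (join_curves \<alpha> \<beta>) (join_subdivision T T')"
proof -
  note T = smooth_subdivisionD[OF T] and T' = smooth_subdivisionD[OF T']
  have sc: "smooth_curve M {a..b} (join_curves \<alpha> \<beta>)" if "(a, b) \<in> pieces (join_subdivision T T')" for a b
    using pieces_join[OF that T(4,3) T'(4,2)]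
  proof (elim disjE conjE)
    assume b: "b \<le> 1 / 2" and p: "(2 * a, 2 * b) \<in> pieces T"
    show ?thesis
      by (rule smooth_curve_reparam[OF T(5)[OF p], of _ 2 0]) (use b in \<open>simp_all add: join_curves_def\<close>)
  next
    assume a: "1 / 2 \<le> a" and p: "(2 * a - 1, 2 * b - 1) \<in> pieces T'"
    show ?thesis
    proof (rule smooth_curve_reparam[OF T'(5)[OF p], of _ 2 "-1"])
      show "join_curves \<alpha> \<beta> r = \<beta> (2 * r + - 1)" if "r \<in> {a..b}" for r
        using that a eq by (intro join_upper) auto
    qed auto
  qed
  have "0 \<in> join_subdivision T T'" "1 \<in> join_subdivision T T'"
    unfolding join_subdivision_def
    using rev_image_eqI[OF T(2), of 0 "\<lambda>t. t / 2"] rev_image_eqI[OF T'(3), of 1 "\<lambda>t. (t + 1) / 2"]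
    by simp_all
  moreover have "finite (join_subdivision T T')" using T(1) T'(1) by (simp add: join_subdivision_def)
  moreover have "join_subdivision T T' \<subseteq> {0..1}"
  proof -
    have "t / 2 \<in> {0..1}" if "t \<in> T" for t using subsetD[OF T(4) that] by simp
    moreover have "(t + 1) / 2 \<in> {0..1}" if "t \<in> T'" for t using subsetD[OF T'(4) that] by simp
    ultimately show ?thesis unfolding join_subdivision_def by (intro Un_least image_subsetI)
  qed
  ultimately show ?thesis using sc by (intro smooth_subdivisionI) simp_all
qed

lemma curve_length_eqI:
  assumes "smooth_subdivision M \<gamma> T" "(f has_integral l) {0..1}" "finite S"
    "\<And>t. t \<in> {0..1} - S \<Longrightarrow> spd \<gamma> t = f t"
  shows "len \<gamma> = l"
proof -
  have "(spd \<gamma> has_integral l) {0..1}"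
    by (rule has_integral_spike_finite[OF assms(3,4,2)])
  then show ?thesis by (simp add: curve_length_def speed_def[abs_def] integral_unique)
qed

lemma curve_length_reverse:
  assumes "smooth_subdivision M \<alpha> T"
  shows "len (\<lambda>t. \<alpha> (1 - t)) = len \<alpha>"
proof (rule curve_length_eqI[OF subdivision_reverse[OF assms]])
  note T = smooth_subdivisionD[OF assms] and R = smooth_subdivisionD[OF subdivision_reverse[OF assms]]
  show "((\<lambda>t. spd \<alpha> (-1 * t + 1)) has_integral len \<alpha>) {0..1}"
    using has_integral_affinity[of "spd \<alpha>" _ 0 1 "-1" 1] speed_has_integral[OF assms]
      reverse_image[of 0 1] by simp
  show "finite ((\<lambda>t. 1 - t) ` T)" by (rule R(1))
  fix t assume t: "t \<in> {0..1} - (\<lambda>t. 1 - t) ` T"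
  then obtain a b where ab: "(a, b) \<in> pieces ((\<lambda>t. 1 - t) ` T)" "a < t" "t < b"
    using pieces_cover[OF R(1-3), of t] by blast
  note p = pieces_reverse[OF ab(1)]
  have sub: "0 \<le> a" "b \<le> 1" using piecesD[OF p] T(4) by auto
  have "spd (\<lambda>t. \<alpha> (1 - t)) t = \<bar>-1\<bar> * spd \<alpha> (-1 * t + 1)"
    by (rule speed_reparam[of "-1" 1 a b]) (use T(5)[OF p] sub ab in \<open>simp_all only: reverse_image\<close>, auto)
  then show "spd (\<lambda>t. \<alpha> (1 - t)) t = spd \<alpha> (-1 * t + 1)" by simp
qed

lemma curve_length_join:
  assumes sT: "smooth_subdivision M \<alpha> T" and sT': "smooth_subdivision M \<beta> T'" and eq: "\<alpha> 1 = \<beta> 0"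
  shows "len (join_curves \<alpha> \<beta>) = len \<alpha> + len \<beta>"
proof (rule curve_length_eqI[OF subdivision_join[OF assms]])
  \<comment> \<open>The terms \<open>2 * t + 0\<close> and \<open>2 * t + (-1)\<close> keep the
    shape \<open>m * t + k\<close> of the reparametrization lemmas.\<close>
  let ?f = "\<lambda>t. if t \<le> 1 / 2 then 2 * spd \<alpha> (2 * t + 0) else 2 * spd \<beta> (2 * t + (-1))"
  note T = smooth_subdivisionD[OF sT] and T' = smooth_subdivisionD[OF sT']
  note S = smooth_subdivisionD[OF subdivision_join[OF assms]]
  have "((\<lambda>t. 2 * spd \<alpha> (2 * t + 0)) has_integral len \<alpha>) {0..1/2}"
    by (rule has_integral_double[OF speed_has_integral[OF sT]]) simp_all
  then have 1: "(?f has_integral len \<alpha>) {0..1/2}"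
    by (rule has_integral_eq[rotated]) simp
  have "((\<lambda>t. 2 * spd \<beta> (2 * t + (-1))) has_integral len \<beta>) {1/2..1}"
    by (rule has_integral_double[OF speed_has_integral[OF sT']]) simp_all
  \<comment> \<open>At 1/2 the function \<open>?f\<close> takes its value from the first half; a
    single point is harmless.\<close>
  then have 2: "(?f has_integral len \<beta>) {1/2..1}"
    by (rule has_integral_spike_finite[of "{1/2}", rotated 2]) auto
  show "(?f has_integral len \<alpha> + len \<beta>) {0..1}"
    by (rule has_integral_combine[OF _ _ 1 2]) simp_all
  show "finite (join_subdivision T T')" by (rule S(1))
  fix t assume t: "t \<in> {0..1} - join_subdivision T T'"
  then obtain a b where ab: "(a, b) \<in> pieces (join_subdivision T T')" "a < t" "t < b"
    using pieces_cover[OF S(1-3), of t] by blast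
  have sub: "0 \<le> a" "b \<le> 1" using piecesD[OF ab(1)] S(4) by auto
  from pieces_join[OF ab(1) T(4,3) T'(4,2)] show "spd (join_curves \<alpha> \<beta>) t = ?f t"
  proof (elim disjE conjE)
    assume b: "b \<le> 1 / 2" and p: "(2 * a, 2 * b) \<in> pieces T"
    have "spd (join_curves \<alpha> \<beta>) t = \<bar>2\<bar> * spd \<alpha> (2 * t + 0)"
    proof (rule speed_reparam[of 2 0 a b])
      show "smooth_curve M ((\<lambda>t. 2 * t + 0) ` {a..b}) \<alpha>" unfolding double_image using T(5)[OF p] by simp
      show "(\<lambda>t. 2 * t + 0) ` {a..b} \<subseteq> {0..1}" using sub b by auto
    qed (use b sub ab in \<open>auto simp: join_curves_def\<close>)
    then show ?thesis using ab b by simp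
  next
    assume a: "1 / 2 \<le> a" and p: "(2 * a - 1, 2 * b - 1) \<in> pieces T'"
    have "spd (join_curves \<alpha> \<beta>) t = \<bar>2\<bar> * spd \<beta> (2 * t + (-1))"
    proof (rule speed_reparam[of 2 "-1" a b])
      show "smooth_curve M ((\<lambda>t. 2 * t + (-1)) ` {a..b}) \<beta>" unfolding double_image using T'(5)[OF p] by simp
      show "(\<lambda>t. 2 * t + (-1)) ` {a..b} \<subseteq> {0..1}" using sub a by auto
      show "join_curves \<alpha> \<beta> s = \<beta> (2 * s + (-1))" if "s \<in> {a..b}" for s
        using that a eq by (intro join_upper) auto
    qed (use sub ab in auto)
    then show ?thesis using ab a by simp
  qed
qed

lemma subdivision_const:
  assumes "p \<in> topspace (mtop M)" shows "smooth_subdivision M (\<lambda>_. p) {0, 1}"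
  using assms by (auto simp: smooth_subdivision_def smooth_curve_def smooth_on_def Ck_on_const o_def)

lemma velocity_const:
  assumes "at t within I \<noteq> bot" shows "velocity M I (\<lambda>_. p) t = (\<lambda>_. 0)"
proof -
  have "vector_derivative (snd c \<circ> (\<lambda>_. p)) (at t within I) = 0" for c :: "('m, 'v) chart"
    by (rule vector_derivative_within[OF assms]) (simp add: o_def)
  then show ?thesis by (auto simp: velocity_def)
qed

lemma zero_tangent: "(\<lambda>_. 0) \<in> tangent_space M q"
  unfolding tangent_space_iff
  using model_subspace by (auto simp: subspace_0 linear_0[OF jac_linear] charts_at_def)

lemma curve_length_const:
  assumes "p \<in> topspace (mtop M)" shows "len (\<lambda>_. p) = 0"
proof (rule curve_length_eqI[OF subdivision_const[OF assms]])
  show "((\<lambda>_. 0) has_integral (0::real)) {0..1::real}" by simp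
  show "finite ({}::real set)" by simp
  fix t :: real assume "t \<in> {0..1} - {}"
  then have "velocity M {0..1} (\<lambda>_. p) t = (\<lambda>_. 0)"
    by (intro velocity_const at_within_Icc_neq_bot) auto
  \<comment> \<open>The value at the zero vector follows from homogeneity with factor 0.\<close>
  moreover have "g p (\<lambda>_. 0) (\<lambda>_. 0) = 0"
    using metric_scale[OF assms zero_tangent, of 0] by simp
  ultimately show "spd (\<lambda>_. p) t = 0" by (simp add: speed_def)
qed

end

section \<open>Parallel sections under reversal and concatenation\<close>

context bundle_connection
begin

abbreviation par_at :: "real set \<Rightarrow> (real \<Rightarrow> 'm) \<Rightarrow> (real \<Rightarrow> 'e) \<Rightarrow> real \<Rightarrow> bool" where
  "par_at I \<alpha> s t \<equiv> has_covariant_derivative M E nabla I \<alpha> s t (vscale E 0 (s t))"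

text \<open>Parallelism is the linear differential equation \<open>y' = - A y\<close> in every
  trivialization around the point, where \<open>A\<close> is the connection form on the velocity;
  the zero vector of the fibre has coordinate 0.\<close>

lemma par_at_iff:
  assumes s: "s t \<in> fibre E (\<alpha> t)"
  shows "par_at I \<alpha> s t \<longleftrightarrow> (\<forall>U \<Phi>. (U, \<Phi>) \<in> trivs E \<longrightarrow> \<alpha> t \<in> U \<longrightarrow>
    ((\<lambda>r. \<Phi> (s r)) has_vector_derivative - cform \<Phi> (\<alpha> t) (velocity M I \<alpha> t) (\<Phi> (s t))) (at t within I))"
proof -
  obtain U0 \<Phi>0 where t0: "(U0, \<Phi>0) \<in> trivs E" "\<alpha> t \<in> U0" using triv_cover[OF fibre_topspace[OF s]] .
  have z: "\<Phi> (vscale E 0 (s t)) = 0" if "(U, \<Phi>) \<in> trivs E" "\<alpha> t \<in> U" for U \<Phi>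
    using fibre_ops(4)[OF that s, of 0] by simp
  have "vscale E 0 (s t) \<in> fibre E (\<alpha> t)" by (rule fibre_ops(3)[OF t0 s])
  then have "par_at I \<alpha> s t \<longleftrightarrow> (\<forall>U \<Phi>. (U, \<Phi>) \<in> trivs E \<longrightarrow> \<alpha> t \<in> U \<longrightarrow>
    (\<exists>y'. ((\<Phi> \<circ> s) has_vector_derivative y') (at t within I) \<and>
          \<Phi> (vscale E 0 (s t)) = y' + cform \<Phi> (\<alpha> t) (velocity M I \<alpha> t) (\<Phi> (s t))))"
    unfolding has_covariant_derivative_def by (auto simp: cform_def)
  also have "\<dots> \<longleftrightarrow> (\<forall>U \<Phi>. (U, \<Phi>) \<in> trivs E \<longrightarrow> \<alpha> t \<in> U \<longrightarrow>
    (\<exists>y'. ((\<Phi> \<circ> s) has_vector_derivative y') (at t within I) \<and>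
          y' = - cform \<Phi> (\<alpha> t) (velocity M I \<alpha> t) (\<Phi> (s t))))"
    by (intro all_cong1 imp_cong refl) (simp add: z eq_neg_iff_add_eq_0 eq_commute[of 0])
  finally show ?thesis by (simp add: o_def)
qed

text \<open>The connection form is homogeneous in the tangent vector, so the factor \<open>m\<close>
  of the velocity matches the factor that the chain rule puts in front of the derivative of the
  section.\<close>

lemma par_at_reparam:
  assumes \<alpha>: "smooth_curve M ((\<lambda>t. m * t + k) ` {a..b}) \<alpha>" and m: "m \<noteq> 0" and ab: "a < b"
    and \<gamma>: "\<And>t. t \<in> {a..b} \<Longrightarrow> \<gamma> t = \<alpha> (m * t + k)" and \<sigma>: "\<And>t. t \<in> {a..b} \<Longrightarrow> \<sigma> t = s (m * t + k)"
    and t: "t \<in> {a..b}" and s: "s (m * t + k) \<in> fibre E (\<alpha> (m * t + k))"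
    and par: "par_at ((\<lambda>t. m * t + k) ` {a..b}) \<alpha> s (m * t + k)"
  shows "par_at {a..b} \<gamma> \<sigma> t"
proof -
  let ?J = "(\<lambda>t. m * t + k) ` {a..b}" and ?t = "m * t + k"
  obtain a' b' where J: "?J = {a'..b'}" "a' < b'" using affine_image_Icc[OF m ab, of k] by blast
  have ntI: "\<And>t. t \<in> {a..b} \<Longrightarrow> at t within {a..b} \<noteq> bot"
    by (rule at_within_Icc_neq_bot[OF ab])
  have ntJ: "\<And>t. t \<in> ?J \<Longrightarrow> at t within ?J \<noteq> bot"
    unfolding J(1) by (rule at_within_Icc_neq_bot[OF J(2)])
  have tJ: "?t \<in> ?J" using t by blast
  have v: "velocity M {a..b} \<gamma> t = (\<lambda>c. m *\<^sub>R velocity M ?J \<alpha> ?t c)"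
    by (rule velocity_reparam[OF \<alpha> \<gamma> ntI ntJ t])
  have tan: "velocity M ?J \<alpha> ?t \<in> tangent_space M (\<alpha> ?t)" by (rule velocity_tangent[OF \<alpha> ntJ tJ])
  have s': "\<sigma> t \<in> fibre E (\<gamma> t)" using s \<sigma>[OF t] \<gamma>[OF t] by simp
  show ?thesis
    unfolding par_at_iff[of \<sigma> t \<gamma>, OF s']
  proof (intro allI impI)
    fix U \<Phi> assume tr: "(U, \<Phi>) \<in> trivs E" and "\<gamma> t \<in> U"
    then have U: "\<alpha> ?t \<in> U" using \<gamma>[OF t] by simp
    have "((\<lambda>r. \<Phi> (s r)) has_vector_derivative - cform \<Phi> (\<alpha> ?t) (velocity M ?J \<alpha> ?t) (\<Phi> (s ?t))) (at ?t within ?J)"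
      using par[unfolded par_at_iff[of s ?t \<alpha>, OF s]] tr U by blast
    moreover have "((\<lambda>t. m * t + k) has_vector_derivative m) (at t within {a..b})"
      by (auto intro!: derivative_eq_intros simp: has_real_derivative_iff_has_vector_derivative[symmetric])
    ultimately have "((\<lambda>r. \<Phi> (s r)) \<circ> (\<lambda>t. m * t + k) has_vector_derivative
        m *\<^sub>R (- cform \<Phi> (\<alpha> ?t) (velocity M ?J \<alpha> ?t) (\<Phi> (s ?t)))) (at t within {a..b})"
      by (rule vector_diff_chain_within[rotated])
    then have "((\<lambda>r. \<Phi> (\<sigma> r)) has_vector_derivative
        m *\<^sub>R (- cform \<Phi> (\<alpha> ?t) (velocity M ?J \<alpha> ?t) (\<Phi> (s ?t)))) (at t within {a..b})"
      unfolding has_vector_derivative_def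
      by (rule has_derivative_transform[OF t, rotated]) (simp add: \<sigma>)
    moreover have "m *\<^sub>R (- cform \<Phi> (\<alpha> ?t) (velocity M ?J \<alpha> ?t) (\<Phi> (s ?t))) =
        - cform \<Phi> (\<gamma> t) (velocity M {a..b} \<gamma> t) (\<Phi> (\<sigma> t))"
      unfolding v \<gamma>[OF t] \<sigma>[OF t] cform_scale_left[OF tr U tan triv_mem[OF tr U s]] by simp
    ultimately show "((\<lambda>r. \<Phi> (\<sigma> r)) has_vector_derivative
        - cform \<Phi> (\<gamma> t) (velocity M {a..b} \<gamma> t) (\<Phi> (\<sigma> t))) (at t within {a..b})" by simp
  qed
qed

lemma parallel_alongD:
  assumes "parallel \<alpha> s"
  shows "\<exists>T. (\<forall>t. t \<in> {0..1} \<longrightarrow> s t \<in> fibre E (\<alpha> t)) \<and> smooth_subdivision M \<alpha> T \<and>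
    (\<forall>a b t. (a, b) \<in> pieces T \<longrightarrow> t \<in> {a..b} \<longrightarrow> par_at {a..b} \<alpha> s t)"
proof -
  obtain T where s: "\<forall>t\<in>{0..1}. s t \<in> fibre E (\<alpha> t)" and T: "smooth_subdivision M \<alpha> T"
    and p: "\<forall>(a, b)\<in>pieces T. \<forall>t\<in>{a..b}. par_at {a..b} \<alpha> s t"
    using assms unfolding parallel_along_def by (elim exE conjE)
  have "par_at {a..b} \<alpha> s t" if "(a, b) \<in> pieces T" "t \<in> {a..b}" for a b t
    using bspec[OF p that(1), unfolded prod.case] that(2) by (rule bspec)
  then show ?thesis using s T by (intro exI[of _ T]) simp
qed

lemma parallel_alongI:
  assumes "\<And>t. t \<in> {0..1} \<Longrightarrow> s t \<in> fibre E (\<alpha> t)" "smooth_subdivision M \<alpha> T"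
    "\<And>a b t. (a, b) \<in> pieces T \<Longrightarrow> t \<in> {a..b} \<Longrightarrow> par_at {a..b} \<alpha> s t"
  shows "parallel \<alpha> s"
  unfolding parallel_along_def using assms(1)
  by (intro conjI exI[of _ T] assms(2) ballI) (use assms(3) in auto)

lemma parallel_reverse:
  assumes "parallel \<alpha> s"
  shows "parallel (\<lambda>t. \<alpha> (1 - t)) (\<lambda>t. s (1 - t))"
proof -
  obtain T where T0: "\<forall>t. t \<in> {0..1} \<longrightarrow> s t \<in> fibre E (\<alpha> t)" "smooth_subdivision M \<alpha> T"
    "\<forall>a b t. (a, b) \<in> pieces T \<longrightarrow> t \<in> {a..b} \<longrightarrow> par_at {a..b} \<alpha> s t"
    using parallel_alongD[OF assms] by (elim exE conjE)
  note T = T0[rule_format]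
  note D = smooth_subdivisionD[OF T(2)]
  show ?thesis
  proof (rule parallel_alongI[OF _ subdivision_reverse[OF T(2)]])
    show "s (1 - t) \<in> fibre E (\<alpha> (1 - t))" if "t \<in> {0..1}" for t using T(1) that by simp
    fix a b t assume ab: "(a, b) \<in> pieces ((\<lambda>t. 1 - t) ` T)" and t: "t \<in> {a..b}"
    note p = pieces_reverse[OF ab]
    show "par_at {a..b} (\<lambda>t. \<alpha> (1 - t)) (\<lambda>t. s (1 - t)) t"
    proof (rule par_at_reparam[of "-1" 1 a b \<alpha> _ _ s])
      show "smooth_curve M ((\<lambda>t. - 1 * t + 1) ` {a..b}) \<alpha>" unfolding reverse_image by (rule D(5)[OF p])
      show "par_at ((\<lambda>t. - 1 * t + 1) ` {a..b}) \<alpha> s (- 1 * t + 1)"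
        unfolding reverse_image by (rule T(3)[OF p]) (use t in auto)
      show "a < b" by (rule piecesD(3)[OF ab])
      show "s (- 1 * t + 1) \<in> fibre E (\<alpha> (- 1 * t + 1))"
        by (rule T(1)) (use t piecesD(1,2)[OF p] D(4) in auto)
    qed (use t in auto)
  qed
qed

text \<open>Equal values at the junction let \<open>join_upper\<close> describe the joined section
  on the closed upper half, including 1/2.\<close>

lemma parallel_join:
  assumes "parallel \<alpha> s" "parallel \<beta> s'"
    and eq: "\<alpha> 1 = \<beta> 0" "s 1 = s' 0"
  shows "parallel (join_curves \<alpha> \<beta>) (join_curves s s')"
proof -
  obtain T where T0: "\<forall>t. t \<in> {0..1} \<longrightarrow> s t \<in> fibre E (\<alpha> t)" "smooth_subdivision M \<alpha> T"
    "\<forall>a b t. (a, b) \<in> pieces T \<longrightarrow> t \<in> {a..b} \<longrightarrow> par_at {a..b} \<alpha> s t"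
    using parallel_alongD[OF assms(1)] by (elim exE conjE)
  note T = T0[rule_format]
  obtain T' where T'0: "\<forall>t. t \<in> {0..1} \<longrightarrow> s' t \<in> fibre E (\<beta> t)" "smooth_subdivision M \<beta> T'"
    "\<forall>a b t. (a, b) \<in> pieces T' \<longrightarrow> t \<in> {a..b} \<longrightarrow> par_at {a..b} \<beta> s' t"
    using parallel_alongD[OF assms(2)] by (elim exE conjE)
  note T' = T'0[rule_format]
  note D = smooth_subdivisionD[OF T(2)] and D' = smooth_subdivisionD[OF T'(2)]
  show ?thesis
  proof (rule parallel_alongI[OF _ subdivision_join[OF T(2) T'(2) eq(1)]])
    show "join_curves s s' t \<in> fibre E (join_curves \<alpha> \<beta> t)" if "t \<in> {0..1}" for t
      using T(1)[of "2 * t"] T'(1)[of "2 * t - 1"] that by (auto simp: join_curves_def)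
    fix a b t assume ab: "(a, b) \<in> pieces (join_subdivision T T')" and t: "t \<in> {a..b}"
    note lt = piecesD(3)[OF ab]
    from pieces_join[OF ab D(4,3) D'(4,2)] show "par_at {a..b} (join_curves \<alpha> \<beta>) (join_curves s s') t"
    proof (elim disjE conjE)
      assume b: "b \<le> 1 / 2" and p: "(2 * a, 2 * b) \<in> pieces T"
      show ?thesis
      proof (rule par_at_reparam[of 2 0 a b \<alpha> _ _ s])
        show "smooth_curve M ((\<lambda>t. 2 * t + 0) ` {a..b}) \<alpha>"
          unfolding double_image using D(5)[OF p] by simp
        show "par_at ((\<lambda>t. 2 * t + 0) ` {a..b}) \<alpha> s (2 * t + 0)"
          unfolding double_image using T(3)[OF p, of "2 * t"] t by simp
        show "s (2 * t + 0) \<in> fibre E (\<alpha> (2 * t + 0))"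
          by (rule T(1)) (use t piecesD(1,2)[OF p] D(4) in auto)
      qed (use t lt b in \<open>auto simp: join_curves_def\<close>)
    next
      assume a: "1 / 2 \<le> a" and p: "(2 * a - 1, 2 * b - 1) \<in> pieces T'"
      show ?thesis
      proof (rule par_at_reparam[of 2 "-1" a b \<beta> _ _ s'])
        show "smooth_curve M ((\<lambda>t. 2 * t + - 1) ` {a..b}) \<beta>"
          unfolding double_image using D'(5)[OF p] by simp
        show "par_at ((\<lambda>t. 2 * t + - 1) ` {a..b}) \<beta> s' (2 * t + - 1)"
          unfolding double_image using T'(3)[OF p, of "2 * t - 1"] t by simp
        show "s' (2 * t + - 1) \<in> fibre E (\<beta> (2 * t + - 1))"
          by (rule T'(1)) (use t piecesD(1,2)[OF p] D'(4) in auto)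
        show "join_curves \<alpha> \<beta> r = \<beta> (2 * r + - 1)" if "r \<in> {a..b}" for r
          using that a eq by (intro join_upper) auto
        show "join_curves s s' r = s' (2 * r + - 1)" if "r \<in> {a..b}" for r
          using that a eq by (intro join_upper) auto
      qed (use t lt in auto)
    qed
  qed
qed

lemma parallel_const:
  assumes e: "e \<in> fibre E p"
  shows "parallel (\<lambda>_. p) (\<lambda>_. e)"
proof (rule parallel_alongI[OF e subdivision_const[OF fibre_topspace[OF e]]])
  fix a b t :: real assume p: "(a, b) \<in> pieces {0, 1}" and t: "t \<in> {a..b}"
  have v: "velocity M {a..b} (\<lambda>_. p) t = (\<lambda>_. 0)"
    by (rule velocity_const[OF at_within_Icc_neq_bot[OF piecesD(3)[OF p] t]])
  show "par_at {a..b} (\<lambda>_. p) (\<lambda>_. e) t"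
    unfolding par_at_iff[of "\<lambda>_. e" t "\<lambda>_. p", OF e] v
  proof (intro allI impI)
    fix U \<Phi> assume tr: "(U, \<Phi>) \<in> trivs E" "p \<in> U"
    have "cform \<Phi> p (\<lambda>_. 0) (\<Phi> e) = 0"
      using cform_scale_left[OF tr zero_tangent triv_mem[OF tr e], of 0] by simp
    then show "((\<lambda>r. \<Phi> e) has_vector_derivative - cform \<Phi> p (\<lambda>_. 0) (\<Phi> e)) (at t within {a..b})"
      by simp
  qed
qed

end

section \<open>Holonomy of short loops\<close>

text \<open>The fundamental theorem of calculus tolerates finitely many exceptional points. The
  integral of \<open>\<sigma>\<close> over all of \<open>{0..1}\<close> bounds the displacement up
  to every \<open>u\<close> because \<open>\<sigma>\<close> is nonnegative.\<close>

lemma norm_diff_le_integral: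
  fixes f :: "real \<Rightarrow> 'a::euclidean_space" and \<sigma> :: "real \<Rightarrow> real"
  assumes T: "finite T" and u: "u \<in> {0..1}" and f: "continuous_on {0..u} f"
    and d: "\<And>t. t \<in> {0<..<u} - T \<Longrightarrow> (f has_vector_derivative f' t) (at t)"
    and b: "\<And>t. t \<in> {0<..<u} - T \<Longrightarrow> norm (f' t) \<le> B * \<sigma> t"
    and \<sigma>: "\<And>t. t \<in> {0..1} \<Longrightarrow> 0 \<le> \<sigma> t" "(\<sigma> has_integral l) {0..1}" and B: "B \<ge> 0"
  shows "norm (f u - f 0) \<le> B * l"
proof -
  \<comment> \<open>Zero at the ends and at the exceptional points, where \<open>f'\<close> is
    uncontrolled, so that the pointwise bound holds on all of \<open>{0..u}\<close>.\<close>
  define k where "k = (\<lambda>t. if t \<in> {0<..<u} - T then f' t else 0)"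
  have k: "(k has_integral (f u - f 0)) {0..u}"
  proof (rule fundamental_theorem_of_calculus_interior_strong[OF T])
    show "(f has_vector_derivative k t) (at t)" if "t \<in> {0<..<u} - T" for t
      using d[OF that] that by (simp add: k_def)
  qed (use u f in auto)
  have i: "\<sigma> integrable_on {0..1}" using \<sigma>(2) by blast
  then have iu: "\<sigma> integrable_on {0..u}"
    by (rule integrable_on_subinterval) (use u in auto)
  have "norm (integral {0..u} k) \<le> integral {0..u} (\<lambda>t. B * \<sigma> t)"
  proof (rule integral_norm_bound_integral)
    show "k integrable_on {0..u}" using k by blast
    show "(\<lambda>t. B * \<sigma> t) integrable_on {0..u}" by (rule integrable_on_mult_right[OF iu])
    show "norm (k t) \<le> B * \<sigma> t" if "t \<in> {0..u}" for t
    proof (cases "t \<in> {0<..<u} - T")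
      case True
      then show ?thesis using b[OF True] by (simp add: k_def)
    next
      case False
      have "0 \<le> \<sigma> t" by (rule \<sigma>(1)) (use that u in auto)
      then have "0 \<le> B * \<sigma> t" using B by simp
      then show ?thesis unfolding k_def if_not_P[OF False] by simp
    qed
  qed
  also have "\<dots> = B * integral {0..u} \<sigma>" by simp
  also have "\<dots> \<le> B * integral {0..1} \<sigma>"
    by (intro mult_left_mono[OF _ B] integral_subset_le iu i) (use u \<sigma>(1) in auto)
  finally show ?thesis using integral_unique[OF k] integral_unique[OF \<sigma>(2)] by simp
qed

section \<open>Short curves remain in a coordinate ball\<close>

context riem_mfd
begin

text \<open>
  At the first exit time from the open ball, the curve has covered a coordinate distance smaller than
  the radius, a contradiction.
\<close>

lemma short_curve_stays:
  assumes c: "c \<in> charts_at M p"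
    and r: "r > 0" "cball (snd c p) r \<inter> mmodel M \<subseteq> snd c ` fst c"
    and C: "C > 0" "\<And>x v. x \<in> cball (snd c p) r \<inter> mmodel M \<Longrightarrow> v \<in> mmodel M \<Longrightarrow>
      norm v \<le> C * sqrt (gform c x v v)"
    and sub: "smooth_subdivision M \<alpha> T" and \<alpha>0: "\<alpha> 0 = p" and short: "C * len \<alpha> < r"
    and t: "t \<in> {0..1}"
  shows "\<alpha> t \<in> fst c \<and> snd c (\<alpha> t) \<in> cball (snd c p) r"
proof -
  have ca: "c \<in> atlas M" "p \<in> fst c" using charts_atD[OF c] by auto
  let ?x = "snd c p"
  \<comment> \<open>The exit is measured from the open set \<open>N\<close>; the closed set
    \<open>K\<close> still contains the curve at the first exit time.\<close>
  define K where "K = chart_inv c ` (cball ?x r \<inter> mmodel M)"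
  define N where "N = chart_inv c ` (ball ?x r \<inter> mmodel M)"
  have cont: "continuous_map (top_of_set {0..1}) (mtop M) \<alpha>"
    by (rule smooth_subdivision_continuous[OF sub])
  have image_iff: "q \<in> chart_inv c ` (A \<inter> mmodel M) \<longleftrightarrow> q \<in> fst c \<and> snd c q \<in> A"
    if A: "A \<subseteq> cball ?x r" for q A
  proof
    assume "q \<in> chart_inv c ` (A \<inter> mmodel M)"
    then obtain x where x: "x \<in> A \<inter> mmodel M" "q = chart_inv c x" by (rule imageE)
    have "x \<in> snd c ` fst c" by (rule subsetD[OF r(2)]) (use A x(1) in blast)
    then show "q \<in> fst c \<and> snd c q \<in> A"
      unfolding x(2) using x(1) chart_inv_mem[of x] by simp
  next
    assume q: "q \<in> fst c \<and> snd c q \<in> A"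
    then have "snd c q \<in> A \<inter> mmodel M" using chart_image_subset[OF ca(1)] by (simp add: image_subset_iff)
    then show "q \<in> chart_inv c ` (A \<inter> mmodel M)" by (rule rev_image_eqI) (use ca q in simp)
  qed
  have K_iff: "q \<in> K \<longleftrightarrow> q \<in> fst c \<and> snd c q \<in> cball ?x r" for q
    unfolding K_def by (rule image_iff) simp
  have N_iff: "q \<in> N \<longleftrightarrow> q \<in> fst c \<and> snd c q \<in> ball ?x r" for q
    unfolding N_def by (rule image_iff) (rule ball_subset_cball)
  have N_sub: "N \<subseteq> K" unfolding N_def K_def by (intro image_mono Int_mono) auto
  have N_open: "openin (mtop M) N"
  proof -
    have "openin (subtopology (mtop M) (fst c)) {q \<in> topspace (subtopology (mtop M) (fst c)). snd c q \<in> ball ?x r}"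
      by (rule openin_continuous_map_preimage[OF chart_continuous[OF ca(1)]]) simp
    moreover have "{q \<in> topspace (subtopology (mtop M) (fst c)). snd c q \<in> ball ?x r} = N"
      using chart_domain[OF ca(1)] unfolding set_eq_iff N_iff by auto
    ultimately have "openin (subtopology (mtop M) (fst c)) N" by simp
    then show ?thesis using chart_open[OF ca(1)] by (rule openin_trans_full)
  qed
  \<comment> \<open>Closedness in all of \<open>M\<close> prevents the curve from leaving the chart
    domain in the limit.\<close>
  have K_closed: "closedin (mtop M) K"
  proof (rule compactin_imp_closedin[OF Hausdorff_M])
    have "compact (cball ?x r \<inter> mmodel M)"
      by (intro compact_Int_closed closed_subspace model_subspace) simp
    then have "compactin (top_of_set (snd c ` fst c)) (cball ?x r \<inter> mmodel M)"
      using r(2) by (simp add: compactin_subtopology)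
    then show "compactin (mtop M) K"
      unfolding K_def by (rule image_compactin[OF _ chart_inv_continuous[OF ca(1)]])
  qed
  define \<sigma> where "\<sigma> = (\<lambda>t. if t \<in> T then 0 else spd \<alpha> t)"
  \<comment> \<open>As long as the curve is in \<open>K\<close> the metric bound applies, so the
    coordinate displacement is at most \<open>C * len \<alpha>\<close>, strictly below the
    radius.\<close>
  have step: "\<alpha> u \<in> N" if u: "u \<in> {0..1}" and uK: "\<And>t. t \<in> {0..u} \<Longrightarrow> \<alpha> t \<in> K" for u
  proof -
    have "norm (snd c (\<alpha> u) - snd c (\<alpha> 0)) \<le> C * len \<alpha>"
    proof (rule norm_diff_le_integral[of T u "\<lambda>t. snd c (\<alpha> t)" "\<lambda>t. velocity M {0..1} \<alpha> t c" C \<sigma>])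
      show "finite T" by (rule smooth_subdivisionD(1)[OF sub])
      have "continuous_map (top_of_set {0..u}) (mtop M) \<alpha>"
        by (rule continuous_map_from_subtopology_mono[OF cont]) (use u in auto)
      then have "continuous_map (top_of_set {0..u}) (subtopology (mtop M) (fst c)) \<alpha>"
        using uK K_iff by (auto simp: continuous_map_in_subtopology)
      from continuous_map_compose[OF this chart_continuous[OF ca(1)]]
      show "continuous_on {0..u} (\<lambda>t. snd c (\<alpha> t))" by (simp add: o_def)
      show "0 \<le> \<sigma> t" if "t \<in> {0..1}" for t unfolding \<sigma>_def by (rule speed_nonneg[OF sub that])
      show "(\<sigma> has_integral len \<alpha>) {0..1}"
        unfolding \<sigma>_def by (rule curve_length_has_integral[OF sub])
      fix t assume t: "t \<in> {0<..<u} - T"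
      then have t': "t \<in> {0..1}" "t \<notin> T" and tu: "t \<in> {0..u}" using u by auto
      have q: "\<alpha> t \<in> fst c" "snd c (\<alpha> t) \<in> cball ?x r" using uK[OF tu] K_iff by auto
      have cq: "c \<in> charts_at M (\<alpha> t)" using ca(1) q(1) by (simp add: charts_at_def)
      note sv = subdivision_velocity[OF sub t']
      show "((\<lambda>t. snd c (\<alpha> t)) has_vector_derivative velocity M {0..1} \<alpha> t c) (at t)"
        by (rule sv(2)[OF cq])
      have "norm (velocity M {0..1} \<alpha> t c) \<le>
          C * sqrt (gform c (snd c (\<alpha> t)) (velocity M {0..1} \<alpha> t c) (velocity M {0..1} \<alpha> t c))"
        by (rule C(2)) (use q chart_image_subset[OF ca(1)] tangent_model[OF cq sv(1)] in \<open>simp_all add: image_subset_iff\<close>)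
      then show "norm (velocity M {0..1} \<alpha> t c) \<le> C * \<sigma> t"
        using t'(2) metric_eq_gform[OF ca(1) q(1) sv(1)] by (simp add: \<sigma>_def speed_def)
    qed (use u C in auto)
    then have "dist ?x (snd c (\<alpha> u)) < r" using short \<alpha>0 by (simp add: dist_norm norm_minus_commute)
    moreover have "\<alpha> u \<in> fst c" using uK[of u] K_iff u by auto
    ultimately show ?thesis using N_iff by simp
  qed
  have all_N: "\<alpha> t \<in> N" if "t \<in> {0..1}" for t
  proof (rule ccontr)
    \<comment> \<open>The times spent outside \<open>N\<close> form a compact set, so a failure has
      an earliest instance.\<close>
    define B where "B = {t \<in> {0..1}. \<alpha> t \<in> topspace (mtop M) - N}"
    assume "\<alpha> t \<notin> N"
    moreover have "\<alpha> t \<in> topspace (mtop M)" using cont that by (auto simp: continuous_map_def)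
    ultimately have ne: "B \<noteq> {}" using that by (auto simp: B_def)
    have "closedin (top_of_set {0..1}) {t \<in> topspace (top_of_set {0..1}). \<alpha> t \<in> topspace (mtop M) - N}"
      by (rule closedin_continuous_map_preimage[OF cont]) (use N_open in blast)
    then have "closed B" by (simp add: B_def closedin_closed_eq)
    moreover have "bounded B" by (rule bounded_subset[of "{0..1}"]) (auto simp: B_def)
    ultimately have "compact B" by (simp add: compact_eq_bounded_closed)
    then obtain t0 where t0: "t0 \<in> B" "\<forall>t\<in>B. t0 \<le> t"
      using compact_attains_inf[OF _ ne] by (elim meta_impE bexE) simp_all
    have t01: "t0 \<in> {0..1}" "\<alpha> t0 \<notin> N" using t0(1) by (auto simp: B_def)
    have before: "\<alpha> t \<in> N" if "0 \<le> t" "t < t0" for t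
    proof (rule ccontr)
      assume "\<alpha> t \<notin> N"
      moreover have "t \<in> {0..1}" using that t01 by simp
      moreover from this have "\<alpha> t \<in> topspace (mtop M)" using cont by (auto simp: continuous_map_def)
      ultimately have "t \<in> B" by (simp add: B_def)
      then show False using t0(2) that(2) by (simp add: linorder_not_le[symmetric])
    qed
    have "p \<in> N" using N_iff ca r by simp
    then have pos: "t0 > 0" using t01 \<alpha>0 by (cases "t0 = 0") auto
    have "closedin (top_of_set {0..1}) {t \<in> topspace (top_of_set {0..1}). \<alpha> t \<in> K}"
      by (rule closedin_continuous_map_preimage[OF cont K_closed])
    then have "closed {t \<in> {0..1}. \<alpha> t \<in> K}" by (simp add: closedin_closed_eq)
    moreover have "{0..<t0} \<subseteq> {t \<in> {0..1}. \<alpha> t \<in> K}"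
      using t01(1) by (auto intro: subsetD[OF N_sub before])
    \<comment> \<open>Before \<open>t0\<close> the curve is in \<open>N\<close>, hence in
      \<open>K\<close>; closedness of the preimage adds \<open>t0\<close> itself.\<close>
    ultimately have "closure {0..<t0} \<subseteq> {t \<in> {0..1}. \<alpha> t \<in> K}" by (rule closure_minimal[rotated])
    moreover have "t0 \<in> closure {0..<t0}" using pos by simp
    ultimately have "\<alpha> t0 \<in> K" by blast
    have "\<alpha> t \<in> K" if "t \<in> {0..t0}" for t
    proof (cases "t = t0")
      case False
      then show ?thesis using that by (intro subsetD[OF N_sub] before) auto
    qed (use \<open>\<alpha> t0 \<in> K\<close> in simp)
    then have "\<alpha> t0 \<in> N" by (rule step[OF t01(1)])
    then show False using t01(2) by (rule notE[rotated])
  qed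
  show ?thesis unfolding K_iff[symmetric] by (rule subsetD[OF N_sub all_N[OF t]])
qed

end

section \<open>Parallel sections along short curves\<close>

context bundle_connection
begin

lemma parallel_derivative:
  assumes tr: "(U, \<Phi>) \<in> trivs E" and sub: "smooth_subdivision M \<alpha> T"
    and s: "\<And>t. t \<in> {0..1} \<Longrightarrow> s t \<in> fibre E (\<alpha> t)"
    and par: "\<And>a b t. (a, b) \<in> pieces T \<Longrightarrow> t \<in> {a..b} \<Longrightarrow> par_at {a..b} \<alpha> s t"
    and t: "t \<in> {0..1}" "t \<notin> T" "\<alpha> t \<in> U"
  shows "((\<lambda>t. \<Phi> (s t)) has_vector_derivative - cform \<Phi> (\<alpha> t) (velocity M {0..1} \<alpha> t) (\<Phi> (s t))) (at t)"
proof -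
  note T = smooth_subdivisionD[OF sub]
  obtain a b where ab: "(a, b) \<in> pieces T" "a < t" "t < b" using pieces_cover[OF T(1-3) t(1,2)] .
  have t01: "0 < t" "t < 1" using t T(2,3) by (cases "t = 0"; cases "t = 1"; simp)+
  have "par_at {a..b} \<alpha> s t" by (rule par[OF ab(1)]) (use ab in simp)
  then have "((\<lambda>t. \<Phi> (s t)) has_vector_derivative - cform \<Phi> (\<alpha> t) (velocity M {a..b} \<alpha> t) (\<Phi> (s t)))
      (at t within {a..b})"
    unfolding par_at_iff[of s t \<alpha>, OF s[OF t(1)]] using tr t(3) by blast
  then show ?thesis
    by (simp add: velocity_interior[OF t01] velocity_interior[OF ab(2,3)] at_within_Icc_interior[OF ab(2,3)])
qed

text \<open>At a break point the one-sided derivatives of the adjacent pieces give continuity from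
  both sides. The maximum taken in the estimate below rests on this.\<close>

lemma parallel_continuous:
  assumes tr: "(U, \<Phi>) \<in> trivs E" and sub: "smooth_subdivision M \<alpha> T"
    and s: "\<And>t. t \<in> {0..1} \<Longrightarrow> s t \<in> fibre E (\<alpha> t)"
    and par: "\<And>a b t. (a, b) \<in> pieces T \<Longrightarrow> t \<in> {a..b} \<Longrightarrow> par_at {a..b} \<alpha> s t"
    and U: "\<And>t. t \<in> {0..1} \<Longrightarrow> \<alpha> t \<in> U"
  shows "continuous_on {0..1} (\<lambda>t. \<Phi> (s t))"
proof -
  note T = smooth_subdivisionD[OF sub]
  show ?thesis
  proof (rule pieces_induct[OF T(1,4,3), of "\<lambda>t. continuous_on {0..t} (\<lambda>t. \<Phi> (s t))"])
    show "continuous_on {0..0} (\<lambda>t. \<Phi> (s t))" by simp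
    fix a b assume p: "(a, b) \<in> pieces T" and IH: "continuous_on {0..a} (\<lambda>t. \<Phi> (s t))"
    have ab: "a < b" "a \<in> {0..1}" "b \<in> {0..1}" using piecesD[OF p] T(4) by auto
    have "continuous_on {a..b} (\<lambda>t. \<Phi> (s t))"
      unfolding continuous_on_eq_continuous_within
    proof
      fix t assume t: "t \<in> {a..b}"
      then have t': "t \<in> {0..1}" using ab by auto
      have "((\<lambda>t. \<Phi> (s t)) has_vector_derivative - cform \<Phi> (\<alpha> t) (velocity M {a..b} \<alpha> t) (\<Phi> (s t)))
          (at t within {a..b})"
        using par[OF p t] tr U[OF t'] unfolding par_at_iff[of s t \<alpha>, OF s[OF t']] by blast
      then show "continuous (at t within {a..b}) (\<lambda>t. \<Phi> (s t))"
        by (rule has_vector_derivative_continuous)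
    qed
    then have "continuous_on ({0..a} \<union> {a..b}) (\<lambda>t. \<Phi> (s t))"
      by (intro continuous_on_closed_Un IH) auto
    moreover have "{0..a} \<union> {a..b} = {0..b}" using ab by auto
    ultimately show "continuous_on {0..b} (\<lambda>t. \<Phi> (s t))" by simp
  qed (rule T(2))
qed

text \<open>
  The maximum \<open>m\<close> of the norm of the section satisfies \<open>m \<le> \<bar>y 0\<bar> + m / 2\<close> for short loops; this replaces
  Gronwall's inequality.
\<close>

lemma short_loop_holonomy:
  assumes p: "p \<in> topspace (mtop M)" and tr: "(U, \<Phi>) \<in> trivs E" and pU: "p \<in> U" and \<rho>: "\<rho> > 0"
  shows "\<exists>\<epsilon>>0. \<forall>\<alpha> s. parallel \<alpha> s \<longrightarrow> \<alpha> 0 = p \<longrightarrow> len \<alpha> < \<epsilon> \<longrightarrow>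
    norm (\<Phi> (s 1) - \<Phi> (s 0)) \<le> \<rho> * norm (\<Phi> (s 0))"
proof -
  obtain c where ca: "c \<in> atlas M" "p \<in> fst c" using atlas_cover[OF p] by blast
  have c: "c \<in> charts_at M p" using ca by (simp add: charts_at_def)
  let ?x = "snd c p"
  have "openin (top_of_set (mmodel M)) (snd c ` (U \<inter> fst c))"
    by (rule chart_image_open[OF ca(1) triv_conditions(1)[OF tr]])
  moreover have "?x \<in> snd c ` (U \<inter> fst c)" using pU ca(2) by blast
  ultimately obtain r where r: "r > 0" "cball ?x r \<inter> mmodel M \<subseteq> snd c ` (U \<inter> fst c)"
    unfolding openin_contains_cball by blast
  let ?K = "cball ?x r \<inter> mmodel M"
  have K: "compact ?K" by (intro compact_Int_closed closed_subspace model_subspace) simp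
  have Kc: "?K \<subseteq> snd c ` fst c" using r(2) by blast
  obtain C where C: "C > 0" "\<And>x v. x \<in> ?K \<Longrightarrow> v \<in> mmodel M \<Longrightarrow> norm v \<le> C * sqrt (gform c x v v)"
    using gform_lower_bound[OF ca(1) K Kc] by metis
  obtain D where D: "D \<ge> 0" "\<And>q X v. q \<in> U \<inter> fst c \<Longrightarrow> snd c q \<in> ?K \<Longrightarrow> X \<in> tangent_space M q \<Longrightarrow>
     v \<in> fmodel E \<Longrightarrow> norm (cform \<Phi> q X v) \<le> D * norm (X c) * norm v"
    using cform_bound[OF tr ca(1) K r(2)] by metis
  \<comment> \<open>The bound \<open>r / C\<close> keeps the curve in the ball. The other one gives
    \<open>D * C * len \<alpha> \<le> 1 / 2\<close>, which absorbs the maximum, and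
    \<open>\<le> \<rho> / 2\<close>, which compensates the resulting factor 2. The summand 1 avoids
    division by zero.\<close>
  define \<epsilon> where "\<epsilon> = min (r / C) (min 1 \<rho> / (2 * (D * C + 1)))"
  have DC: "D * C \<ge> 0" using D C by simp
  have \<epsilon>: "\<epsilon> > 0" using r C DC \<rho> by (simp add: \<epsilon>_def)
  have "norm (\<Phi> (s 1) - \<Phi> (s 0)) \<le> \<rho> * norm (\<Phi> (s 0))"
    if par: "parallel \<alpha> s" and \<alpha>0: "\<alpha> 0 = p" and short: "len \<alpha> < \<epsilon>" for \<alpha> s
  proof -
    obtain T where T0: "\<forall>t. t \<in> {0..1} \<longrightarrow> s t \<in> fibre E (\<alpha> t)" "smooth_subdivision M \<alpha> T"
      "\<forall>a b t. (a, b) \<in> pieces T \<longrightarrow> t \<in> {a..b} \<longrightarrow> par_at {a..b} \<alpha> s t"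
      using parallel_alongD[OF par] by (elim exE conjE)
    note T = T0[rule_format]
    let ?l = "len \<alpha>" and ?y = "\<lambda>t. \<Phi> (s t)"
    have l0: "?l \<ge> 0" by (rule curve_length_nonneg[OF T(2)])
    have "?l < r / C" and l: "?l < min 1 \<rho> / (2 * (D * C + 1))" using short by (simp_all add: \<epsilon>_def)
    then have l1: "C * ?l < r" using C(1) by (simp add: field_simps)
    have "?l * (2 * (D * C + 1)) < min 1 \<rho>" using l DC by (simp add: pos_less_divide_eq)
    then have l2: "D * C * ?l \<le> 1 / 2" and l3: "D * C * ?l \<le> \<rho> / 2" using l0 by (simp_all add: algebra_simps)
    have stay: "\<alpha> t \<in> U \<inter> fst c \<and> snd c (\<alpha> t) \<in> ?K" if "t \<in> {0..1}" for t
    proof -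
      have *: "\<alpha> t \<in> fst c \<and> snd c (\<alpha> t) \<in> cball ?x r"
        by (rule short_curve_stays[OF c r(1) Kc C T(2) \<alpha>0 l1 that])
      then have k: "snd c (\<alpha> t) \<in> ?K" using chart_image_subset[OF ca(1)] by blast
      \<comment> \<open>The part of the ball in the model space is covered by the image of
        \<open>U \<inter> fst c\<close>, so injectivity of the chart places
        \<open>\<alpha> t\<close> in \<open>U\<close> as well.\<close>
      then obtain q where q: "q \<in> U \<inter> fst c" "snd c (\<alpha> t) = snd c q" using r(2) by blast
      then have "\<alpha> t = q" using * chart_inj[OF ca(1)] by (auto dest: inj_onD)
      then show ?thesis using q k by blast
    qed
    have cont: "continuous_on {0..1} ?y"
      by (rule parallel_continuous[OF tr T(2) T(1) T(3)]) (use stay in auto)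
    have ne: "{0..1::real} \<noteq> {}" by simp
    obtain t1 where t1: "t1 \<in> {0..1}" "\<forall>t\<in>{0..1}. norm (?y t) \<le> norm (?y t1)"
      using continuous_attains_sup[OF compact_Icc ne continuous_on_norm[OF cont]] by (elim bexE)
    define m where "m = norm (?y t1)"
    define \<sigma> where "\<sigma> = (\<lambda>t. if t \<in> T then 0 else spd \<alpha> t)"
    \<comment> \<open>The derivative of the section is bounded by the factor \<open>D\<close> of the
      connection form, the coordinate speed \<open>C * \<sigma> t\<close> and the maximum
      \<open>m\<close>.\<close>
    have bd: "norm (?y u - ?y 0) \<le> (D * C * m) * ?l" if u: "u \<in> {0..1}" for u
    proof (rule norm_diff_le_integral[of T u ?y "\<lambda>t. - cform \<Phi> (\<alpha> t) (velocity M {0..1} \<alpha> t) (\<Phi> (s t))" _ \<sigma>])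
      show "finite T" by (rule smooth_subdivisionD(1)[OF T(2)])
      show "continuous_on {0..u} ?y" by (rule continuous_on_subset[OF cont]) (use u in auto)
      show "0 \<le> \<sigma> t" if "t \<in> {0..1}" for t unfolding \<sigma>_def by (rule speed_nonneg[OF T(2) that])
      show "(\<sigma> has_integral ?l) {0..1}" unfolding \<sigma>_def by (rule curve_length_has_integral[OF T(2)])
      show "D * C * m \<ge> 0" using DC by (simp add: m_def)
      fix t assume t: "t \<in> {0<..<u} - T"
      then have t': "t \<in> {0..1}" "t \<notin> T" using u by auto
      show "(?y has_vector_derivative - cform \<Phi> (\<alpha> t) (velocity M {0..1} \<alpha> t) (\<Phi> (s t))) (at t)"
        by (rule parallel_derivative[OF tr T(2) T(1) T(3) t']) (use stay[OF t'(1)] in auto)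
      have q: "\<alpha> t \<in> U" "\<alpha> t \<in> fst c" "snd c (\<alpha> t) \<in> ?K" using stay[OF t'(1)] by auto
      have cq: "c \<in> charts_at M (\<alpha> t)" using ca(1) q(2) by (simp add: charts_at_def)
      note sv = subdivision_velocity[OF T(2) t']
      let ?v = "velocity M {0..1} \<alpha> t"
      have v: "norm (?v c) \<le> C * \<sigma> t"
        using C(2)[OF q(3) tangent_model[OF cq sv(1)]] t'(2) metric_eq_gform[OF ca(1) q(2) sv(1)]
        by (simp add: \<sigma>_def speed_def)
      have "norm (- cform \<Phi> (\<alpha> t) ?v (\<Phi> (s t))) \<le> D * norm (?v c) * norm (\<Phi> (s t))"
        unfolding norm_minus_cancel
        by (rule D(2)[OF _ q(3) sv(1) triv_mem[OF tr q(1) T(1)[OF t'(1)]]]) (use q in blast)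
      also have "\<dots> \<le> D * (C * \<sigma> t) * m"
      proof (intro mult_mono mult_nonneg_nonneg)
        show "0 \<le> \<sigma> t" unfolding \<sigma>_def by (rule speed_nonneg[OF T(2) t'(1)])
        show "norm (\<Phi> (s t)) \<le> m" using t1(2) t'(1) by (simp add: m_def)
      qed (use D(1) C(1) v in auto)
      finally show "norm (- cform \<Phi> (\<alpha> t) ?v (\<Phi> (s t))) \<le> D * C * m * \<sigma> t" by (simp add: mult_ac)
    qed (use u in auto)
    have m0: "m \<ge> 0" by (simp add: m_def)
    have "m \<le> norm (?y 0) + norm (?y t1 - ?y 0)"
      unfolding m_def using norm_triangle_sub[of "?y t1" "?y 0"] by simp
    also have "\<dots> \<le> norm (?y 0) + (D * C * ?l) * m" using bd[OF t1(1)] by (simp add: mult_ac)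
    also have "\<dots> \<le> norm (?y 0) + (1 / 2) * m" using mult_right_mono[OF l2 m0] by simp
    finally have m2: "m \<le> 2 * norm (?y 0)" by simp
    have "norm (?y 1 - ?y 0) \<le> (D * C * ?l) * m" using bd[of 1] by (simp add: mult_ac)
    also have "\<dots> \<le> (\<rho> / 2) * (2 * norm (?y 0))"
      by (rule mult_mono[OF l3 m2]) (use \<rho> m0 in simp_all)
    finally show ?thesis by simp
  qed
  then show ?thesis using \<epsilon> by (intro exI[of _ \<epsilon>]) simp
qed

end

section \<open>The metric on the holonomy group\<close>

lemma (in Metric_space) continuous_map_mtopology_euclideanI:
  fixes f :: "'a \<Rightarrow> 'b::metric_space"
  assumes f: "\<And>x e. x \<in> M \<Longrightarrow> e > 0 \<Longrightarrow> \<exists>\<delta>>0. \<forall>y\<in>M. d x y < \<delta> \<longrightarrow> dist (f x) (f y) < e"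
  shows "continuous_map mtopology euclidean f"
  unfolding continuous_map_def
proof (intro conjI allI impI)
  fix V :: "'b set" assume "openin euclidean V"
  then have V: "open V" by simp
  show "openin mtopology {x \<in> topspace mtopology. f x \<in> V}"
    unfolding openin_mtopology topspace_mtopology
  proof (intro conjI allI impI)
    fix x assume "x \<in> {x \<in> M. f x \<in> V}"
    then have x: "x \<in> M" "f x \<in> V" by auto
    obtain e where e: "e > 0" "ball (f x) e \<subseteq> V" using V x(2) open_contains_ball by blast
    obtain \<delta> where \<delta>: "\<delta> > 0" "\<forall>y\<in>M. d x y < \<delta> \<longrightarrow> dist (f x) (f y) < e" using f[OF x(1) e(1)] by (elim exE conjE)
    have "mball x \<delta> \<subseteq> {x \<in> M. f x \<in> V}"
    proof
      fix y assume "y \<in> mball x \<delta>"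
      then have y: "y \<in> M" "d x y < \<delta>" by auto
      then have "f y \<in> ball (f x) e" using \<delta>(2) by simp
      then show "y \<in> {x \<in> M. f x \<in> V}" using e(2) y(1) by blast
    qed
    then show "\<exists>r>0. mball x r \<subseteq> {x \<in> M. f x \<in> V}" using \<delta>(1) by (intro exI[of _ \<delta>] conjI)
  qed blast
qed simp

text \<open>This separates the algebra of the metric \<open>L (inv a \<otimes> b)\<close> from its
  geometric origin; definiteness is the one axiom whose verification will call on the holonomy
  estimate.\<close>

locale group_length = group G for G (structure) +
  fixes H :: "'a set" and L :: "'a \<Rightarrow> real"
  assumes H: "subgroup H G"
    and L_nonneg: "a \<in> H \<Longrightarrow> L a \<ge> 0"
    and L_eq_0_iff: "a \<in> H \<Longrightarrow> L a = 0 \<longleftrightarrow> a = \<one>"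
    and L_inv: "a \<in> H \<Longrightarrow> L (inv a) = L a"
    and L_mult: "a \<in> H \<Longrightarrow> b \<in> H \<Longrightarrow> L (a \<otimes> b) \<le> L a + L b"
begin

definition ldist :: "'a \<Rightarrow> 'a \<Rightarrow> real" where
  "ldist a b = (if a \<in> H \<and> b \<in> H then L (inv a \<otimes> b) else 0)"

lemma H_closed: "a \<in> H \<Longrightarrow> a \<in> carrier G" "a \<in> H \<Longrightarrow> inv a \<in> H" "a \<in> H \<Longrightarrow> b \<in> H \<Longrightarrow> a \<otimes> b \<in> H"
  "\<one> \<in> H"
  using H by (auto dest: subgroup.mem_carrier subgroup.m_inv_closed subgroup.m_closed subgroup.one_closed)

lemma Metric_space_ldist: "Metric_space H ldist"
proof
  fix a b c
  show "0 \<le> ldist a b" by (simp add: ldist_def L_nonneg H_closed)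
  show "ldist a b = ldist b a"
  proof (cases "a \<in> H \<and> b \<in> H")
    case True
    then have "inv (inv a \<otimes> b) = inv b \<otimes> a" by (simp add: inv_mult_group H_closed)
    then show ?thesis using True L_inv[of "inv a \<otimes> b"] by (simp add: ldist_def H_closed)
  qed (auto simp: ldist_def)
  show "(ldist a b = 0) = (a = b)" if "a \<in> H" "b \<in> H"
  proof -
    have "inv a \<otimes> b = \<one> \<longleftrightarrow> a = b"
    proof
      assume "inv a \<otimes> b = \<one>"
      then have "a \<otimes> (inv a \<otimes> b) = a" using that by (simp add: H_closed)
      then show "a = b" using that by (simp add: H_closed m_assoc[symmetric])
    qed (use that in \<open>simp add: H_closed\<close>)
    then show ?thesis using that by (simp add: ldist_def L_eq_0_iff H_closed)
  qed
  show "ldist a c \<le> ldist a b + ldist b c" if "a \<in> H" "b \<in> H" "c \<in> H"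
  proof -
    have "(inv a \<otimes> b) \<otimes> (inv b \<otimes> c) = inv a \<otimes> (b \<otimes> (inv b \<otimes> c))"
      using that by (simp add: m_assoc H_closed)
    also have "b \<otimes> (inv b \<otimes> c) = c" using that by (simp add: H_closed m_assoc[symmetric])
    finally show ?thesis
      using that L_mult[of "inv a \<otimes> b" "inv b \<otimes> c"] by (simp add: ldist_def H_closed)
  qed
qed

text \<open>\<open>L\<close> is the distance from the identity, hence Lipschitz with constant
  1.\<close>

lemma L_diff_le:
  assumes "a \<in> H" "b \<in> H" shows "\<bar>L a - L b\<bar> \<le> ldist a b"
proof -
  interpret Metric_space H ldist by (rule Metric_space_ldist)
  have L: "L x = ldist \<one> x" if "x \<in> H" for x using that by (simp add: ldist_def H_closed)
  show ?thesis
    using triangle[OF H_closed(4) assms] triangle[OF H_closed(4) assms(2,1)] commute[of a b]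
    by (simp add: L[OF assms(1)] L[OF assms(2)])
qed

end

section \<open>The inner product on the fibre over \<open>p\<close>, read in a
  trivialization\<close>

locale bundle_fibre = bundle_connection M g E h nabla
  for M :: "('m, 'v::euclidean_space) manifold" and g
    and E :: "('m, 'e, 'f::euclidean_space) vbundle" and h nabla +
  fixes p :: 'm and U :: "'m set" and \<Phi> :: "'e \<Rightarrow> 'f"
  assumes triv: "(U, \<Phi>) \<in> trivs E" and pU: "p \<in> U"
begin

abbreviation "GLp \<equiv> GL E p"
abbreviation "op_norm_dist \<equiv> op_dist E h p"
abbreviation "Fp \<equiv> fibre E p"
abbreviation "\<kappa> v \<equiv> const_section E \<Phi> v p"

lemma pM: "p \<in> topspace (mtop M)"
  using triv_subset[OF triv] pU by blast

lemmas ops = fibre_ops[OF triv pU]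
lemmas \<Phi>_mem = triv_mem[OF triv pU]
lemmas \<Phi>_inj = triv_inj[OF triv pU]
lemmas \<kappa>_mem = const_section_mem[OF triv pU]
lemmas \<Phi>_\<kappa> = const_section_triv[OF triv pU]
lemmas \<kappa>_\<Phi> = const_section_self[OF triv pU]

lemma h_rules:
  assumes "e \<in> Fp"
  shows "e' \<in> Fp \<Longrightarrow> h e e' = h e' e" "e' \<in> Fp \<Longrightarrow> h (vscale E r e) e' = r * h e e'"
    "e' \<in> Fp \<Longrightarrow> e'' \<in> Fp \<Longrightarrow> h (vadd E e e'') e' = h e e' + h e'' e'"
    "e \<noteq> vscale E 0 e \<Longrightarrow> h e e > 0"
proof -
  have *: "\<forall>p\<in>topspace (mtop M). \<forall>e\<in>fibre E p.
        (\<forall>e'\<in>fibre E p. h e e' = h e' e \<and>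
           (\<forall>r. h (vscale E r e) e' = r * h e e') \<and>
           (\<forall>e''\<in>fibre E p. h (vadd E e e'') e' = h e e' + h e'' e')) \<and>
        (e \<noteq> vscale E 0 e \<longrightarrow> h e e > 0)"
    using bm unfolding bundle_metric_def by (elim conjE)
  note ** = bspec[OF bspec[OF * pM] assms]
  show "e' \<in> Fp \<Longrightarrow> h e e' = h e' e" "e' \<in> Fp \<Longrightarrow> h (vscale E r e) e' = r * h e e'"
    "e' \<in> Fp \<Longrightarrow> e'' \<in> Fp \<Longrightarrow> h (vadd E e e'') e' = h e e' + h e'' e'"
    "e \<noteq> vscale E 0 e \<Longrightarrow> h e e > 0"
    using ** by simp_all
qed

text \<open>The inner product is carried to the model fibre in order to compare it with the
  Euclidean one; it is meaningful on \<open>fmodel E\<close> only.\<close>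

definition hform :: "'f \<Rightarrow> 'f \<Rightarrow> real" where "hform u v = h (\<kappa> u) (\<kappa> v)"
definition hnorm :: "'f \<Rightarrow> real" where "hnorm u = sqrt (hform u u)"

lemma \<kappa>_add: "u \<in> fmodel E \<Longrightarrow> v \<in> fmodel E \<Longrightarrow> \<kappa> (u + v) = vadd E (\<kappa> u) (\<kappa> v)"
  by (rule \<Phi>_inj) (simp_all add: \<kappa>_mem \<Phi>_\<kappa> ops subspace_add[OF fmodel_subspace])

lemma \<kappa>_scale: "u \<in> fmodel E \<Longrightarrow> \<kappa> (r *\<^sub>R u) = vscale E r (\<kappa> u)"
  by (rule \<Phi>_inj) (simp_all add: \<kappa>_mem \<Phi>_\<kappa> ops subspace_mul[OF fmodel_subspace])

lemma hform_linear_left: "w \<in> fmodel E \<Longrightarrow> lin_on (fmodel E) (\<lambda>v. hform v w)"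
  by (simp add: lin_on_def hform_def \<kappa>_add \<kappa>_scale h_rules \<kappa>_mem)

lemma hform_sym: "u \<in> fmodel E \<Longrightarrow> v \<in> fmodel E \<Longrightarrow> hform u v = hform v u"
  by (simp add: hform_def h_rules(1) \<kappa>_mem)

lemma hform_linear_right:
  assumes w: "w \<in> fmodel E" shows "lin_on (fmodel E) (hform w)"
  using hform_linear_left[OF w] fmodel_subspace
  by (simp add: lin_on_def hform_sym[OF w] subspace_add subspace_mul)

lemma hform_pos:
  assumes "u \<in> fmodel E" "u \<noteq> 0" shows "hform u u > 0"
proof -
  have "\<Phi> (\<kappa> u) \<noteq> \<Phi> (vscale E 0 (\<kappa> u))"
    using assms by (simp add: ops \<kappa>_mem \<Phi>_\<kappa>)
  then have "\<kappa> u \<noteq> vscale E 0 (\<kappa> u)" by metis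
  then show ?thesis unfolding hform_def by (rule h_rules(4)[OF \<kappa>_mem[OF assms(1)]])
qed

lemma hform_zero: "hform 0 0 = 0"
  using lin_on_zero[OF hform_linear_right[OF subspace_0] fmodel_subspace] fmodel_subspace by simp

lemma hform_nonneg: "u \<in> fmodel E \<Longrightarrow> hform u u \<ge> 0"
  using hform_pos[of u] hform_zero by (cases "u = 0") auto

lemma hnorm_nonneg: "u \<in> fmodel E \<Longrightarrow> hnorm u \<ge> 0"
  by (simp add: hnorm_def hform_nonneg)

lemma hnorm_eq_0: "u \<in> fmodel E \<Longrightarrow> hnorm u = 0 \<longleftrightarrow> u = 0"
  using hform_pos[of u] hform_zero by (cases "u = 0") (auto simp: hnorm_def)

lemma hform_scale: "u \<in> fmodel E \<Longrightarrow> hform (r *\<^sub>R u) (r *\<^sub>R u) = r\<^sup>2 * hform u u"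
  using hform_linear_left[of "r *\<^sub>R u"] hform_linear_right[of u] fmodel_subspace
  by (simp add: lin_on_def subspace_mul power2_eq_square)

lemma hnorm_minus: "u \<in> fmodel E \<Longrightarrow> hnorm (- u) = hnorm u"
  using hform_scale[of u "-1"] by (simp add: hnorm_def)

lemma hform_add:
  assumes "u \<in> fmodel E" "v \<in> fmodel E"
  shows "hform (u + v) (u + v) = hform u u + 2 * hform u v + hform v v"
proof -
  have uv: "u + v \<in> fmodel E" by (rule subspace_add[OF fmodel_subspace assms])
  show ?thesis
    using hform_linear_left[OF uv] hform_linear_right[OF assms(1)] hform_linear_right[OF assms(2)] assms
      hform_sym[OF assms]
    by (simp add: lin_on_def)
qed

lemma hform_Cauchy_Schwarz:
  assumes u: "u \<in> fmodel E" and v: "v \<in> fmodel E"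
  shows "hform u v \<le> hnorm u * hnorm v"
proof (cases "v = 0")
  case True
  then show ?thesis
    using lin_on_zero[OF hform_linear_right[OF u] fmodel_subspace] hnorm_eq_0[OF v] by simp
next
  case False
  define a b c where "a = hform u u" and "b = hform u v" and "c = hform v v"
  have c: "c > 0" unfolding c_def by (rule hform_pos[OF v False])
  \<comment> \<open>The minimizer in \<open>t\<close> of the quadratic polynomial
    \<open>hform (u + t *\<^sub>R v) (u + t *\<^sub>R v)\<close>.\<close>
  let ?t = "- (b / c)"
  have tv: "?t *\<^sub>R v \<in> fmodel E" by (rule subspace_mul[OF fmodel_subspace v])
  have "0 \<le> hform (u + ?t *\<^sub>R v) (u + ?t *\<^sub>R v)"
    by (rule hform_nonneg[OF subspace_add[OF fmodel_subspace u tv]])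
  also have "\<dots> = a + 2 * (?t * b) + ?t\<^sup>2 * c"
  proof -
    have "hform u (?t *\<^sub>R v) = ?t * b"
      unfolding b_def using hform_linear_right[OF u, unfolded lin_on_def, rule_format, OF v, THEN conjunct2, THEN spec, of ?t]
      by (simp only: real_scaleR_def b_def)
    then show ?thesis
      using hform_add[OF u tv] hform_scale[OF v, of ?t] unfolding a_def[symmetric] c_def[symmetric]
      by (simp only:)
  qed
  also have "\<dots> = a - b\<^sup>2 / c" using c by (simp add: field_simps power2_eq_square)
  finally have "b\<^sup>2 \<le> a * c" using c by (simp add: field_simps)
  then have "b \<le> sqrt (a * c)" by (rule real_le_rsqrt)
  then show ?thesis by (simp add: a_def b_def c_def hnorm_def real_sqrt_mult)
qed

lemma hnorm_triangle:
  assumes u: "u \<in> fmodel E" and v: "v \<in> fmodel E"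
  shows "hnorm (u + v) \<le> hnorm u + hnorm v"
proof -
  have "hform (u + v) (u + v) \<le> (hnorm u + hnorm v)\<^sup>2"
    using hform_Cauchy_Schwarz[OF assms] hform_nonneg[OF u] hform_nonneg[OF v]
    by (simp add: hform_add[OF assms] power2_sum hnorm_def)
  then show ?thesis
    using real_le_lsqrt hnorm_nonneg[OF u] hnorm_nonneg[OF v] unfolding hnorm_def[of "u + v"] by simp
qed

lemma hnorm_bounds:
  obtains k C where "k > 0" "C > 0" "\<And>u. u \<in> fmodel E \<Longrightarrow> norm u \<le> k * hnorm u"
    "\<And>u. u \<in> fmodel E \<Longrightarrow> hnorm u \<le> C * norm u"
proof -
  obtain B where B: "parseval_frame (fmodel E) B" using parseval_frame_exists[OF fmodel_subspace] .
  \<comment> \<open>The compactness lemmas are applied to a constant family over a one-point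
    space.\<close>
  obtain l where l: "l > 0" "\<And>x v. x \<in> {0::real} \<Longrightarrow> v \<in> fmodel E \<Longrightarrow> l * (norm v)\<^sup>2 \<le> hform v v"
    by (rule compact_posdef_lower_bound[of "{0::real}" "fmodel E" B "\<lambda>_. hform"])
      (auto simp: fmodel_subspace B hform_linear_left hform_linear_right hform_pos)
  obtain D where D: "D \<ge> 0" "\<And>x v w. x \<in> {0::real} \<Longrightarrow> v \<in> fmodel E \<Longrightarrow> w \<in> fmodel E \<Longrightarrow>
      norm (hform v w) \<le> D * norm v * norm w"
    by (rule compact_bilin_bound[of "{0::real}" "fmodel E" B "fmodel E" B "\<lambda>_. hform"])
      (auto simp: fmodel_subspace B hform_linear_left hform_linear_right)
  have 1: "norm u \<le> (1 / sqrt l) * hnorm u" if "u \<in> fmodel E" for u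
  proof -
    have "sqrt l * norm u = sqrt (l * (norm u)\<^sup>2)" by (simp add: real_sqrt_mult)
    also have "\<dots> \<le> hnorm u" unfolding hnorm_def using l(2)[of 0 u] that by simp
    finally show ?thesis using l(1) by (simp add: field_simps)
  qed
  \<comment> \<open>The summand 1 makes the constant positive even if \<open>D = 0\<close>.\<close>
  have 2: "hnorm u \<le> (sqrt D + 1) * norm u" if "u \<in> fmodel E" for u
  proof -
    have "hform u u \<le> D * (norm u)\<^sup>2" using D(2)[of 0 u u] that by (simp add: power2_eq_square mult_ac)
    then have "hnorm u \<le> sqrt (D * (norm u)\<^sup>2)" unfolding hnorm_def by simp
    also have "\<dots> = sqrt D * norm u" by (simp add: real_sqrt_mult)
    also have "\<dots> \<le> (sqrt D + 1) * norm u" by (simp add: algebra_simps)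
    finally show ?thesis .
  qed
  have "1 / sqrt l > 0" "sqrt D + 1 > 0" using l(1) D(1) by (simp_all add: add_nonneg_pos)
  then show ?thesis using that 1 2 by metis
qed

lemma h_eq_hnorm: "e \<in> Fp \<Longrightarrow> sqrt (h e e) = hnorm (\<Phi> e)"
  by (simp add: hnorm_def hform_def \<kappa>_\<Phi>)

lemma unit_ball_iff: "e \<in> Fp \<Longrightarrow> h e e \<le> 1 \<longleftrightarrow> hnorm (\<Phi> e) \<le> 1"
  by (simp add: h_eq_hnorm[symmetric])

text \<open>A witness that the unit ball is nonempty, also in rank 0, as the supremum in
  \<open>op_dist\<close> demands.\<close>

definition zero_vec :: 'e where "zero_vec = \<kappa> 0"

lemma zero_vec: "zero_vec \<in> Fp" "\<Phi> zero_vec = 0" "h zero_vec zero_vec \<le> 1"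
proof -
  show 1: "zero_vec \<in> Fp" "\<Phi> zero_vec = 0"
    by (simp_all add: zero_vec_def \<kappa>_mem \<Phi>_\<kappa> subspace_0[OF fmodel_subspace])
  show "h zero_vec zero_vec \<le> 1"
    unfolding unit_ball_iff[OF 1(1)] 1(2) using hnorm_eq_0[OF subspace_0[OF fmodel_subspace]] by simp
qed

section \<open>Linear automorphisms of the fibre and the operator norm\<close>

lemma GL_iff: "a \<in> carrier (GLp) \<longleftrightarrow> a \<in> Bij Fp \<and> (\<forall>e\<in>Fp. (\<forall>e'\<in>Fp. a (vadd E e e') = vadd E (a e) (a e')) \<and>
        (\<forall>r. a (vscale E r e) = vscale E r (a e)))"
  by (simp add: GL_def)

lemma GL_mem: "a \<in> carrier (GLp) \<Longrightarrow> e \<in> Fp \<Longrightarrow> a e \<in> Fp"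
  unfolding GL_iff using Bij_imp_funcset by (auto dest: funcset_mem)

lemma GL_linear: "a \<in> carrier (GLp) \<Longrightarrow> e \<in> Fp \<Longrightarrow> e' \<in> Fp \<Longrightarrow> a (vadd E e e') = vadd E (a e) (a e')"
  "a \<in> carrier (GLp) \<Longrightarrow> e \<in> Fp \<Longrightarrow> a (vscale E r e) = vscale E r (a e)"
  unfolding GL_iff by simp_all

lemma GL_inj: "a \<in> carrier (GLp) \<Longrightarrow> e \<in> Fp \<Longrightarrow> e' \<in> Fp \<Longrightarrow> a e = a e' \<Longrightarrow> e = e'"
  unfolding GL_iff by (auto simp: Bij_def bij_betw_def dest: inj_onD)

lemma GL_eqI:
  assumes "a \<in> carrier (GLp)" "b \<in> carrier (GLp)" "\<And>e. e \<in> Fp \<Longrightarrow> a e = b e"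
  shows "a = b"
  by (rule extensionalityI[of _ Fp]) (use assms in \<open>simp_all add: GL_iff Bij_imp_extensional\<close>)

lemma GL_subgroup: "subgroup (carrier (GLp)) (BijGroup Fp)"
proof -
  interpret B: group "BijGroup Fp" by (rule group_BijGroup)
  show ?thesis
  proof (rule B.subgroupI)
    show "carrier (GLp) \<subseteq> carrier (BijGroup Fp)" by (auto simp: GL_iff BijGroup_def)
    have "(\<lambda>e\<in>Fp. e) \<in> carrier (GLp)"
      unfolding GL_iff using ops by (simp add: id_Bij)
    then show "carrier (GLp) \<noteq> {}" by blast
  next
    fix a assume a: "a \<in> carrier (GLp)"
    then have aB: "a \<in> Bij Fp" by (simp add: GL_iff)
    let ?b = "\<lambda>x\<in>Fp. inv_into Fp a x"
    have aF: "a ` Fp = Fp" using aB by (simp add: Bij_def bij_betw_def)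
    have ab: "a (?b e) = e" "?b e \<in> Fp" if "e \<in> Fp" for e
      using that f_inv_into_f[of e a Fp] inv_into_into[of e a Fp] unfolding aF by simp_all
    have "?b \<in> carrier (GLp)"
      unfolding GL_iff
    proof (intro conjI ballI allI)
      show "?b \<in> Bij Fp" by (rule restrict_inv_into_Bij[OF aB])
      fix e assume e: "e \<in> Fp"
      show "?b (vadd E e e') = vadd E (?b e) (?b e')" if e': "e' \<in> Fp" for e'
      \<comment> \<open>Linearity of the inverse is checked after applying the injective map
        \<open>a\<close>.\<close>
      proof (rule GL_inj[OF a])
        show "a (?b (vadd E e e')) = a (vadd E (?b e) (?b e'))"
          unfolding ab(1)[OF ops(1)[OF e e']] GL_linear(1)[OF a ab(2)[OF e] ab(2)[OF e']] ab(1)[OF e] ab(1)[OF e'] ..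
      qed (use e e' ops ab(2) in \<open>simp_all del: restrict_apply\<close>)
      show "?b (vscale E r e) = vscale E r (?b e)" for r
      proof (rule GL_inj[OF a])
        show "a (?b (vscale E r e)) = a (vscale E r (?b e))"
          unfolding ab(1)[OF ops(3)[OF e]] GL_linear(2)[OF a ab(2)[OF e]] ab(1)[OF e] ..
      qed (use e ops ab(2) in \<open>simp_all del: restrict_apply\<close>)
    qed
    then show "inv\<^bsub>BijGroup Fp\<^esub> a \<in> carrier (GLp)" by (simp only: inv_BijGroup[OF aB])
  next
    fix a b assume a: "a \<in> carrier (GLp)" and b: "b \<in> carrier (GLp)"
    then have B: "a \<in> Bij Fp" "b \<in> Bij Fp" by (simp_all add: GL_iff)
    have ce: "compose Fp a b e = a (b e)" if "e \<in> Fp" for e using that by (simp add: compose_def)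
    have "compose Fp a b \<in> carrier (GLp)"
      unfolding GL_iff
      using compose_Bij[OF B] by (simp add: ce ops GL_linear[OF a] GL_linear[OF b] GL_mem[OF b])
    then show "a \<otimes>\<^bsub>BijGroup Fp\<^esub> b \<in> carrier (GLp)" using B by (simp add: BijGroup_def)
  qed
qed

lemma GL_eq: "GLp = BijGroup Fp\<lparr>carrier := carrier (GLp)\<rparr>"
  by (simp add: GL_def)

lemma GL_group: "group (GLp)"
  using subgroup.subgroup_is_group[OF GL_subgroup group_BijGroup] GL_eq by simp

lemma GL_mult:
  assumes "a \<in> carrier (GLp)" "b \<in> carrier (GLp)" "e \<in> Fp"
  shows "(a \<otimes>\<^bsub>GLp\<^esub> b) e = a (b e)"
proof -
  have "a \<in> Bij Fp" "b \<in> Bij Fp" using assms by (simp_all add: GL_iff)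
  then show ?thesis using assms(3) by (simp add: GL_def BijGroup_def compose_def)
qed

lemma GL_one: "e \<in> Fp \<Longrightarrow> \<one>\<^bsub>GLp\<^esub> e = e"
  by (simp add: GL_def BijGroup_def)

lemma GL_inv:
  assumes a: "a \<in> carrier (GLp)" and e: "e \<in> Fp"
  shows "a ((inv\<^bsub>GLp\<^esub> a) e) = e" "(inv\<^bsub>GLp\<^esub> a) (a e) = e"
proof -
  interpret group "GLp" by (rule GL_group)
  show "a ((inv\<^bsub>GLp\<^esub> a) e) = e"
    using GL_mult[OF a inv_closed[OF a] e] r_inv[OF a] GL_one[OF e] by simp
  show "(inv\<^bsub>GLp\<^esub> a) (a e) = e"
    using GL_mult[OF inv_closed[OF a] a e] l_inv[OF a] GL_one[OF e] by simp
qed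

lemma GL_lin_on:
  assumes a: "a \<in> carrier (GLp)"
  shows "lin_on (fmodel E) (\<lambda>v. \<Phi> (a (\<kappa> v)))"
  unfolding lin_on_def
  by (simp add: \<kappa>_add \<kappa>_scale GL_linear[OF a] \<kappa>_mem ops GL_mem[OF a])

text \<open>The Lipschitz form suits an abstract fibre: the difference is formed in
  \<open>fmodel E\<close> and carried back by \<open>\<kappa>\<close>, where linearity of
  \<open>a\<close> applies.\<close>

lemma GL_bound:
  assumes a: "a \<in> carrier (GLp)"
  obtains C where "C \<ge> 0" "\<And>e e'. e \<in> Fp \<Longrightarrow> e' \<in> Fp \<Longrightarrow> norm (\<Phi> (a e) - \<Phi> (a e')) \<le> C * norm (\<Phi> e - \<Phi> e')"
proof -
  obtain C where C: "C \<ge> 0" "\<And>v. v \<in> fmodel E \<Longrightarrow> norm (\<Phi> (a (\<kappa> v))) \<le> C * norm v"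
    using lin_on_bound[OF GL_lin_on[OF a] fmodel_subspace] by metis
  have "norm (\<Phi> (a e) - \<Phi> (a e')) \<le> C * norm (\<Phi> e - \<Phi> e')" if e: "e \<in> Fp" "e' \<in> Fp" for e e'
  proof -
    have d: "\<Phi> e - \<Phi> e' = \<Phi> e + (-1) *\<^sub>R \<Phi> e'" by simp
    have m: "(-1) *\<^sub>R \<Phi> e' \<in> fmodel E" by (rule subspace_mul[OF fmodel_subspace \<Phi>_mem[OF e(2)]])
    have "\<Phi> (a (\<kappa> (\<Phi> e - \<Phi> e'))) = \<Phi> (a e) - \<Phi> (a e')"
      unfolding d \<kappa>_add[OF \<Phi>_mem[OF e(1)] m] \<kappa>_scale[OF \<Phi>_mem[OF e(2)]] \<kappa>_\<Phi>[OF e(1)] \<kappa>_\<Phi>[OF e(2)]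
      using e by (simp add: GL_linear[OF a] ops GL_mem[OF a])
    moreover have "\<Phi> e - \<Phi> e' \<in> fmodel E" by (rule subspace_diff[OF fmodel_subspace \<Phi>_mem[OF e(1)] \<Phi>_mem[OF e(2)]])
    ultimately show ?thesis using C(2)[of "\<Phi> e - \<Phi> e'"] by simp
  qed
  then show ?thesis using that C(1) by metis
qed

definition vdist :: "('e \<Rightarrow> 'e) \<Rightarrow> ('e \<Rightarrow> 'e) \<Rightarrow> 'e \<Rightarrow> real" where
  "vdist a b e = hnorm (\<Phi> (a e) - \<Phi> (b e))"

lemma vdist_eq:
  assumes "a \<in> carrier (GLp)" "b \<in> carrier (GLp)" "e \<in> Fp"
  shows "(let d = vadd E (a e) (vscale E (-1) (b e)) in sqrt (h d d)) = vdist a b e"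
proof -
  have m: "a e \<in> Fp" "b e \<in> Fp" by (rule GL_mem[OF assms(1,3)], rule GL_mem[OF assms(2,3)])
  then have d: "vadd E (a e) (vscale E (-1) (b e)) \<in> Fp" by (simp add: ops)
  have "\<Phi> (vadd E (a e) (vscale E (-1) (b e))) = \<Phi> (a e) - \<Phi> (b e)"
    using m by (simp add: ops)
  then show ?thesis unfolding Let_def h_eq_hnorm[OF d] vdist_def by simp
qed

abbreviation "uball \<equiv> {e \<in> Fp. h e e \<le> 1}"

lemma op_dist_eq:
  assumes "a \<in> carrier (GLp)" "b \<in> carrier (GLp)"
  shows "op_norm_dist a b = (SUP e\<in>uball. vdist a b e)"
  unfolding op_dist_def if_P[OF conjI[OF assms]]
  by (rule arg_cong[where f = Sup], rule image_cong[OF refl]) (rule vdist_eq[OF assms], simp)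

lemma diff_mem:
  assumes "a \<in> carrier (GLp)" "b \<in> carrier (GLp)" "e \<in> Fp"
  shows "\<Phi> (a e) - \<Phi> (b e) \<in> fmodel E"
  by (rule subspace_diff[OF fmodel_subspace \<Phi>_mem[OF GL_mem[OF assms(1,3)]] \<Phi>_mem[OF GL_mem[OF assms(2,3)]]])

lemma GL_zero: "a \<in> carrier (GLp) \<Longrightarrow> \<Phi> (a zero_vec) = 0"
  unfolding zero_vec_def by (rule lin_on_zero[OF GL_lin_on fmodel_subspace])

text \<open>A real supremum dominates its terms only once the set is bounded; the bound combines
  \<open>GL_bound\<close> with the equivalence of \<open>hnorm\<close> and the Euclidean
  norm.\<close>

lemma vdist_le_op_dist:
  assumes a: "a \<in> carrier (GLp)" and b: "b \<in> carrier (GLp)" and e: "e \<in> uball"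
  shows "vdist a b e \<le> op_norm_dist a b"
proof -
  obtain Ca where Ca: "Ca \<ge> 0" "\<And>e e'. e \<in> Fp \<Longrightarrow> e' \<in> Fp \<Longrightarrow> norm (\<Phi> (a e) - \<Phi> (a e')) \<le> Ca * norm (\<Phi> e - \<Phi> e')"
    using GL_bound[OF a] by metis
  obtain Cb where Cb: "Cb \<ge> 0" "\<And>e e'. e \<in> Fp \<Longrightarrow> e' \<in> Fp \<Longrightarrow> norm (\<Phi> (b e) - \<Phi> (b e')) \<le> Cb * norm (\<Phi> e - \<Phi> e')"
    using GL_bound[OF b] by metis
  obtain k C where k: "k > 0" "C > 0" "\<And>u. u \<in> fmodel E \<Longrightarrow> norm u \<le> k * hnorm u"
    "\<And>u. u \<in> fmodel E \<Longrightarrow> hnorm u \<le> C * norm u" using hnorm_bounds by metis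
  have "vdist a b x \<le> C * ((Ca + Cb) * k)" if x: "x \<in> uball" for x
  proof -
    have xF: "x \<in> Fp" using x by simp
    have "norm (\<Phi> x) \<le> k * hnorm (\<Phi> x)" by (rule k(3)[OF \<Phi>_mem[OF xF]])
    also have "\<dots> \<le> k * 1" using x k(1) unit_ball_iff[OF xF] by (intro mult_left_mono) auto
    finally have n: "norm (\<Phi> x) \<le> k" by simp
    have "norm (\<Phi> (a x) - \<Phi> (b x)) \<le> norm (\<Phi> (a x)) + norm (\<Phi> (b x))" by (rule norm_triangle_ineq4)
    \<comment> \<open>Each map is compared with its value at \<open>zero_vec\<close>, which has
      coordinate 0.\<close>
    also have "\<dots> \<le> Ca * norm (\<Phi> x) + Cb * norm (\<Phi> x)"
      using Ca(2)[OF xF zero_vec(1)] Cb(2)[OF xF zero_vec(1)] by (simp add: GL_zero[OF a] GL_zero[OF b] zero_vec(2))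
    also have "\<dots> \<le> (Ca + Cb) * k"
      unfolding distrib_right[symmetric] using n Ca(1) Cb(1) by (intro mult_left_mono) auto
    finally have "norm (\<Phi> (a x) - \<Phi> (b x)) \<le> (Ca + Cb) * k" .
    then have "C * norm (\<Phi> (a x) - \<Phi> (b x)) \<le> C * ((Ca + Cb) * k)" using k(2) by (intro mult_left_mono) auto
    then show ?thesis unfolding vdist_def using k(4)[OF diff_mem[OF a b xF]] by linarith
  qed
  then have "bdd_above (vdist a b ` uball)" by (auto intro!: bdd_aboveI)
  then show ?thesis unfolding op_dist_eq[OF a b] by (rule cSUP_upper[OF e])
qed

lemma op_dist_leI:
  assumes a: "a \<in> carrier (GLp)" and b: "b \<in> carrier (GLp)"
    and le: "\<And>e. e \<in> uball \<Longrightarrow> vdist a b e \<le> B"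
  shows "op_norm_dist a b \<le> B"
  unfolding op_dist_eq[OF a b] by (rule cSUP_least) (use zero_vec le in auto)

lemma vdist_nonneg: "a \<in> carrier (GLp) \<Longrightarrow> b \<in> carrier (GLp) \<Longrightarrow> e \<in> Fp \<Longrightarrow> vdist a b e \<ge> 0"
  unfolding vdist_def by (intro hnorm_nonneg diff_mem)

lemma Metric_space_op_dist: "Metric_space (carrier (GLp)) (op_norm_dist)"
proof
  fix a b c
  let ?G = "carrier (GLp)"
  have z: "zero_vec \<in> uball" using zero_vec by simp
  show "0 \<le> op_norm_dist a b"
  proof (cases "a \<in> ?G \<and> b \<in> ?G")
    case True
    then show ?thesis
      using vdist_le_op_dist[of a b, OF _ _ z] vdist_nonneg[of a b, OF _ _ zero_vec(1)] by linarith
  qed (auto simp: op_dist_def)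
  have vc: "vdist a b e = vdist b a e" if "a \<in> ?G" "b \<in> ?G" "e \<in> Fp" for a b e
    unfolding vdist_def using hnorm_minus[OF diff_mem[OF that]] by simp
  have le: "op_norm_dist a b \<le> op_norm_dist b a" if "a \<in> ?G" "b \<in> ?G" for a b
    by (rule op_dist_leI[OF that]) (use that vc vdist_le_op_dist[of b a] in simp)
  show "op_norm_dist a b = op_norm_dist b a"
  proof (cases "a \<in> ?G \<and> b \<in> ?G")
    case True
    then show ?thesis using le[of a b] le[of b a] by simp
  qed (auto simp: op_dist_def)
  show "op_norm_dist a c \<le> op_norm_dist a b + op_norm_dist b c" if "a \<in> ?G" "b \<in> ?G" "c \<in> ?G"
  proof (rule op_dist_leI[OF that(1,3)])
    fix e assume e: "e \<in> uball"
    then have eF: "e \<in> Fp" by simp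
    have "vdist a c e = hnorm ((\<Phi> (a e) - \<Phi> (b e)) + (\<Phi> (b e) - \<Phi> (c e)))" by (simp add: vdist_def)
    also have "\<dots> \<le> vdist a b e + vdist b c e"
      unfolding vdist_def by (rule hnorm_triangle[OF diff_mem diff_mem]) (use that eF in auto)
    finally show "vdist a c e \<le> op_norm_dist a b + op_norm_dist b c"
      using vdist_le_op_dist[OF that(1,2) e] vdist_le_op_dist[OF that(2,3) e] by linarith
  qed
  show "(op_norm_dist a b = 0) = (a = b)" if ab: "a \<in> ?G" "b \<in> ?G"
  proof
    assume "a = b"
    have "op_norm_dist a b \<le> 0"
      by (rule op_dist_leI[OF ab])
        (use \<open>a = b\<close> hnorm_eq_0[OF subspace_0[OF fmodel_subspace]] in \<open>simp add: vdist_def\<close>)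
    moreover have "0 \<le> op_norm_dist a b"
      using vdist_le_op_dist[OF ab z] vdist_nonneg[OF ab zero_vec(1)] by linarith
    ultimately show "op_norm_dist a b = 0" by simp
  next
    assume 0: "op_norm_dist a b = 0"
    show "a = b"
    proof (rule GL_eqI[OF ab])
      fix e assume e: "e \<in> Fp"
      \<comment> \<open>This scales \<open>e\<close> into the unit ball; the summand 1 avoids
        division by zero.\<close>
      define r where "r = 1 / (hnorm (\<Phi> e) + 1)"
      have n: "hnorm (\<Phi> e) \<ge> 0" by (rule hnorm_nonneg[OF \<Phi>_mem[OF e]])
      have r: "r > 0" "r * hnorm (\<Phi> e) \<le> 1" using n by (simp_all add: r_def field_simps)
      let ?e = "vscale E r e"
      have eF: "?e \<in> Fp" by (rule ops(3)[OF e])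
      have "hnorm (\<Phi> ?e) = r * hnorm (\<Phi> e)"
        unfolding ops(4)[OF e] hnorm_def hform_scale[OF \<Phi>_mem[OF e]] using r(1) by (simp add: real_sqrt_mult)
      then have eb: "?e \<in> uball" using r(2) unit_ball_iff[OF eF] eF by simp
      have "vdist a b ?e = 0"
        using vdist_le_op_dist[OF ab eb] vdist_nonneg[OF ab eF] 0 by linarith
      then have "\<Phi> (a ?e) = \<Phi> (b ?e)"
        unfolding vdist_def using hnorm_eq_0[OF diff_mem[OF ab eF]] by simp
      then have "r *\<^sub>R \<Phi> (a e) = r *\<^sub>R \<Phi> (b e)"
        by (simp add: GL_linear(2)[OF ab(1) e] GL_linear(2)[OF ab(2) e] ops(4) GL_mem[OF _ e] ab)
      then have "\<Phi> (a e) = \<Phi> (b e)" using r(1) by simp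
      then show "a e = b e" by (rule \<Phi>_inj[OF GL_mem[OF ab(1) e] GL_mem[OF ab(2) e]])
    qed
  qed
qed

end

section \<open>Loops representing elements of the holonomy group\<close>

context bundle_fibre
begin

abbreviation "Holp \<equiv> Hol M E nabla p"
abbreviation "lnorm \<equiv> length_norm M g E nabla p"

definition has_loop :: "('e \<Rightarrow> 'e) \<Rightarrow> (real \<Rightarrow> 'm) \<Rightarrow> bool" where
  "has_loop a \<alpha> \<longleftrightarrow> piecewise_smooth_loop M p \<alpha> \<and> is_parallel_translation M E nabla \<alpha> a"

lemma has_loopD:
  assumes "has_loop a \<alpha>"
  shows "\<exists>T. smooth_subdivision M \<alpha> T" "\<alpha> 0 = p" "\<alpha> 1 = p" "a \<in> extensional Fp"
    "e \<in> Fp \<Longrightarrow> \<exists>s. parallel \<alpha> s \<and> s 0 = e \<and> s 1 = a e"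
proof -
  show 1: "\<exists>T. smooth_subdivision M \<alpha> T" "\<alpha> 0 = p" "\<alpha> 1 = p"
    using assms by (simp_all add: has_loop_def piecewise_smooth_loop_def)
  show "a \<in> extensional Fp" "e \<in> Fp \<Longrightarrow> \<exists>s. parallel \<alpha> s \<and> s 0 = e \<and> s 1 = a e"
    using assms by (simp_all add: has_loop_def is_parallel_translation_def 1)
qed

lemma has_loopI:
  assumes "smooth_subdivision M \<alpha> T" "\<alpha> 0 = p" "\<alpha> 1 = p" "a \<in> extensional Fp"
    "\<And>e. e \<in> Fp \<Longrightarrow> \<exists>s. parallel \<alpha> s \<and> s 0 = e \<and> s 1 = a e"
  shows "has_loop a \<alpha>"
  unfolding has_loop_def piecewise_smooth_loop_def is_parallel_translation_def
  using assms by auto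

lemma Hol_iff: "a \<in> Holp \<longleftrightarrow> a \<in> carrier GLp \<and> (\<exists>\<alpha>. has_loop a \<alpha>)"
  by (simp add: Hol_def has_loop_def)

lemma GL_extensional: "a \<in> carrier GLp \<Longrightarrow> a \<in> extensional Fp"
  by (simp add: GL_iff Bij_imp_extensional)

lemma has_loop_one: "has_loop \<one>\<^bsub>GLp\<^esub> (\<lambda>_. p)"
proof (rule has_loopI[OF subdivision_const[OF pM]])
  show "\<one>\<^bsub>GLp\<^esub> \<in> extensional Fp"
    by (rule GL_extensional[OF monoid.one_closed[OF group.is_monoid[OF GL_group]]])
  fix e assume e: "e \<in> Fp"
  show "\<exists>s. parallel (\<lambda>_. p) s \<and> s 0 = e \<and> s 1 = \<one>\<^bsub>GLp\<^esub> e"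
    using parallel_const[OF e] GL_one[OF e] by (intro exI[of _ "\<lambda>_. e"]) simp
qed simp_all

lemma has_loop_inv:
  assumes a: "a \<in> carrier GLp" and \<alpha>: "has_loop a \<alpha>"
  shows "has_loop (inv\<^bsub>GLp\<^esub> a) (\<lambda>t. \<alpha> (1 - t))" "len (\<lambda>t. \<alpha> (1 - t)) = len \<alpha>"
proof -
  note ia = group.inv_closed[OF GL_group a]
  obtain T where T: "smooth_subdivision M \<alpha> T" using has_loopD(1)[OF \<alpha>] by (elim exE)
  show "has_loop (inv\<^bsub>GLp\<^esub> a) (\<lambda>t. \<alpha> (1 - t))"
  proof (rule has_loopI[OF subdivision_reverse[OF T]])
    fix e assume e: "e \<in> Fp"
    have ie: "(inv\<^bsub>GLp\<^esub> a) e \<in> Fp" by (rule GL_mem[OF ia e])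
    \<comment> \<open>The reversed section has to start at \<open>e\<close>, so the section chosen
      along \<open>\<alpha>\<close> is one that ends there.\<close>
    obtain s where s: "parallel \<alpha> s" "s 0 = (inv\<^bsub>GLp\<^esub> a) e" "s 1 = a ((inv\<^bsub>GLp\<^esub> a) e)"
      using has_loopD(5)[OF \<alpha> ie] by (elim exE conjE)
    show "\<exists>s. parallel (\<lambda>t. \<alpha> (1 - t)) s \<and> s 0 = e \<and> s 1 = (inv\<^bsub>GLp\<^esub> a) e"
      using parallel_reverse[OF s(1)] s(2,3) GL_inv(1)[OF a e] by (intro exI[of _ "\<lambda>t. s (1 - t)"]) simp
  qed (use has_loopD(2,3)[OF \<alpha>] GL_extensional[OF ia] in simp_all)
  show "len (\<lambda>t. \<alpha> (1 - t)) = len \<alpha>" by (rule curve_length_reverse[OF T])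
qed

text \<open>The product applies \<open>b\<close> first, so the loop runs through
  \<open>\<beta>\<close> before \<open>\<alpha>\<close>.\<close>

lemma has_loop_mult:
  assumes a: "a \<in> carrier GLp" and \<alpha>: "has_loop a \<alpha>" and b: "b \<in> carrier GLp" and \<beta>: "has_loop b \<beta>"
  shows "has_loop (a \<otimes>\<^bsub>GLp\<^esub> b) (join_curves \<beta> \<alpha>)"
    "len (join_curves \<beta> \<alpha>) = len \<beta> + len \<alpha>"
proof -
  note ab = monoid.m_closed[OF group.is_monoid[OF GL_group] a b]
  obtain T where T: "smooth_subdivision M \<alpha> T" using has_loopD(1)[OF \<alpha>] by (elim exE)
  obtain S where S: "smooth_subdivision M \<beta> S" using has_loopD(1)[OF \<beta>] by (elim exE)
  have eq: "\<beta> 1 = \<alpha> 0" using has_loopD(2,3)[OF \<alpha>] has_loopD(2,3)[OF \<beta>] by simp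
  show "has_loop (a \<otimes>\<^bsub>GLp\<^esub> b) (join_curves \<beta> \<alpha>)"
  proof (rule has_loopI[OF subdivision_join[OF S T eq]])
    fix e assume e: "e \<in> Fp"
    obtain s where s: "parallel \<beta> s" "s 0 = e" "s 1 = b e"
      using has_loopD(5)[OF \<beta> e] by (elim exE conjE)
    obtain s' where s': "parallel \<alpha> s'" "s' 0 = b e" "s' 1 = a (b e)"
      using has_loopD(5)[OF \<alpha> GL_mem[OF b e]] by (elim exE conjE)
    have "s 1 = s' 0" using s s' by simp
    from parallel_join[OF s(1) s'(1) eq this]
    show "\<exists>s. parallel (join_curves \<beta> \<alpha>) s \<and> s 0 = e \<and> s 1 = (a \<otimes>\<^bsub>GLp\<^esub> b) e"
      using s s' GL_mult[OF a b e] by (intro exI[of _ "join_curves s s'"]) (simp add: join_curves_def)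
  qed (use has_loopD(2,3)[OF \<alpha>] has_loopD(2,3)[OF \<beta>] GL_extensional[OF ab] in \<open>simp_all add: join_curves_def\<close>)
  show "len (join_curves \<beta> \<alpha>) = len \<beta> + len \<alpha>"
    by (rule curve_length_join[OF S T eq])
qed

lemma Hol_subgroup: "subgroup Holp GLp"
proof -
  interpret group GLp by (rule GL_group)
  show ?thesis
  proof (rule subgroupI)
    show "Holp \<subseteq> carrier GLp" using Hol_iff by blast
    show "Holp \<noteq> {}" using Hol_iff[of "\<one>\<^bsub>GLp\<^esub>"] has_loop_one by auto
    fix a assume a: "a \<in> Holp"
    then obtain \<alpha> where \<alpha>: "a \<in> carrier GLp" "has_loop a \<alpha>" unfolding Hol_iff by (elim exE conjE)
    show "inv\<^bsub>GLp\<^esub> a \<in> Holp" unfolding Hol_iff using has_loop_inv(1)[OF \<alpha>] inv_closed[OF \<alpha>(1)] by (intro conjI exI)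
    fix b assume b: "b \<in> Holp"
    then obtain \<beta> where \<beta>: "b \<in> carrier GLp" "has_loop b \<beta>" unfolding Hol_iff by (elim exE conjE)
    show "a \<otimes>\<^bsub>GLp\<^esub> b \<in> Holp"
      unfolding Hol_iff using has_loop_mult(1)[OF \<alpha> \<beta>] m_closed[OF \<alpha>(1) \<beta>(1)] by (intro conjI exI)
  qed
qed

lemma loop_length_nonneg: "has_loop a \<alpha> \<Longrightarrow> len \<alpha> \<ge> 0"
  using curve_length_nonneg has_loopD(1) by (elim exE[OF has_loopD(1)])

lemma lnorm_eq: "lnorm a = Inf {len \<alpha> |\<alpha>. has_loop a \<alpha>}"
  by (simp add: length_norm_def has_loop_def)

lemma loop_lengths_bdd: "bdd_below {len \<alpha> |\<alpha>. has_loop a \<alpha>}"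
  by (rule bdd_belowI[of _ 0]) (auto simp: loop_length_nonneg)

lemma lnorm_le: "has_loop a \<alpha> \<Longrightarrow> lnorm a \<le> len \<alpha>"
  unfolding lnorm_eq by (rule cInf_lower[OF _ loop_lengths_bdd]) blast

lemma lnorm_greatest:
  assumes "a \<in> Holp" "\<And>\<alpha>. has_loop a \<alpha> \<Longrightarrow> x \<le> len \<alpha>"
  shows "x \<le> lnorm a"
  unfolding lnorm_eq by (rule cInf_greatest) (use assms Hol_iff in auto)

lemma lnorm_less:
  assumes "a \<in> Holp" "lnorm a < x" shows "\<exists>\<alpha>. has_loop a \<alpha> \<and> len \<alpha> < x"
proof (rule ccontr)
  assume n: "\<nexists>\<alpha>. has_loop a \<alpha> \<and> len \<alpha> < x"
  have "x \<le> lnorm a"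
  proof (rule lnorm_greatest[OF assms(1)])
    fix \<alpha> assume "has_loop a \<alpha>"
    then show "x \<le> len \<alpha>" using n by (simp add: linorder_not_less)
  qed
  then show False using assms(2) by simp
qed

text \<open>The infimum in the length norm need not be attained; any representing loop shorter than
  \<open>\<delta>\<close> serves, with whatever parallel section it supplies for
  \<open>e\<close>.\<close>

lemma holonomy_near_identity:
  assumes \<rho>: "\<rho> > 0"
  shows "\<exists>\<delta>>0. \<forall>a\<in>Holp. lnorm a < \<delta> \<longrightarrow> (\<forall>e\<in>Fp. norm (\<Phi> (a e) - \<Phi> e) \<le> \<rho> * norm (\<Phi> e))"
proof -
  obtain \<delta> where \<delta>: "\<delta> > 0" and est: "\<forall>\<alpha> s. parallel \<alpha> s \<longrightarrow> \<alpha> 0 = p \<longrightarrow>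
    len \<alpha> < \<delta> \<longrightarrow> norm (\<Phi> (s 1) - \<Phi> (s 0)) \<le> \<rho> * norm (\<Phi> (s 0))"
    using short_loop_holonomy[OF pM triv pU \<rho>] by (elim exE conjE)
  have "norm (\<Phi> (a e) - \<Phi> e) \<le> \<rho> * norm (\<Phi> e)" if a: "a \<in> Holp" "lnorm a < \<delta>" and e: "e \<in> Fp" for a e
  proof -
    obtain \<alpha> where \<alpha>: "has_loop a \<alpha>" "len \<alpha> < \<delta>" using lnorm_less[OF a] by (elim exE conjE)
    obtain s where s: "parallel \<alpha> s" "s 0 = e" "s 1 = a e"
      using has_loopD(5)[OF \<alpha>(1) e] by (elim exE conjE)
    show ?thesis using est[rule_format, OF s(1) has_loopD(2)[OF \<alpha>(1)] \<alpha>(2)] s(2,3) by simp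
  qed
  then show ?thesis using \<delta> by (intro exI[of _ \<delta>]) simp
qed

lemma lnorm_nonneg: "a \<in> Holp \<Longrightarrow> lnorm a \<ge> 0"
  by (rule lnorm_greatest) (simp_all add: loop_length_nonneg)

text \<open>Length norm 0 lies below the \<open>\<delta>\<close> of every \<open>\<rho>\<close>, so
  the relative displacement of each vector is arbitrarily small.\<close>

lemma lnorm_zero_imp_one:
  assumes a: "a \<in> Holp" and 0: "lnorm a = 0"
  shows "a = \<one>\<^bsub>GLp\<^esub>"
proof (rule GL_eqI)
  show "a \<in> carrier GLp" using a by (simp add: Hol_iff)
  show "\<one>\<^bsub>GLp\<^esub> \<in> carrier GLp" by (rule monoid.one_closed[OF group.is_monoid[OF GL_group]])
  fix e assume eF: "e \<in> Fp"
  have small: "norm (\<Phi> (a e) - \<Phi> e) \<le> \<rho> * norm (\<Phi> e)" if "\<rho> > 0" for \<rho>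
    using holonomy_near_identity[OF that] a 0 eF by auto
  have "norm (\<Phi> (a e) - \<Phi> e) \<le> 0"
  proof (rule field_le_epsilon)
    fix d :: real assume d: "d > 0"
    have n: "norm (\<Phi> e) + 1 > 0" by (rule add_nonneg_pos) simp_all
    have "norm (\<Phi> (a e) - \<Phi> e) \<le> d / (norm (\<Phi> e) + 1) * norm (\<Phi> e)"
      by (rule small) (use d n in simp)
    also have "\<dots> \<le> d" using d n by (simp add: field_simps)
    finally show "norm (\<Phi> (a e) - \<Phi> e) \<le> 0 + d" by simp
  qed
  then have "\<Phi> (a e) = \<Phi> e" by simp
  then have "a e = e" using a by (intro \<Phi>_inj[OF GL_mem[OF _ eF] eF]) (simp_all add: Hol_iff)
  then show "a e = \<one>\<^bsub>GLp\<^esub> e" by (simp add: GL_one[OF eF])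
qed

lemma lnorm_inv_le:
  assumes "a \<in> Holp" shows "lnorm (inv\<^bsub>GLp\<^esub> a) \<le> lnorm a"
proof (rule lnorm_greatest[OF assms])
  fix \<alpha> assume \<alpha>: "has_loop a \<alpha>"
  have "a \<in> carrier GLp" using assms by (simp add: Hol_iff)
  from has_loop_inv[OF this \<alpha>] show "lnorm (inv\<^bsub>GLp\<^esub> a) \<le> len \<alpha>"
    using lnorm_le by metis
qed

text \<open>The two infima are taken one after the other: over the loops for \<open>a\<close> with
  the loop for \<open>b\<close> fixed, then over the latter.\<close>

lemma lnorm_mult:
  assumes a: "a \<in> Holp" and b: "b \<in> Holp"
  shows "lnorm (a \<otimes>\<^bsub>GLp\<^esub> b) \<le> lnorm a + lnorm b"
proof -
  have ab: "a \<in> carrier GLp" "b \<in> carrier GLp" using assms by (simp_all add: Hol_iff)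
  have 1: "lnorm (a \<otimes>\<^bsub>GLp\<^esub> b) - len \<beta> \<le> lnorm a" if \<beta>: "has_loop b \<beta>" for \<beta>
  proof (rule lnorm_greatest[OF a])
    fix \<alpha> assume \<alpha>: "has_loop a \<alpha>"
    show "lnorm (a \<otimes>\<^bsub>GLp\<^esub> b) - len \<beta> \<le> len \<alpha>"
      using lnorm_le[OF has_loop_mult(1)[OF ab(1) \<alpha> ab(2) \<beta>]] has_loop_mult(2)[OF ab(1) \<alpha> ab(2) \<beta>] by simp
  qed
  have "lnorm (a \<otimes>\<^bsub>GLp\<^esub> b) - lnorm a \<le> lnorm b"
    by (rule lnorm_greatest[OF b]) (use 1 in \<open>simp add: algebra_simps\<close>)
  then show ?thesis by simp
qed

lemma group_length_Hol: "group_length GLp Holp lnorm"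
proof -
  interpret group GLp by (rule GL_group)
  show ?thesis
  proof (intro group_length.intro[OF GL_group] group_length_axioms.intro)
    show "subgroup Holp GLp" by (rule Hol_subgroup)
    fix a assume a: "a \<in> Holp"
    show "0 \<le> lnorm a" by (rule lnorm_nonneg[OF a])
    show "lnorm a = 0 \<longleftrightarrow> a = \<one>\<^bsub>GLp\<^esub>"
    proof
      assume "a = \<one>\<^bsub>GLp\<^esub>"
      then show "lnorm a = 0"
        using lnorm_le[OF has_loop_one] curve_length_const[OF pM] lnorm_nonneg[OF a] by simp
    qed (rule lnorm_zero_imp_one[OF a])
    have ia: "inv\<^bsub>GLp\<^esub> a \<in> Holp" by (rule subgroup.m_inv_closed[OF Hol_subgroup a])
    \<comment> \<open>Since inversion is an involution, \<open>lnorm_inv_le\<close> applied to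
      \<open>a\<close> and to its inverse gives equality.\<close>
    have "inv\<^bsub>GLp\<^esub> (inv\<^bsub>GLp\<^esub> a) = a" using a by (simp add: Hol_iff)
    then show "lnorm (inv\<^bsub>GLp\<^esub> a) = lnorm a" using lnorm_inv_le[OF a] lnorm_inv_le[OF ia] by simp
    fix b assume b: "b \<in> Holp"
    show "lnorm (a \<otimes>\<^bsub>GLp\<^esub> b) \<le> lnorm a + lnorm b" by (rule lnorm_mult[OF a b])
  qed
qed

section \<open>The length metric and the topologies on the holonomy group\<close>

abbreviation "ld \<equiv> length_dist M g E nabla p"

sublocale HL: group_length GLp Holp lnorm
  by (rule group_length_Hol)

lemma ld_eq: "HL.ldist = ld"
  by (intro ext) (simp add: HL.ldist_def length_dist_def)

lemma Metric_space_ld: "Metric_space Holp ld"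
  using HL.Metric_space_ldist by (simp only: ld_eq)

sublocale MH: Metric_space Holp ld
  by (rule Metric_space_ld)

text \<open>With \<open>?c\<close> the quotient, \<open>b e\<close> equals \<open>a (?c e)\<close>,
  and \<open>?c\<close> is close to the identity. The Lipschitz constant \<open>D\<close> of
  \<open>a\<close> is compensated by asking for \<open>\<rho> / (D + 1)\<close> there.\<close>

lemma holonomy_continuous:
  assumes a: "a \<in> Holp" and \<rho>: "\<rho> > 0"
  shows "\<exists>\<delta>>0. \<forall>b\<in>Holp. ld a b < \<delta> \<longrightarrow> (\<forall>e\<in>Fp. norm (\<Phi> (a e) - \<Phi> (b e)) \<le> \<rho> * norm (\<Phi> e))"
proof -
  have aG: "a \<in> carrier GLp" using a by (simp add: Hol_iff)
  obtain D where D: "D \<ge> 0" "\<And>e e'. e \<in> Fp \<Longrightarrow> e' \<in> Fp \<Longrightarrow> norm (\<Phi> (a e) - \<Phi> (a e')) \<le> D * norm (\<Phi> e - \<Phi> e')"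
    using GL_bound[OF aG] by metis
  have "\<rho> / (D + 1) > 0" using \<rho> D(1) by simp
  then obtain \<delta> where \<delta>: "\<delta> > 0" and est: "\<forall>a\<in>Holp. lnorm a < \<delta> \<longrightarrow>
      (\<forall>e\<in>Fp. norm (\<Phi> (a e) - \<Phi> e) \<le> \<rho> / (D + 1) * norm (\<Phi> e))"
    using holonomy_near_identity by blast
  have "norm (\<Phi> (a e) - \<Phi> (b e)) \<le> \<rho> * norm (\<Phi> e)"
    if b: "b \<in> Holp" "ld a b < \<delta>" and e: "e \<in> Fp" for b e
  proof -
    have bG: "b \<in> carrier GLp" using b by (simp add: Hol_iff)
    let ?c = "inv\<^bsub>GLp\<^esub> a \<otimes>\<^bsub>GLp\<^esub> b"
    have c: "?c \<in> Holp" by (intro HL.H_closed a b)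
    then have cF: "?c e \<in> Fp" using GL_mem[OF _ e] by (simp add: Hol_iff)
    have "a (?c e) = b e"
      unfolding GL_mult[OF HL.inv_closed[OF aG] bG e] by (rule GL_inv(1)[OF aG GL_mem[OF bG e]])
    then have "norm (\<Phi> (a e) - \<Phi> (b e)) \<le> D * norm (\<Phi> e - \<Phi> (?c e))" using D(2)[OF e cF] by simp
    also have "\<dots> \<le> D * (\<rho> / (D + 1) * norm (\<Phi> e))"
    proof (rule mult_left_mono[OF _ D(1)])
      have "lnorm ?c < \<delta>" using a b by (simp add: length_dist_def)
      then show "norm (\<Phi> e - \<Phi> (?c e)) \<le> \<rho> / (D + 1) * norm (\<Phi> e)"
        using est c e by (simp add: norm_minus_commute)
    qed
    also have "\<dots> = (D / (D + 1)) * (\<rho> * norm (\<Phi> e))" by simp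
    also have "\<dots> \<le> 1 * (\<rho> * norm (\<Phi> e))" by (rule mult_right_mono) (use D(1) \<rho> in simp_all)
    finally show ?thesis by simp
  qed
  then show ?thesis using \<delta> by (intro exI[of _ \<delta>]) simp
qed

lemma op_dist_small:
  assumes a: "a \<in> Holp" and r: "r > 0"
  shows "\<exists>\<delta>>0. \<forall>b\<in>Holp. ld a b < \<delta> \<longrightarrow> op_norm_dist a b < r"
proof -
  have aG: "a \<in> carrier GLp" using a by (simp add: Hol_iff)
  obtain k C where k: "k > 0" "C > 0" "\<And>u. u \<in> fmodel E \<Longrightarrow> norm u \<le> k * hnorm u"
    "\<And>u. u \<in> fmodel E \<Longrightarrow> hnorm u \<le> C * norm u" using hnorm_bounds by metis
  \<comment> \<open>On the unit ball the Euclidean norm is at most \<open>k\<close>, and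
    \<open>C\<close> converts back to \<open>hnorm\<close>. The factor 2 leaves room for strictness,
    as a supremum yields only a weak inequality.\<close>
  define \<rho> where "\<rho> = r / (2 * C * k)"
  have \<rho>: "\<rho> > 0" "C * (\<rho> * k) = r / 2" using r k by (simp_all add: \<rho>_def)
  obtain \<delta> where \<delta>: "\<delta> > 0" and est: "\<forall>b\<in>Holp. ld a b < \<delta> \<longrightarrow>
      (\<forall>e\<in>Fp. norm (\<Phi> (a e) - \<Phi> (b e)) \<le> \<rho> * norm (\<Phi> e))"
    using holonomy_continuous[OF a \<rho>(1)] by blast
  have "op_norm_dist a b < r" if b: "b \<in> Holp" "ld a b < \<delta>" for b
  proof -
    have bG: "b \<in> carrier GLp" using b by (simp add: Hol_iff)
    have "op_norm_dist a b \<le> r / 2"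
    proof (rule op_dist_leI[OF aG bG])
      fix e assume eb: "e \<in> uball"
      then have e: "e \<in> Fp" by simp
      have "hnorm (\<Phi> e) \<le> 1" using eb unit_ball_iff[OF e] by simp
      then have "k * hnorm (\<Phi> e) \<le> k * 1" by (rule mult_left_mono) (use k(1) in simp)
      then have n: "norm (\<Phi> e) \<le> k" using k(3)[OF \<Phi>_mem[OF e]] by simp
      have "vdist a b e \<le> C * norm (\<Phi> (a e) - \<Phi> (b e))"
        unfolding vdist_def by (rule k(4)[OF diff_mem[OF aG bG e]])
      also have "\<dots> \<le> C * (\<rho> * norm (\<Phi> e))"
        by (rule mult_left_mono) (use est b e k(2) in simp_all)
      also have "\<dots> \<le> C * (\<rho> * k)" using n k(2) \<rho>(1) by (intro mult_left_mono) simp_all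
      finally show "vdist a b e \<le> r / 2" by (simp only: \<rho>(2))
    qed
    then show ?thesis using r by simp
  qed
  then show ?thesis using \<delta> by (intro exI[of _ \<delta>]) simp
qed

text \<open>By \<open>op_dist_small\<close>, the trace on the holonomy group of every operator-norm
  ball around one of its elements contains a length ball around the same element.\<close>

lemma GL_topology_coarser:
  assumes "openin (subtopology (GL_topology E h p) Holp) W"
  shows "openin MH.mtopology W"
proof -
  interpret O: Metric_space "carrier GLp" "op_norm_dist" by (rule Metric_space_op_dist)
  obtain V where V: "openin O.mtopology V" "W = V \<inter> Holp"
    using assms unfolding openin_subtopology GL_topology_def by (elim exE conjE)
  show ?thesis
    unfolding MH.openin_mtopology
  proof (intro conjI allI impI)
    show "W \<subseteq> Holp" using V(2) by simp
    fix a assume "a \<in> W"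
    then have a: "a \<in> V" "a \<in> Holp" using V(2) by auto
    then obtain r where r: "r > 0" "O.mball a r \<subseteq> V" using V(1) unfolding O.openin_mtopology by meson
    obtain \<delta> where \<delta>: "\<delta> > 0" "\<forall>b\<in>Holp. ld a b < \<delta> \<longrightarrow> op_norm_dist a b < r"
      using op_dist_small[OF a(2) r(1)] by (elim exE conjE)
    have "MH.mball a \<delta> \<subseteq> W"
    proof
      fix b assume "b \<in> MH.mball a \<delta>"
      then have b: "b \<in> Holp" "ld a b < \<delta>" by auto
      then have "b \<in> O.mball a r" using \<delta>(2) a(2) by (simp add: Hol_iff)
      then show "b \<in> W" using r(2) V(2) b(1) by blast
    qed
    then show "\<exists>r>0. MH.mball a r \<subseteq> W" using \<delta>(1) by (intro exI[of _ \<delta>] conjI)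
  qed
qed

lemma lnorm_continuous: "continuous_map MH.mtopology euclideanreal lnorm"
proof (rule MH.continuous_map_mtopology_euclideanI)
  fix a and e :: real assume a: "a \<in> Holp" and e: "e > 0"
  have "dist (lnorm a) (lnorm b) < e" if "b \<in> Holp" "ld a b < e" for b
    using HL.L_diff_le[OF a that(1)] that(2) by (simp add: ld_eq dist_real_def)
  then show "\<exists>\<delta>>0. \<forall>b\<in>Holp. ld a b < \<delta> \<longrightarrow> dist (lnorm a) (lnorm b) < e"
    using e by (intro exI[of _ e]) simp
qed

text \<open>Continuity for a fixed vector; linearity later upgrades it to joint continuity.\<close>

lemma orbit_continuous:
  assumes e: "e \<in> Fp"
  shows "continuous_map MH.mtopology euclidean (\<lambda>a. \<Phi> (a e))"
proof (rule MH.continuous_map_mtopology_euclideanI)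
  fix a and r :: real assume a: "a \<in> Holp" and r: "r > 0"
  define \<rho> where "\<rho> = r / (norm (\<Phi> e) + 1)"
  have n: "norm (\<Phi> e) + 1 > 0" by (rule add_nonneg_pos) simp_all
  have \<rho>: "\<rho> > 0" "\<rho> * norm (\<Phi> e) < r" using r n by (simp_all add: \<rho>_def field_simps)
  obtain \<delta> where \<delta>: "\<delta> > 0" and est: "\<forall>b\<in>Holp. ld a b < \<delta> \<longrightarrow>
      (\<forall>e\<in>Fp. norm (\<Phi> (a e) - \<Phi> (b e)) \<le> \<rho> * norm (\<Phi> e))"
    using holonomy_continuous[OF a \<rho>(1)] by blast
  have "dist (\<Phi> (a e)) (\<Phi> (b e)) < r" if b: "b \<in> Holp" "ld a b < \<delta>" for b
    using bspec[OF est b(1), rule_format, OF b(2) e] \<rho>(2) by (simp add: dist_norm)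
  then show "\<exists>\<delta>>0. \<forall>b\<in>Holp. ld a b < \<delta> \<longrightarrow> dist (\<Phi> (a e)) (\<Phi> (b e)) < r"
    using \<delta> by (intro exI[of _ \<delta>]) simp
qed

section \<open>Continuity of the action on the fibre\<close>

abbreviation "Ep \<equiv> subtopology (etop E) Fp"

lemma topspace_Ep: "topspace Ep = Fp"
  by (auto simp: fibre_def)

text \<open>The bundle trivialization restricted to the fibre over \<open>p\<close> identifies it
  topologically with \<open>fmodel E\<close>; the inverse sends \<open>v\<close> to the preimage of
  \<open>(p, v)\<close>.\<close>

lemma fibre_homeo:
  shows "continuous_map Ep euclidean \<Phi>" "continuous_map (top_of_set (fmodel E)) Ep (\<lambda>v. \<kappa> v)"
proof -
  let ?X = "{e \<in> topspace (etop E). proj E e \<in> U}"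
  let ?Y = "prod_topology (subtopology (mtop M) U) (top_of_set (fmodel E))"
  let ?f = "\<lambda>e. (proj E e, \<Phi> e)"
  have sub: "Fp \<subseteq> ?X" using pU by (auto simp: fibre_def)
  note hm = triv_conditions(2)[OF triv]
  have "continuous_map (subtopology (etop E) ?X) ?Y ?f" by (rule homeomorphic_imp_continuous_map[OF hm])
  then have "continuous_map (subtopology (etop E) ?X) (top_of_set (fmodel E)) (snd \<circ> ?f)"
    by (rule continuous_map_compose[OF _ continuous_map_snd])
  then have "continuous_map (subtopology (etop E) ?X) euclidean \<Phi>"
    by (simp add: o_def continuous_map_in_subtopology)
  then show "continuous_map Ep euclidean \<Phi>" by (rule continuous_map_from_subtopology_mono[OF _ sub])
  obtain k where k: "homeomorphic_maps (subtopology (etop E) ?X) ?Y ?f k"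
    using hm unfolding homeomorphic_map_maps by (rule exE)
  have "continuous_map (top_of_set (fmodel E)) ?Y (\<lambda>v. (p, v))"
  proof (rule continuous_map_pairedI)
    show "continuous_map (top_of_set (fmodel E)) (subtopology (mtop M) U) (\<lambda>v. p)"
      unfolding continuous_map_const using pU pM by simp
    show "continuous_map (top_of_set (fmodel E)) (top_of_set (fmodel E)) (\<lambda>v. v)"
      using continuous_map_id[of "top_of_set (fmodel E)"] by (simp add: id_def)
  qed
  moreover have "continuous_map ?Y (subtopology (etop E) ?X) k" using k by (simp add: homeomorphic_maps_def)
  ultimately have c: "continuous_map (top_of_set (fmodel E)) (subtopology (etop E) ?X) (k \<circ> (\<lambda>v. (p, v)))"
    by (rule continuous_map_compose)
  have k\<kappa>: "k (p, v) = \<kappa> v" if v: "v \<in> fmodel E" for v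
  proof -
    have m: "\<kappa> v \<in> topspace (subtopology (etop E) ?X)" using \<kappa>_mem[OF v] sub by (auto simp: fibre_def)
    have "k (?f (\<kappa> v)) = \<kappa> v" using k m by (simp add: homeomorphic_maps_def)
    moreover have "?f (\<kappa> v) = (p, v)" using \<kappa>_mem[OF v] \<Phi>_\<kappa>[OF v] by (simp add: fibre_def)
    ultimately show ?thesis by simp
  qed
  have "continuous_map (top_of_set (fmodel E)) (subtopology (etop E) ?X) (\<lambda>v. \<kappa> v)"
    by (rule continuous_map_eq[OF c]) (simp add: k\<kappa>)
  then have "continuous_map (top_of_set (fmodel E)) (etop E) (\<lambda>v. \<kappa> v)"
    by (simp add: continuous_map_in_subtopology)
  then show "continuous_map (top_of_set (fmodel E)) Ep (\<lambda>v. \<kappa> v)"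
    unfolding continuous_map_in_subtopology using \<kappa>_mem by (simp add: image_subset_iff)
qed

text \<open>Expanding \<open>\<Phi> e\<close> in a finite frame writes \<open>\<Phi> (a e)\<close>
  as a sum of products of a function of \<open>e\<close> and the orbit map of a fixed frame vector,
  so joint continuity follows from \<open>orbit_continuous\<close>.\<close>

lemma action_continuous: "continuous_map (prod_topology MH.mtopology Ep) Ep (\<lambda>(a, e). a e)"
proof -
  let ?P = "prod_topology MH.mtopology Ep"
  obtain B where B: "parseval_frame (fmodel E) B" using parseval_frame_exists[OF fmodel_subspace] .
  have fB: "finite B" "B \<subseteq> fmodel E" using B by (simp_all add: parseval_frame_def)
  let ?F = "\<lambda>z. \<Sum>b\<in>B. (\<Phi> (snd z) \<bullet> b) *\<^sub>R \<Phi> (fst z (\<kappa> b))"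
  have tP: "topspace ?P = Holp \<times> Fp" by (simp only: topspace_prod_topology MH.topspace_mtopology topspace_Ep)
  have eq: "\<Phi> (a e) = ?F (a, e)" if "a \<in> Holp" "e \<in> Fp" for a e
  proof -
    have aG: "a \<in> carrier GLp" using that by (simp add: Hol_iff)
    show ?thesis
      using lin_on_expand[OF GL_lin_on[OF aG] fmodel_subspace B \<Phi>_mem[OF that(2)]] \<kappa>_\<Phi>[OF that(2)] by simp
  qed
  have cF: "continuous_map ?P euclidean ?F"
  proof (rule continuous_map_sum[OF fB(1)])
    fix b assume "b \<in> B"
    then have b: "\<kappa> b \<in> Fp" using fB(2) by (intro \<kappa>_mem) blast
    have 1: "continuous_map ?P euclidean (\<lambda>z. \<Phi> (snd z))"
      using continuous_map_compose[OF continuous_map_snd fibre_homeo(1), of MH.mtopology] by (simp add: o_def)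
    have 2: "continuous_map ?P euclidean (\<lambda>z. \<Phi> (fst z (\<kappa> b)))"
      using continuous_map_compose[OF continuous_map_fst orbit_continuous[OF b], of Ep] by (simp add: o_def)
    \<comment> \<open>Continuity is tested by limits at the points of the product, where the rules
      for inner product and scaling apply.\<close>
    show "continuous_map ?P euclidean (\<lambda>z. (\<Phi> (snd z) \<bullet> b) *\<^sub>R \<Phi> (fst z (\<kappa> b)))"
      unfolding continuous_map_atin limitin_canonical_iff
      by (intro ballI tendsto_scaleR tendsto_inner tendsto_const
          bspec[OF 1[unfolded continuous_map_atin limitin_canonical_iff]]
          bspec[OF 2[unfolded continuous_map_atin limitin_canonical_iff]])
  qed
  have "continuous_map ?P euclidean (\<lambda>z. \<Phi> (fst z (snd z)))"
  proof (rule continuous_map_eq[OF cF])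
    fix z assume "z \<in> topspace ?P"
    then have "fst z \<in> Holp" "snd z \<in> Fp" unfolding tP by (simp_all add: mem_Times_iff)
    from eq[OF this] show "?F z = \<Phi> (fst z (snd z))" by simp
  qed
  moreover have "\<Phi> (fst z (snd z)) \<in> fmodel E" if "z \<in> topspace ?P" for z
  proof -
    have z: "fst z \<in> carrier GLp" "snd z \<in> Fp" using that unfolding tP by (simp_all add: mem_Times_iff Hol_iff)
    show ?thesis by (rule \<Phi>_mem[OF GL_mem[OF z]])
  qed
  ultimately have "continuous_map ?P (top_of_set (fmodel E)) (\<lambda>z. \<Phi> (fst z (snd z)))"
    by (simp add: continuous_map_in_subtopology image_subset_iff Pi_iff)
  from continuous_map_compose[OF this fibre_homeo(2)]
  have "continuous_map ?P Ep (\<lambda>z. \<kappa> (\<Phi> (fst z (snd z))))" by (simp add: o_def)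
  then show ?thesis
  proof (rule continuous_map_eq)
    fix z assume "z \<in> topspace ?P"
    then have z: "fst z \<in> carrier GLp" "snd z \<in> Fp" unfolding tP by (simp_all add: mem_Times_iff Hol_iff)
    show "\<kappa> (\<Phi> (fst z (snd z))) = (case z of (a, e) \<Rightarrow> a e)"
      unfolding \<kappa>_\<Phi>[OF GL_mem[OF z]] by (simp add: case_prod_unfold)
  qed
qed

end

theorem theorem3p26:
  fixes M :: "('m, 'v::euclidean_space) manifold"
    and g :: "'m \<Rightarrow> ('m, 'v) tvec \<Rightarrow> ('m, 'v) tvec \<Rightarrow> real"
    and E :: "('m, 'e, 'f::euclidean_space) vbundle"
    and h :: "'e \<Rightarrow> 'e \<Rightarrow> real"
    and nabla :: "('m \<Rightarrow> 'e) \<Rightarrow> 'm \<Rightarrow> ('m, 'v) tvec \<Rightarrow> 'e"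
    and p :: 'm
  assumes "riemannian_manifold M g"
    and "vector_bundle M E"
    and "bundle_metric M E h"
    and "metric_connection M E h nabla"
    and "p \<in> topspace (mtop M)"
  shows "let H = Hol M E nabla p;
             L = length_norm M g E nabla p;
             d = length_dist M g E nabla p;
             Ep = subtopology (etop E) (fibre E p)
         in Metric_space H d \<and>
            (\<exists>T. T = Metric_space.mtopology H d \<and>
                 topspace T = H \<and>
                 metrizable_space T \<and>
                 (\<forall>U. openin (subtopology (GL_topology E h p) H) U \<longrightarrow> openin T U) \<and>
                 continuous_map T euclideanreal L \<and>
                 continuous_map (prod_topology T Ep) Ep (\<lambda>(a, e). a e))"
proof -
  have conn: "connection M E nabla" using assms(4) unfolding metric_connection_def by (rule conjunct1)
  interpret B: bundle_connection M g E h nabla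
    by unfold_locales (rule assms(1), rule assms(2), rule assms(3), rule conn)
  \<comment> \<open>Any trivialization around \<open>p\<close> serves; the conclusion does not
    mention it.\<close>
  obtain U \<Phi> where tr: "(U, \<Phi>) \<in> trivs E" "p \<in> U" using B.triv_cover[OF assms(5)] .
  interpret bundle_fibre M g E h nabla p U \<Phi>
    by unfold_locales (rule tr)+
  show ?thesis
    unfolding Let_def
    by (intro conjI exI[of _ MH.mtopology] allI impI refl Metric_space_ld MH.topspace_mtopology
        MH.metrizable_space_mtopology GL_topology_coarser lnorm_continuous action_continuous)
qed

end
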